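(* Suppose $1<p<\infty$ and $p\neq 2$. Then there exists a Ritt operator $T$ on the Schatten space $S^p$, with $\mathrm{Ran}(I-T)$ dense in $S^p$, which admits a completely bounded $H^\infty(B_\gamma)$ functional calculus for some $\gamma\in\,]0,\frac{\pi}{2}[$, such that $$\sup\Big\{\frac{\|x\|_{p,T,c,1}}{\|x\|_{p,T,r,1}}: x\in S^p\Big\}=\infty\ \text{ if } 2<p<\infty,\qquad \sup\Big\{\frac{\|x\|_{p,T,r,1}}{\|x\|_{p,T,c,1}}: x\in S^p\Big\}=\infty\ \text{ if } 1<p<2.$$ Moreover, the same result holds with the roles of $\|\cdot\|_{p,T,c,1}$ and $\|\cdot\|_{p,T,r,1}$ switched: there also exists a (possibly different) Ritt operator $T$ on $S^p$ with $\mathrm{Ran}(I-T)$ dense in $S^p$ and admitting a completely bounded $H^\infty(B_\gamma)$ functional calculus for some $\gamma\in\,]0,\frac{\pi}{2}[$, such that $\sup\{\|x\|_{p,T,r,1}/\|x\|_{p,T,c,1}: x\in S^p\}=\infty$ if $2<p<\infty$, and $\sup\{\|x\|_{p,T,c,1}/\|x\|_{p,T,r,1}: x\in S^p\}=\infty$ if $1<p<2$.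
   Context: $S^p$ is the Schatten class of compact operators $x$ on $\ell^2$ with $\|x\|_{S^p}=(\mathrm{Tr}(x^*x)^{p/2})^{1/p}<\infty$; it is $L^p(B(\ell^2))$ for the canonical trace. $S^p(\ell^2_c)$ and $S^p(\ell^2_r)$ are the completions of $S^p\otimes\ell^2$ for the norms determined by $\|\sum_{k=1}^n x_k\otimes e_k\|_{S^p(\ell^2_c)}=\|(\sum_k|x_k|^2)^{1/2}\|_{S^p}$ and $\|\sum_{k=1}^n x_k\otimes e_k\|_{S^p(\ell^2_r)}=\|(\sum_k|x_k^*|^2)^{1/2}\|_{S^p}$, where $|x|=(x^*x)^{1/2}$ and $(e_k)_{k\ge1}$ is the canonical basis of $\ell^2$; they are identified with spaces of sequences $(x_k)_{k\ge1}$ in $S^p$ such that $\sum_k x_k\otimes e_k$ converges in the respective norm. A bounded operator $T$ on a Banach space is a Ritt operator if the sets $\{T^n: n\ge0\}$ and $\{n(T^n-T^{n-1}): n\geq1\}$ are bounded. For a Ritt operator $T$ on $S^p$ and $x\in S^p$, $\|x\|_{p,T,c,1}$ is the norm of $\big(k^{1/2}T^{k-1}(I-T)x\big)_{k\ge1}$ in $S^p(\ell^2_c)$ if this sequence belongs to that space, and $+\infty$ otherwise; $\|x\|_{p,T,r,1}$ is defined in the same way with $S^p(\ell^2_r)$. The assertion that a supremum of quotients $\sup\{N_1(x)/N_2(x): x\in S^p\}$ equals $\infty$ means that there is no finite constant $K$ such that $N_1(x)\le K N_2(x)$ for all $x\in S^p$. For $\gamma\in\,]0,\frac{\pi}{2}[$,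 $B_\gamma$ is the interior of the convex hull of $1$ and the disc $D(0,\sin\gamma)$, and $\|\varphi\|_{H^\infty(B_\gamma)}=\sup_{z\in B_\gamma}|\varphi(z)|$. A linear map $V$ on $S^p$ is completely bounded if $I_{S^p}\otimes V$ extends to a bounded operator on $S^p(S^p)=L^p(B(\ell^2)\overline{\otimes}B(\ell^2))$, and $\|V\|_{cb}$ is the norm of this extension. $T$ admits a completely bounded $H^\infty(B_\gamma)$ functional calculus if there is a constant $K$ with $\|\varphi(T)\|_{cb}\le K\|\varphi\|_{H^\infty(B_\gamma)}$ for every complex polynomial $\varphi$. *)

theory Defs
  imports "HOL-Analysis.Analysis" "HOL-Computational_Algebra.Polynomial"
begin

section \<open>The complex Hilbert space of square-summable families\<close>

text \<open>The index type is a parameter because both the space over \<open>nat\<close> and its Hilbert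
  tensor square, the space over \<open>nat \<times> nat\<close>, are needed.\<close>

typedef 'i ell2 = "{f :: 'i \<Rightarrow> complex. (\<lambda>i. (cmod (f i))\<^sup>2) summable_on UNIV}"
  morphisms ell2_nth Abs_ell2
  by (rule exI[of _ "\<lambda>_. 0"]) simp

setup_lifting type_definition_ell2

lemma square_summable_mult:
  fixes f g :: "'i \<Rightarrow> complex"
  assumes f: "(\<lambda>i. (cmod (f i))\<^sup>2) summable_on UNIV" and g: "(\<lambda>i. (cmod (g i))\<^sup>2) summable_on UNIV"
  shows "(\<lambda>i. cnj (f i) * g i) summable_on UNIV"
proof -
  have le: "cmod (cnj (f i) * g i) \<le> norm ((cmod (f i))\<^sup>2 + (cmod (g i))\<^sup>2)" for i
  proof -
    have "0 \<le> (cmod (f i) - cmod (g i))\<^sup>2" by simp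
    then have "2 * (cmod (f i) * cmod (g i)) \<le> (cmod (f i))\<^sup>2 + (cmod (g i))\<^sup>2"
      by (simp add: power2_diff)
    moreover have "0 \<le> cmod (f i) * cmod (g i)" by simp
    ultimately have "cmod (f i) * cmod (g i) \<le> (cmod (f i))\<^sup>2 + (cmod (g i))\<^sup>2" by linarith
    then show ?thesis by (simp add: norm_mult)
  qed
  have "(\<lambda>i. (cmod (f i))\<^sup>2 + (cmod (g i))\<^sup>2) summable_on UNIV"
    using summable_on_add[OF f g] .
  then have "(\<lambda>i. norm ((cmod (f i))\<^sup>2 + (cmod (g i))\<^sup>2)) summable_on UNIV"
    by simp
  then have "(\<lambda>i. norm (cnj (f i) * g i)) summable_on UNIV"
    by (rule Infinite_Sum.abs_summable_on_comparison_test) (rule le)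
  then show ?thesis by (rule abs_summable_summable)
qed

lemma square_summable_add:
  fixes f g :: "'i \<Rightarrow> complex"
  assumes f: "(\<lambda>i. (cmod (f i))\<^sup>2) summable_on UNIV" and g: "(\<lambda>i. (cmod (g i))\<^sup>2) summable_on UNIV"
  shows "(\<lambda>i. (cmod (f i + g i))\<^sup>2) summable_on UNIV"
proof -
  have le: "(cmod (f i + g i))\<^sup>2 \<le> 2 * ((cmod (f i))\<^sup>2 + (cmod (g i))\<^sup>2)" for i
  proof -
    have "(cmod (f i + g i))\<^sup>2 \<le> (cmod (f i) + cmod (g i))\<^sup>2"
      by (intro power_mono norm_triangle_ineq) simp
    moreover have "0 \<le> (cmod (f i) - cmod (g i))\<^sup>2" by simp
    ultimately show ?thesis by (simp add: power2_diff power2_sum)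
  qed
  show ?thesis
    by (rule summable_on_comparison_test[OF summable_on_cmult_right[OF summable_on_add[OF f g]]])
       (auto intro: le)
qed

lemma square_summable_cmult:
  fixes f :: "'i \<Rightarrow> complex"
  assumes "(\<lambda>i. (cmod (f i))\<^sup>2) summable_on UNIV"
  shows "(\<lambda>i. (cmod (c * f i))\<^sup>2) summable_on UNIV"
  using summable_on_cmult_right[OF assms, of "(cmod c)\<^sup>2"] by (simp add: norm_mult power_mult_distrib)

text \<open>The inner product is conjugate-linear in its first argument.\<close>

lift_definition cinner :: "'i ell2 \<Rightarrow> 'i ell2 \<Rightarrow> complex"
  is "\<lambda>f g. \<Sum>\<^sub>\<infinity>i. cnj (f i) * g i" .

lift_definition cscale :: "complex \<Rightarrow> 'i ell2 \<Rightarrow> 'i ell2"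
  is "\<lambda>c f i. c * f i"
  by (rule square_summable_cmult)

lift_definition ket :: "'i \<Rightarrow> 'i ell2" is "\<lambda>i j. if i = j then 1 else 0"
proof -
  fix i :: 'i
  have "(\<lambda>j. (cmod (if i = j then 1 else 0))\<^sup>2) summable_on {i}" by simp
  then show "(\<lambda>j. (cmod (if i = j then 1 else 0))\<^sup>2) summable_on UNIV"
    by (subst summable_on_cong_neutral[where T = "{i}"]) auto
qed

instantiation ell2 :: (type) real_inner
begin

lift_definition zero_ell2 :: "'a ell2" is "\<lambda>_. 0" by simp

lift_definition plus_ell2 :: "'a ell2 \<Rightarrow> 'a ell2 \<Rightarrow> 'a ell2" is "\<lambda>f g i. f i + g i"
  by (rule square_summable_add)

lift_definition uminus_ell2 :: "'a ell2 \<Rightarrow> 'a ell2" is "\<lambda>f i. - f i" by simp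

lift_definition minus_ell2 :: "'a ell2 \<Rightarrow> 'a ell2 \<Rightarrow> 'a ell2" is "\<lambda>f g i. f i - g i"
  using square_summable_add[where g = "\<lambda>i. - g i" for g] by force

lift_definition scaleR_ell2 :: "real \<Rightarrow> 'a ell2 \<Rightarrow> 'a ell2" is "\<lambda>r f i. r *\<^sub>R f i"
  by (simp add: scaleR_conv_of_real square_summable_cmult)

definition inner_ell2 :: "'a ell2 \<Rightarrow> 'a ell2 \<Rightarrow> real" where
  "inner_ell2 u v = Re (cinner u v)"

definition norm_ell2 :: "'a ell2 \<Rightarrow> real" where
  "norm_ell2 u = sqrt (inner u u)"

definition dist_ell2 :: "'a ell2 \<Rightarrow> 'a ell2 \<Rightarrow> real" where
  "dist_ell2 u v = norm (u - v)"

definition sgn_ell2 :: "'a ell2 \<Rightarrow> 'a ell2" where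
  "sgn_ell2 u = inverse (norm u) *\<^sub>R u"

definition uniformity_ell2 :: "('a ell2 \<times> 'a ell2) filter" where
  "uniformity_ell2 = (INF e\<in>{0<..}. principal {(u, v). dist u v < e})"

definition open_ell2 :: "'a ell2 set \<Rightarrow> bool" where
  "open_ell2 S = (\<forall>u\<in>S. \<forall>\<^sub>F (u', v) in uniformity. u' = u \<longrightarrow> v \<in> S)"

instance
proof
  fix u v w :: "'a ell2" and r s :: real
  show "u + v + w = u + (v + w)" by transfer (simp add: add.assoc)
  show "u + v = v + u" by transfer (simp add: add.commute)
  show "0 + u = u" by transfer simp
  show "- u + u = 0" by transfer simp
  show "u - v = u + - v" by transfer simp
  show "r *\<^sub>R (u + v) = r *\<^sub>R u + r *\<^sub>R v" by transfer (simp add: scaleR_right_distrib)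
  show "(r + s) *\<^sub>R u = r *\<^sub>R u + s *\<^sub>R u" by transfer (simp add: scaleR_left_distrib)
  show "r *\<^sub>R s *\<^sub>R u = (r * s) *\<^sub>R u" by transfer simp
  show "1 *\<^sub>R u = u" by transfer simp
  show "sgn u = inverse (norm u) *\<^sub>R u" by (rule sgn_ell2_def)
  show "dist u v = norm (u - v)" by (rule dist_ell2_def)
  show "uniformity = (INF e\<in>{0<..}. principal {(u :: 'a ell2, v). dist u v < e})"
    by (rule uniformity_ell2_def)
  show "open S = (\<forall>u\<in>S. \<forall>\<^sub>F (u', v) in uniformity. u' = u \<longrightarrow> v \<in> S)" for S :: "'a ell2 set"
    by (rule open_ell2_def)
  show "norm u = sqrt (inner u u)" by (rule norm_ell2_def)
  have cnj: "cinner v u = cnj (cinner u v)"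
    by transfer (simp flip: infsum_cnj add: mult.commute)
  show "inner u v = inner v u" unfolding inner_ell2_def cnj by simp
  have "cinner (u + v) w = cinner u w + cinner v w"
    by transfer (simp add: distrib_right infsum_add square_summable_mult)
  then show "inner (u + v) w = inner u w + inner v w" unfolding inner_ell2_def by simp
  have "cinner (r *\<^sub>R u) v = r *\<^sub>R cinner u v"
    by transfer (simp add: infsum_scaleR_right)
  then show "inner (r *\<^sub>R u) v = r * inner u v" unfolding inner_ell2_def by simp
  have sq: "inner u u = (\<Sum>\<^sub>\<infinity>i. (cmod (ell2_nth u i))\<^sup>2)"
  proof -
    have "(\<lambda>i. cnj (ell2_nth u i) * ell2_nth u i) summable_on UNIV"
      using ell2_nth[of u] by (intro square_summable_mult) auto
    then have "Re (cinner u u) = (\<Sum>\<^sub>\<infinity>i. Re (cnj (ell2_nth u i) * ell2_nth u i))"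
      unfolding cinner.rep_eq by (rule infsum_Re[symmetric])
    also have "\<dots> = (\<Sum>\<^sub>\<infinity>i. (cmod (ell2_nth u i))\<^sup>2)"
      by (rule infsum_cong) (simp add: cmod_power2 flip: power2_eq_square)
    finally show ?thesis by (simp add: inner_ell2_def)
  qed
  show "0 \<le> inner u u" unfolding sq by (rule infsum_nonneg) simp
  show "inner u u = 0 \<longleftrightarrow> u = 0"
  proof
    assume "inner u u = 0"
    then have "(cmod (ell2_nth u i))\<^sup>2 = 0" for i
      using ell2_nth[of u] unfolding sq
      by (intro nonneg_infsum_le_0D[where A = UNIV and f = "\<lambda>i. (cmod (ell2_nth u i))\<^sup>2"]) auto
    then show "u = 0" by transfer auto
  next
    assume "u = 0"
    then show "inner u u = 0" unfolding sq by (simp add: zero_ell2.rep_eq)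
  qed
qed

end

lift_definition ell2_tensor :: "'i ell2 \<Rightarrow> 'j ell2 \<Rightarrow> ('i \<times> 'j) ell2"
  is "\<lambda>f g (i, j). f i * g j"
proof -
  fix f :: "'i \<Rightarrow> complex" and g :: "'j \<Rightarrow> complex"
  assume f: "(\<lambda>i. (cmod (f i))\<^sup>2) summable_on UNIV" and g: "(\<lambda>j. (cmod (g j))\<^sup>2) summable_on UNIV"
  have "(\<lambda>(i, j). (cmod (f i))\<^sup>2 * (cmod (g j))\<^sup>2) summable_on (SIGMA i:UNIV. UNIV)"
    using has_sum_cmult_right[OF has_sum_infsum[OF g]] summable_on_cmult_left[OF f]
    by (intro summable_on_SigmaI[where g = "\<lambda>i. (cmod (f i))\<^sup>2 * (\<Sum>\<^sub>\<infinity>j. (cmod (g j))\<^sup>2)"]) auto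
  then show "(\<lambda>x. (cmod (case x of (i, j) \<Rightarrow> f i * g j))\<^sup>2) summable_on UNIV"
    by (simp add: case_prod_unfold norm_mult power_mult_distrib)
qed


section \<open>Operators on the Hilbert space\<close>

text \<open>The type below consists of all bounded real-linear maps; complex linearity is
  imposed by \<open>complex_linear_op\<close> where Schatten classes are defined.\<close>

type_synonym 'i op = "'i ell2 \<Rightarrow>\<^sub>L 'i ell2"

definition complex_linear_op :: "'i op \<Rightarrow> bool" where
  "complex_linear_op x \<longleftrightarrow> (\<forall>c u. blinfun_apply x (cscale c u) = cscale c (blinfun_apply x u))"

definition compact_op :: "'i op \<Rightarrow> bool" where
  "compact_op x \<longleftrightarrow> compact (closure (blinfun_apply x ` cball 0 1))"

lemma cscale_bounded_linear: "bounded_linear (cscale c)"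
proof (rule bounded_linear_intro[where K = "cmod c"])
  fix u v :: "'i ell2" and r :: real
  show "cscale c (u + v) = cscale c u + cscale c v" by transfer (simp add: distrib_left)
  show "cscale c (r *\<^sub>R u) = r *\<^sub>R cscale c u" by transfer simp
  have "cinner (cscale c u) (cscale c u) = of_real ((cmod c)\<^sup>2) * cinner u u"
    by transfer (simp add: complex_norm_square mult_ac flip: infsum_cmult_right' del: of_real_power)
  then have "inner (cscale c u) (cscale c u) = (cmod c)\<^sup>2 * inner u u"
    by (simp add: inner_ell2_def del: of_real_power)
  then show "norm (cscale c u) \<le> norm u * cmod c"
    by (simp add: norm_eq_sqrt_inner real_sqrt_mult)
qed

definition op_cscale :: "complex \<Rightarrow> 'i op \<Rightarrow> 'i op" where
  "op_cscale c x = Blinfun (\<lambda>u. cscale c (blinfun_apply x u))"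

lemma op_cscale_apply [simp]: "blinfun_apply (op_cscale c x) u = cscale c (blinfun_apply x u)"
  unfolding op_cscale_def
  by (subst bounded_linear_Blinfun_apply)
     (auto intro: bounded_linear_compose[OF cscale_bounded_linear] blinfun.bounded_linear_right)

definition op_adj :: "'i op \<Rightarrow> 'i op" where
  "op_adj x = (THE y. \<forall>u v. cinner (blinfun_apply x u) v = cinner u (blinfun_apply y v))"

text \<open>Functional calculus \<open>a\<^sup>s\<close> for a positive compact operator \<open>a\<close> and \<open>s > 0\<close>: the bounded
  operator acting as multiplication by \<open>t\<^sup>s\<close> on the \<open>t\<close>-eigenspace of \<open>a\<close>, for every \<open>t \<ge> 0\<close>.
  Existence and uniqueness are the spectral theorem for compact operators. On the kernel of \<open>a\<close>
  the value is 0, because \<open>0 powr s = 0\<close>.\<close>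

definition op_powr :: "'i op \<Rightarrow> real \<Rightarrow> 'i op" where
  "op_powr a s = (THE b. \<forall>t\<ge>0. \<forall>v. blinfun_apply a v = t *\<^sub>R v
                            \<longrightarrow> blinfun_apply b v = (t powr s) *\<^sub>R v)"

definition op_abs :: "'i op \<Rightarrow> 'i op" where
  "op_abs x = op_powr (op_adj x o\<^sub>L x) (1/2)"

definition pos_trace :: "'i op \<Rightarrow> ennreal" where
  "pos_trace a = (\<Sum>\<^sub>\<infinity>i. ennreal (Re (cinner (ket i) (blinfun_apply a (ket i)))))"

definition op_tensor :: "'i op \<Rightarrow> 'j op \<Rightarrow> ('i \<times> 'j) op" where
  "op_tensor a b = (THE z. \<forall>u v. blinfun_apply z (ell2_tensor u v)
                               = ell2_tensor (blinfun_apply a u) (blinfun_apply b v))"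


section \<open>Schatten classes and operators acting on them\<close>

definition schatten :: "real \<Rightarrow> 'i op set" where
  "schatten p = {x. complex_linear_op x \<and> compact_op x
                    \<and> pos_trace (op_powr (op_adj x o\<^sub>L x) (p/2)) < \<infinity>}"

definition schatten_norm :: "real \<Rightarrow> 'i op \<Rightarrow> real" where
  "schatten_norm p x = enn2real (pos_trace (op_powr (op_adj x o\<^sub>L x) (p/2))) powr (1/p)"

text \<open>A map on the Schatten class is a total function on \<^typ>\<open>'i op\<close>, of which only the values
  on \<^term>\<open>schatten p\<close> matter.\<close>

definition schatten_linear :: "real \<Rightarrow> ('i op \<Rightarrow> 'i op) \<Rightarrow> bool" where
  "schatten_linear p V \<longleftrightarrow>
     (\<forall>x\<in>schatten p. V x \<in> schatten p) \<and>
     (\<forall>x\<in>schatten p. \<forall>y\<in>schatten p. V (x + y) = V x + V y) \<and>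
     (\<forall>c. \<forall>x\<in>schatten p. V (op_cscale c x) = op_cscale c (V x))"

definition schatten_opnorm :: "real \<Rightarrow> ('i op \<Rightarrow> 'i op) \<Rightarrow> ennreal" where
  "schatten_opnorm p V =
     (SUP x\<in>{x \<in> schatten p. schatten_norm p x \<le> 1}. ennreal (schatten_norm p (V x)))"

definition schatten_bounded :: "real \<Rightarrow> ('i op \<Rightarrow> 'i op) \<Rightarrow> bool" where
  "schatten_bounded p V \<longleftrightarrow> schatten_linear p V \<and> schatten_opnorm p V < \<infinity>"

definition ritt :: "real \<Rightarrow> ('i op \<Rightarrow> 'i op) \<Rightarrow> bool" where
  "ritt p T \<longleftrightarrow> schatten_bounded p T \<and>
     (SUP n. schatten_opnorm p (T ^^ n)) < \<infinity> \<and>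
     (SUP n\<in>{1..}. schatten_opnorm p (\<lambda>x. real n *\<^sub>R ((T ^^ n) x - (T ^^ (n - 1)) x))) < \<infinity>"

definition dense_range_I_minus :: "real \<Rightarrow> ('i op \<Rightarrow> 'i op) \<Rightarrow> bool" where
  "dense_range_I_minus p T \<longleftrightarrow>
     (\<forall>y\<in>schatten p. \<forall>e>0. \<exists>x\<in>schatten p. schatten_norm p (y - (x - T x)) < e)"


section \<open>Column and row square functions\<close>

text \<open>Norm of the finite sum of the \<open>x k \<otimes> e k\<close>, \<open>k \<in> I\<close>, in the column and in the row space.\<close>

definition column_norm :: "real \<Rightarrow> nat set \<Rightarrow> (nat \<Rightarrow> 'i op) \<Rightarrow> real" where
  "column_norm p I x =
     schatten_norm p (op_powr (\<Sum>k\<in>I. op_abs (x k) o\<^sub>L op_abs (x k)) (1/2))"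

definition row_norm :: "real \<Rightarrow> nat set \<Rightarrow> (nat \<Rightarrow> 'i op) \<Rightarrow> real" where
  "row_norm p I x =
     schatten_norm p (op_powr (\<Sum>k\<in>I. op_abs (op_adj (x k)) o\<^sub>L op_abs (op_adj (x k))) (1/2))"

text \<open>Completion, for a norm \<open>N\<close> as above, realised by sequences indexed by \<open>k \<ge> 1\<close>: the series of
  the \<open>x k \<otimes> e k\<close> converges in the completion iff its partial sums are Cauchy, and the norm of its
  sum is the limit of the norms of the partial sums.\<close>

definition seq_space ::
  "real \<Rightarrow> (nat set \<Rightarrow> (nat \<Rightarrow> 'i op) \<Rightarrow> real) \<Rightarrow> (nat \<Rightarrow> 'i op) set" where
  "seq_space p N = {x. (\<forall>k\<ge>1. x k \<in> schatten p) \<and>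
                       (\<forall>e>0. \<exists>M. \<forall>m\<ge>M. \<forall>n\<ge>m. N {m<..n} x < e)}"

definition seq_norm :: "(nat set \<Rightarrow> (nat \<Rightarrow> 'i op) \<Rightarrow> real) \<Rightarrow> (nat \<Rightarrow> 'i op) \<Rightarrow> real" where
  "seq_norm N x = lim (\<lambda>n. N {1..n} x)"

definition square_seq :: "('i op \<Rightarrow> 'i op) \<Rightarrow> 'i op \<Rightarrow> nat \<Rightarrow> 'i op" where
  "square_seq T x k = (real k powr (1/2)) *\<^sub>R (T ^^ (k - 1)) (x - T x)"

definition column_square_norm :: "real \<Rightarrow> ('i op \<Rightarrow> 'i op) \<Rightarrow> 'i op \<Rightarrow> ennreal" where
  "column_square_norm p T x =
     (if square_seq T x \<in> seq_space p (column_norm p)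
      then ennreal (seq_norm (column_norm p) (square_seq T x)) else \<infinity>)"

definition row_square_norm :: "real \<Rightarrow> ('i op \<Rightarrow> 'i op) \<Rightarrow> 'i op \<Rightarrow> ennreal" where
  "row_square_norm p T x =
     (if square_seq T x \<in> seq_space p (row_norm p)
      then ennreal (seq_norm (row_norm p) (square_seq T x)) else \<infinity>)"

text \<open>Restricting to \<open>K > 0\<close> loses nothing and avoids the convention \<open>0 * \<infinity> = 0\<close>.\<close>

definition sup_quotient_infinite ::
  "real \<Rightarrow> ('i op \<Rightarrow> ennreal) \<Rightarrow> ('i op \<Rightarrow> ennreal) \<Rightarrow> bool" where
  "sup_quotient_infinite p N1 N2 \<longleftrightarrow>
     \<not> (\<exists>K::real. K > 0 \<and> (\<forall>x\<in>schatten p. N1 x \<le> ennreal K * N2 x))"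


section \<open>Completely bounded functional calculus\<close>

text \<open>\<open>S\<^sup>p(S\<^sup>p)\<close> is the Schatten class over the Hilbert tensor square of the \<open>nat\<close>-indexed space, and
  \<open>W\<close> below is a bounded extension of \<open>I \<otimes> V\<close>; it is unique on \<open>S\<^sup>p(S\<^sup>p)\<close>, the algebraic
  tensor product being dense.\<close>

definition cb_extension ::
  "real \<Rightarrow> (nat op \<Rightarrow> nat op) \<Rightarrow> ((nat \<times> nat) op \<Rightarrow> (nat \<times> nat) op) \<Rightarrow> bool" where
  "cb_extension p V W \<longleftrightarrow> schatten_bounded p W \<and>
     (\<forall>a\<in>schatten p. \<forall>b\<in>schatten p. W (op_tensor a b) = op_tensor a (V b))"

definition completely_bounded :: "real \<Rightarrow> (nat op \<Rightarrow> nat op) \<Rightarrow> bool" where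
  "completely_bounded p V \<longleftrightarrow> schatten_linear p V \<and> (\<exists>W. cb_extension p V W)"

definition cb_norm :: "real \<Rightarrow> (nat op \<Rightarrow> nat op) \<Rightarrow> ennreal" where
  "cb_norm p V = schatten_opnorm p (SOME W. cb_extension p V W)"

definition stolz_domain :: "real \<Rightarrow> complex set" where
  "stolz_domain \<gamma> = interior (convex hull (insert 1 (ball 0 (sin \<gamma>))))"

definition poly_op :: "complex poly \<Rightarrow> ('i op \<Rightarrow> 'i op) \<Rightarrow> 'i op \<Rightarrow> 'i op" where
  "poly_op \<phi> T x = (\<Sum>i\<le>degree \<phi>. op_cscale (coeff \<phi> i) ((T ^^ i) x))"

definition cb_functional_calculus :: "real \<Rightarrow> real \<Rightarrow> (nat op \<Rightarrow> nat op) \<Rightarrow> bool" where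
  "cb_functional_calculus p \<gamma> T \<longleftrightarrow>
     (\<exists>K::real. \<forall>\<phi>. completely_bounded p (poly_op \<phi> T) \<and>
        cb_norm p (poly_op \<phi> T) \<le> ennreal (K * (SUP z\<in>stolz_domain \<gamma>. cmod (poly \<phi> z))))"

end

theory Submission
  imports Defs
begin

text \<open>Let \<open>a\<close> be the diagonal operator with entries \<open>a i = 1 - 1 / 2 ^ (i + 1)\<close> and let \<open>T\<close> be left
  multiplication by \<open>a\<close>. Then \<open>\<phi>(T)\<close> is left multiplication by \<open>\<phi>(a)\<close>, whose completely bounded norm
  is at most the supremum of \<open>|\<phi>(a i)|\<close>, and the \<open>a i\<close> lie in every Stolz domain. For the rank-one
  operator \<open>x = u \<otimes> e\<close>, where \<open>u\<close> is the sum of the first \<open>n\<close> basis vectors, the column square function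
  has norm \<open>(\<Sum>k. k \<parallel>a ^ (k - 1) (1 - a) u\<parallel>\<^sup>2) ^ (1/2)\<close>, which is of order \<open>n ^ (1/2)\<close>. The row square
  function is the square root of the \<open>n\<close> by \<open>n\<close> matrix with entries
  \<open>(1 - a i) (1 - a j) / (1 - a i a j)\<^sup>2 \<le> 2 ^ (- |i - j|)\<close>; this positive matrix is bounded by 4 and
  its trace is of order \<open>n\<close>, so its norm in the Schatten class of exponent \<open>p/2\<close> is at most (for
  \<open>p > 2\<close>) or at least (for \<open>p < 2\<close>) of order \<open>n ^ (2/p)\<close>, and the row norm of order \<open>n ^ (1/p)\<close>. Right multiplication
  by \<open>a\<close> exchanges rows and columns.\<close>

section \<open>The Hilbert space of square-summable families\<close>

text \<open>The test sequences consist of rank-one operators that all share one factor. One of the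
  two sums of squares is therefore a multiple of a single projection and forgets \<open>p\<close>.
  The other is a genuine \<open>n\<close> by \<open>n\<close> matrix, whose power \<open>p/2\<close>
  has a trace of order \<open>n\<close>. The quotient of the norms is a power of \<open>n\<close>
  with exponent \<plusminus>(1/2 - 1/p), which is why the two square functions trade places at
  \<open>p = 2\<close>. The gaps \<open>1 - a i\<close> shrink geometrically to make the orbits of
  different basis vectors almost orthogonal; norm and trace of the Gram matrix then suffice, and its
  eigenvalues never have to be known. Much of the work is to give the definitions their meaning.
  \<open>op_adj\<close>, \<open>op_powr\<close> and \<open>op_tensor\<close> are definite
  descriptions over real-linear maps, so existence and uniqueness must be proved there, and
  \<open>cb_norm\<close> selects some extension, which must be shown unique by a density argument.
  The triangle inequality of the Schatten norm is avoided throughout: traces of positive operators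
  are compared through their quadratic forms, and the density argument measures differences in the
  operator norm.\<close>

lemma cinner_summable: "(\<lambda>i. cnj (ell2_nth u i) * ell2_nth v i) summable_on UNIV"
  using ell2_nth[of u] ell2_nth[of v] by (intro square_summable_mult) auto

lemma cinner_commute: "cinner v u = cnj (cinner u v)"
  by transfer (simp flip: infsum_cnj add: mult.commute)

lemma cinner_add_right: "cinner u (v + w) = cinner u v + cinner u w"
  by transfer (simp add: distrib_left infsum_add square_summable_mult)

lemma cinner_add_left: "cinner (u + v) w = cinner u w + cinner v w"
  by (subst (1 2 3) cinner_commute) (simp add: cinner_add_right)

lemma cinner_cscale_right [simp]: "cinner u (cscale c v) = c * cinner u v"
  by transfer (simp add: mult.left_commute flip: infsum_cmult_right')

lemma cinner_cscale_left [simp]: "cinner (cscale c u) v = cnj c * cinner u v"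
  by (subst (1 2) cinner_commute) simp

lemma cscale_of_real: "cscale (of_real r) u = r *\<^sub>R u"
  by transfer (simp add: scaleR_conv_of_real)

lemma cscale_cscale [simp]: "cscale c (cscale d u) = cscale (c * d) u"
  by transfer (simp add: mult.assoc)

lemma cscale_one [simp]: "cscale 1 u = u"
  by transfer simp

lemma cscale_zero_left [simp]: "cscale 0 u = 0"
  by transfer simp

lemma cscale_add_left: "cscale (c + d) u = cscale c u + cscale d u"
  by transfer (simp add: distrib_right)

lemma cscale_minus_left: "cscale (- c) u = - cscale c u"
  by transfer simp

lemma cscale_add_right: "cscale c (u + v) = cscale c u + cscale c v"
  by transfer (simp add: distrib_left)

lemma cscale_zero_right [simp]: "cscale c 0 = 0"
  by transfer simp

lemma cscale_minus_right: "cscale c (- u) = - cscale c u"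
  by transfer simp

lemma cscale_diff_right: "cscale c (u - v) = cscale c u - cscale c v"
  using cscale_add_right[of c u "- v"] by (simp add: cscale_minus_right)

lemma cscale_scaleR: "cscale c (r *\<^sub>R u) = r *\<^sub>R cscale c u"
  by (simp flip: cscale_of_real add: mult.commute)

lemma cinner_scaleR_right [simp]: "cinner u (r *\<^sub>R v) = of_real r * cinner u v"
  by (simp flip: cscale_of_real)

lemma cinner_scaleR_left [simp]: "cinner (r *\<^sub>R u) v = of_real r * cinner u v"
  by (simp flip: cscale_of_real)

lemma cinner_zero_right [simp]: "cinner u 0 = 0"
  using cinner_cscale_right[of u 0 0] by simp

lemma cinner_zero_left [simp]: "cinner 0 u = 0"
  using cinner_cscale_left[of 0 0 u] by simp

lemma cinner_minus_right: "cinner u (- v) = - cinner u v"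
  using cinner_cscale_right[of u "-1" v] by (simp add: cscale_minus_left)

lemma cinner_diff_right: "cinner u (v - w) = cinner u v - cinner u w"
  using cinner_add_right[of u v "- w"] by (simp add: cinner_minus_right)

lemma cinner_sum_right: "cinner u (\<Sum>i\<in>A. f i) = (\<Sum>i\<in>A. cinner u (f i))"
  by (induction A rule: infinite_finite_induct) (simp_all add: cinner_add_right)

lemma cinner_sum_left: "cinner (\<Sum>i\<in>A. f i) u = (\<Sum>i\<in>A. cinner (f i) u)"
  by (induction A rule: infinite_finite_induct) (simp_all add: cinner_add_left)

lemma norm_sq_cinner: "(norm u)\<^sup>2 = Re (cinner u u)"
  by (simp add: power2_norm_eq_inner inner_ell2_def)

lemma cinner_self: "cinner u u = of_real ((norm u)\<^sup>2)"
proof -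
  have "Im (cinner u u) = 0"
    using arg_cong[OF cinner_commute[of u u], of Im] by simp
  then show ?thesis by (simp add: complex_eq_iff norm_sq_cinner)
qed

lemma norm_cscale [simp]: "norm (cscale c u) = cmod c * norm u"
proof -
  have "of_real ((norm (cscale c u))\<^sup>2) = (of_real ((cmod c)\<^sup>2) :: complex) * of_real ((norm u)\<^sup>2)"
    unfolding cinner_self[symmetric] complex_norm_square by (simp add: mult_ac)
  also have "\<dots> = of_real ((cmod c * norm u)\<^sup>2)" by (simp add: power_mult_distrib)
  finally have "of_real ((norm (cscale c u))\<^sup>2) = (of_real ((cmod c * norm u)\<^sup>2) :: complex)" .
  then have "(norm (cscale c u))\<^sup>2 = (cmod c * norm u)\<^sup>2" using of_real_eq_iff by blast
  then show ?thesis by (simp add: power2_eq_iff_nonneg)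
qed

lemma cmod_cinner_le: "cmod (cinner u v) \<le> norm u * norm v"
proof (cases "cinner u v = 0")
  case False
  define d where "d = sgn (cinner u v)"
  have d: "cmod d = 1" using False by (simp add: d_def norm_sgn)
  have "cinner (cscale d u) v = of_real (cmod (cinner u v))"
  proof -
    have "of_real (cmod (cinner u v)) * cinner (cscale d u) v = of_real (cmod (cinner u v)) * of_real (cmod (cinner u v))"
      using False complex_norm_square[of "cinner u v"]
      by (simp add: d_def sgn_div_norm scaleR_conv_of_real power2_eq_square mult.commute[of "cnj _"])
    then show ?thesis using False by simp
  qed
  then have "cmod (cinner u v) = inner (cscale d u) v" by (simp add: inner_ell2_def)
  also have "\<dots> \<le> norm (cscale d u) * norm v" by (rule norm_cauchy_schwarz)
  finally show ?thesis using d by simp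
qed simp

lemma bounded_linear_cinner_right: "bounded_linear (cinner u)"
  by (rule bounded_linear_intro[where K = "norm u"])
     (simp_all add: cinner_add_right scaleR_conv_of_real cmod_cinner_le mult.commute[of "norm u"]
        order.trans[OF cmod_cinner_le])

lemma bounded_linear_cinner_left: "bounded_linear (\<lambda>u. cinner u v)"
  by (rule bounded_linear_intro[where K = "norm v"])
     (simp_all add: cinner_add_left scaleR_conv_of_real cmod_cinner_le)

lemma cinner_ket_left [simp]: "cinner (ket i) v = ell2_nth v i"
  unfolding cinner.rep_eq ket.rep_eq
  by (subst infsum_cong_neutral[where T = "{i}"]) auto

lemma ell2_eqI: "(\<And>i. ell2_nth u i = ell2_nth v i) \<Longrightarrow> u = v"
  by (metis ell2_nth_inject ext)

lemma cinner_eqI: "(\<And>w. cinner w u = cinner w v) \<Longrightarrow> u = v"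
  by (rule ell2_eqI) (metis cinner_ket_left)

lemma ell2_nth_simps [simp]:
  "ell2_nth (u + v) i = ell2_nth u i + ell2_nth v i"
  "ell2_nth (u - v) i = ell2_nth u i - ell2_nth v i"
  "ell2_nth 0 i = 0" "ell2_nth (cscale c u) i = c * ell2_nth u i"
  "ell2_nth (r *\<^sub>R u) i = of_real r * ell2_nth u i"
  by (simp_all add: plus_ell2.rep_eq minus_ell2.rep_eq zero_ell2.rep_eq cscale.rep_eq
      scaleR_ell2.rep_eq scaleR_conv_of_real)

lemma ell2_nth_sum: "ell2_nth (\<Sum>k\<in>A. f k) i = (\<Sum>k\<in>A. ell2_nth (f k) i)"
  by (induction A rule: infinite_finite_induct) simp_all

lemma ell2_nth_ket: "ell2_nth (ket i) j = (if i = j then 1 else 0)"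
  by (simp add: ket.rep_eq)

lemma has_sum_norm_ell2: "((\<lambda>i. (cmod (ell2_nth u i))\<^sup>2) has_sum (norm u)\<^sup>2) UNIV"
proof -
  have "((\<lambda>i. cnj (ell2_nth u i) * ell2_nth u i) has_sum cinner u u) UNIV"
    using has_sum_infsum[OF cinner_summable] unfolding cinner.rep_eq .
  from has_sum_Re[OF this] show ?thesis
    by (simp add: norm_sq_cinner cmod_power2 flip: power2_eq_square)
qed

lemma norm_ket [simp]: "norm (ket i) = 1"
proof -
  have "of_real ((norm (ket i))\<^sup>2) = (1::complex)"
    unfolding cinner_self[symmetric] by (simp add: ell2_nth_ket)
  then have "(norm (ket i))\<^sup>2 = 1" using of_real_eq_1_iff by blast
  then show ?thesis by (simp add: power2_eq_1_iff) (smt (verit) norm_ge_zero)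
qed

lemma cmod_ell2_nth_le: "cmod (ell2_nth u i) \<le> norm u"
  using cmod_cinner_le[of "ket i" u] by simp

text \<open>A Cauchy sequence converges in every coordinate. The Cauchy estimate, restricted to
  finitely many coordinates, survives this limit; being uniform in the finite set, it yields both
  square-summability of the limit and convergence in norm.\<close>

instance ell2 :: (type) banach
proof
  fix X :: "nat \<Rightarrow> 'a ell2" assume C: "Cauchy X"
  have "Cauchy (\<lambda>n. ell2_nth (X n) i)" for i
    using bounded_linear.Cauchy[OF bounded_linear_cinner_right[of "ket i"] C] by simp
  then have "\<exists>l. (\<lambda>n. ell2_nth (X n) i) \<longlonglongrightarrow> l" for i
    using Cauchy_convergent convergent_def by blast
  then obtain L where L: "\<And>i. (\<lambda>n. ell2_nth (X n) i) \<longlonglongrightarrow> L i" by metis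
  have tail: "(\<Sum>i\<in>F. (cmod (ell2_nth (X n) i - L i))\<^sup>2) \<le> e\<^sup>2"
    if "finite F" "e > 0" "\<forall>m\<ge>N. \<forall>n\<ge>N. norm (X m - X n) < e" "n \<ge> N" for F e N n
  proof (rule LIMSEQ_le_const2)
    show "(\<lambda>m. \<Sum>i\<in>F. (cmod (ell2_nth (X n) i - ell2_nth (X m) i))\<^sup>2) \<longlonglongrightarrow> (\<Sum>i\<in>F. (cmod (ell2_nth (X n) i - L i))\<^sup>2)"
      by (intro tendsto_intros L)
    have "(\<Sum>i\<in>F. (cmod (ell2_nth (X n) i - ell2_nth (X m) i))\<^sup>2) \<le> e\<^sup>2" if "m \<ge> N" for m
    proof -
      have "(\<Sum>i\<in>F. (cmod (ell2_nth (X n - X m) i))\<^sup>2) \<le> (norm (X n - X m))\<^sup>2"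
        by (rule finite_sum_le_has_sum[OF has_sum_norm_ell2]) (use \<open>finite F\<close> in auto)
      also have "\<dots> \<le> e\<^sup>2" using that \<open>n \<ge> N\<close> \<open>\<forall>m\<ge>N. \<forall>n\<ge>N. norm (X m - X n) < e\<close>
        by (intro power_mono) (auto intro: less_imp_le)
      finally show ?thesis by simp
    qed
    then show "\<exists>M. \<forall>m\<ge>M. (\<Sum>i\<in>F. (cmod (ell2_nth (X n) i - ell2_nth (X m) i))\<^sup>2) \<le> e\<^sup>2" by blast
  qed
  have summ: "(\<lambda>i. (cmod (ell2_nth (X n) i - L i))\<^sup>2) summable_on UNIV"
    if "e > 0" "\<forall>m\<ge>N. \<forall>n\<ge>N. norm (X m - X n) < e" "n \<ge> N" for e N n
    using tail[OF _ that] by (intro nonneg_bdd_above_summable_on) (auto intro!: bdd_aboveI[where M = "e\<^sup>2"])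
  obtain N1 where N1: "\<forall>m\<ge>N1. \<forall>n\<ge>N1. norm (X m - X n) < 1"
    using C unfolding Cauchy_iff by (metis zero_less_one)
  \<comment> \<open>The coordinatewise limit is a member of the sequence minus a square-summable
    difference.\<close>
  have "(\<lambda>i. (cmod (ell2_nth (X N1) i + - (ell2_nth (X N1) i - L i)))\<^sup>2) summable_on UNIV"
    using summ[OF _ N1 order.refl] ell2_nth[of "X N1"]
    by (intro square_summable_add) (auto simp: norm_minus_commute)
  then have Lm: "L \<in> {f. (\<lambda>i. (cmod (f i))\<^sup>2) summable_on UNIV}" by simp
  define l where "l = Abs_ell2 L"
  have l: "ell2_nth l i = L i" for i
    using Abs_ell2_inverse[OF Lm] by (simp add: l_def)
  have "X \<longlonglongrightarrow> l"
  proof (rule LIMSEQ_I)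
    fix r :: real assume "0 < r"
    then obtain N where N: "\<forall>m\<ge>N. \<forall>n\<ge>N. norm (X m - X n) < r/2"
      using C unfolding Cauchy_iff by (metis half_gt_zero)
    have "norm (X n - l) < r" if n: "n \<ge> N" for n
    proof -
      have "(norm (X n - l))\<^sup>2 \<le> (r/2)\<^sup>2"
        using has_sum_le_finite_sums[OF has_sum_norm_ell2[of "X n - l"], of "(r/2)\<^sup>2"] tail[OF _ _ N n] \<open>0 < r\<close>
        by (simp add: l)
      then have "norm (X n - l) \<le> r/2" using \<open>0 < r\<close> by (simp add: power2_le_iff_abs_le)
      then show ?thesis using \<open>0 < r\<close> by simp
    qed
    then show "\<exists>N. \<forall>n\<ge>N. norm (X n - l) < r" by blast
  qed
  then show "convergent X" by (auto simp: convergent_def)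
qed

section \<open>Orthonormal bases\<close>

definition orthonormal :: "'j set \<Rightarrow> ('j \<Rightarrow> 'i ell2) \<Rightarrow> bool" where
  "orthonormal J e \<longleftrightarrow> (\<forall>i\<in>J. \<forall>j\<in>J. cinner (e i) (e j) = (if i = j then 1 else 0))"

text \<open>Totality is phrased through orthogonality because this is what maximality in Zorn's
  lemma delivers. The explicit index set serves both \<open>ket\<close> on \<open>UNIV\<close> and
  sets of eigenvectors indexed by themselves.\<close>

definition onb :: "'j set \<Rightarrow> ('j \<Rightarrow> 'i ell2) \<Rightarrow> bool" where
  "onb J e \<longleftrightarrow> orthonormal J e \<and> (\<forall>v. (\<forall>j\<in>J. cinner (e j) v = 0) \<longrightarrow> v = 0)"

lemma onb_orthonormal: "onb J e \<Longrightarrow> orthonormal J e"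
  by (simp add: onb_def)

lemma orthonormal_norm:
  assumes "orthonormal J e" "j \<in> J" shows "norm (e j) = 1"
proof -
  have "of_real ((norm (e j))\<^sup>2) = (1::complex)"
    unfolding cinner_self[symmetric] using assms by (simp add: orthonormal_def)
  then have "(norm (e j))\<^sup>2 = 1" using of_real_eq_1_iff by blast
  then show ?thesis by (simp add: power2_eq_1_iff) (smt (verit) norm_ge_zero)
qed

lemma onb_eqI:
  assumes "onb J e" "\<And>j. j \<in> J \<Longrightarrow> cinner (e j) u = cinner (e j) v" shows "u = v"
proof -
  have "u - v = 0" proof -
    have "\<forall>j\<in>J. cinner (e j) (u - v) = 0" using assms(2) by (simp add: cinner_diff_right)
    then show ?thesis using assms(1) unfolding onb_def by blast
  qed
  then show ?thesis by simp
qed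

lemma onb_ket: "onb UNIV ket"
  unfolding onb_def orthonormal_def by (auto intro: ell2_eqI simp: ell2_nth_ket)

lemma norm_sum_orthonormal:
  assumes "orthonormal J e" "finite F" "F \<subseteq> J"
  shows "(norm (\<Sum>j\<in>F. cscale (c j) (e j)))\<^sup>2 = (\<Sum>j\<in>F. (cmod (c j))\<^sup>2)"
proof -
  have "cinner (\<Sum>j\<in>F. cscale (c j) (e j)) (\<Sum>j\<in>F. cscale (c j) (e j))
      = (\<Sum>i\<in>F. \<Sum>j\<in>F. c i * (cnj (c j) * cinner (e j) (e i)))"
    by (simp add: cinner_sum_left cinner_sum_right sum_distrib_left)
  also have "\<dots> = (\<Sum>i\<in>F. \<Sum>j\<in>F. if i = j then of_real ((cmod (c i))\<^sup>2) else 0)"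
    using assms by (intro sum.cong refl) (auto simp: orthonormal_def complex_norm_square subset_iff mult.commute simp del: of_real_power)
  also have "\<dots> = of_real (\<Sum>i\<in>F. (cmod (c i))\<^sup>2)" using assms(2) by simp
  finally show ?thesis unfolding cinner_self of_real_eq_iff .
qed

lemma bessel_finite:
  assumes "orthonormal J e" "finite F" "F \<subseteq> J"
  shows "(\<Sum>j\<in>F. (cmod (cinner (e j) v))\<^sup>2) \<le> (norm v)\<^sup>2"
proof -
  define w where "w = (\<Sum>j\<in>F. cscale (cinner (e j) v) (e j))"
  have ww: "(norm w)\<^sup>2 = (\<Sum>j\<in>F. (cmod (cinner (e j) v))\<^sup>2)"
    unfolding w_def by (rule norm_sum_orthonormal[OF assms])
  have "cinner w v = of_real ((norm w)\<^sup>2)"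
    unfolding ww by (simp add: w_def cinner_sum_left complex_norm_square mult.commute del: of_real_power)
  then have "(norm w)\<^sup>2 = cmod (cinner w v)" by (simp del: of_real_power)
  also have "\<dots> \<le> norm w * norm v" by (rule cmod_cinner_le)
  finally have "norm w \<le> norm v" by (cases "norm w = 0") (auto simp: power2_eq_square)
  then show ?thesis unfolding ww[symmetric] by (simp add: power_mono)
qed

lemma bessel_summable:
  assumes "orthonormal J e"
  shows "(\<lambda>j. (cmod (cinner (e j) v))\<^sup>2) summable_on J"
  using bessel_finite[OF assms]
  by (intro nonneg_bdd_above_summable_on) (auto intro!: bdd_aboveI[where M = "(norm v)\<^sup>2"])

text \<open>By Pythagoras, the distance between two finite partial sums is governed by the
  coefficients outside a finite set that carries almost all of their square sum. The net of finite
  partial sums is thus Cauchy, and the space is complete.\<close>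

lemma orthonormal_summable:
  assumes on: "orthonormal J e" and c: "(\<lambda>j. (cmod (c j))\<^sup>2) summable_on J"
  shows "(\<lambda>j. cscale (c j) (e j)) summable_on J"
proof -
  let ?f = "\<lambda>j. cscale (c j) (e j)"
  have ex: "\<exists>P. eventually P (finite_subsets_at_top J) \<and> (\<forall>F F'. P F \<and> P F' \<longrightarrow> dist (sum ?f F) (sum ?f F') < r)"
    if "r > 0" for r
  proof -
    define S where "S = infsum (\<lambda>j. (cmod (c j))\<^sup>2) J"
    obtain F0 where F0: "finite F0" "F0 \<subseteq> J" "dist (\<Sum>j\<in>F0. (cmod (c j))\<^sup>2) S \<le> (r/3)\<^sup>2"
      using infsum_finite_approximation[OF c, of "(r/3)\<^sup>2"] \<open>r > 0\<close> unfolding S_def by auto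
    have near: "norm (sum ?f F - sum ?f F0) \<le> r/3" if F: "finite F" "F0 \<subseteq> F" "F \<subseteq> J" for F
    proof -
      have "sum ?f F - sum ?f F0 = sum ?f (F - F0)" using F by (simp add: sum_diff)
      then have "(norm (sum ?f F - sum ?f F0))\<^sup>2 = (\<Sum>j\<in>F - F0. (cmod (c j))\<^sup>2)"
        using norm_sum_orthonormal[OF on, of "F - F0" c] F by auto
      also have "\<dots> = (\<Sum>j\<in>F. (cmod (c j))\<^sup>2) - (\<Sum>j\<in>F0. (cmod (c j))\<^sup>2)" using F by (simp add: sum_diff)
      also have "\<dots> \<le> S - (\<Sum>j\<in>F0. (cmod (c j))\<^sup>2)"
        unfolding S_def using F finite_sum_le_infsum[OF c, of F] by auto
      also have "\<dots> \<le> (r/3)\<^sup>2" using F0(3) by (simp add: dist_real_def)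
      finally show ?thesis using \<open>r > 0\<close> by (simp add: power2_le_iff_abs_le)
    qed
    define P where "P F \<longleftrightarrow> finite F \<and> F0 \<subseteq> F \<and> F \<subseteq> J" for F
    have "eventually P (finite_subsets_at_top J)"
      unfolding eventually_finite_subsets_at_top P_def using F0 by blast
    moreover have "dist (sum ?f F) (sum ?f F') < r" if "P F" "P F'" for F F'
    proof -
      have "sum ?f F - sum ?f F' = (sum ?f F - sum ?f F0) - (sum ?f F' - sum ?f F0)" by simp
      then have "norm (sum ?f F - sum ?f F') \<le> r/3 + r/3"
        using near[of F] near[of F'] that norm_triangle_ineq4[of "sum ?f F - sum ?f F0" "sum ?f F' - sum ?f F0"]
        unfolding P_def by auto
      then show ?thesis using \<open>r > 0\<close> by (simp add: dist_norm)
    qed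
    ultimately show ?thesis by blast
  qed
  then have "cauchy_filter (filtermap (sum ?f) (finite_subsets_at_top J))"
    by (simp add: cauchy_filter_metric_filtermap)
  moreover have "complete (UNIV :: 'b ell2 set)"
    by (meson Cauchy_convergent UNIV_I complete_def convergent_def)
  ultimately obtain L' where "(sum ?f \<longlongrightarrow> L') (finite_subsets_at_top J)"
    using complete_uniform[where S=UNIV] by (force simp add: filterlim_def)
  then show ?thesis using summable_on_def has_sum_def by blast
qed

text \<open>Riesz-Fischer: continuity of the inner product recovers the coefficients of the sum, and
  pairing the sum with itself gives its norm.\<close>

lemma orthonormal_synthesis:
  assumes on: "orthonormal J e" and c: "(\<lambda>j. (cmod (c j))\<^sup>2) summable_on J"
  shows "\<exists>w. ((\<lambda>j. cscale (c j) (e j)) has_sum w) J \<and> (\<forall>j\<in>J. cinner (e j) w = c j)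
    \<and> ((\<lambda>j. (cmod (c j))\<^sup>2) has_sum (norm w)\<^sup>2) J"
proof -
  obtain w where w: "((\<lambda>j. cscale (c j) (e j)) has_sum w) J"
    using orthonormal_summable[OF assms] has_sum_infsum by blast
  have coeff: "cinner (e j) w = c j" if "j \<in> J" for j
  proof -
    have "((\<lambda>i. c i * cinner (e j) (e i)) has_sum cinner (e j) w) J"
      using has_sum_bounded_linear[OF bounded_linear_cinner_right w] by (simp add: o_def)
    moreover have "((\<lambda>i. c i * cinner (e j) (e i)) has_sum c j) J"
      by (subst has_sum_cong_neutral[where T = "{j}" and g = "\<lambda>i. c i * cinner (e j) (e i)"])
         (use that on in \<open>auto simp: orthonormal_def intro!: has_sum_finiteI\<close>)
    ultimately show ?thesis by (rule has_sum_unique)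
  qed
  have "((\<lambda>j. cinner (cscale (c j) (e j)) w) has_sum cinner w w) J"
    using has_sum_bounded_linear[OF bounded_linear_cinner_left w] by (simp add: o_def)
  then have "((\<lambda>j. Re (cnj (c j) * cinner (e j) w)) has_sum Re (cinner w w)) J"
    using has_sum_Re by fastforce
  then have "((\<lambda>j. (cmod (c j))\<^sup>2) has_sum (norm w)\<^sup>2) J"
    by (subst has_sum_cong[where g = "\<lambda>j. Re (cnj (c j) * cinner (e j) w)"])
       (simp_all add: coeff norm_sq_cinner cmod_power2 power2_eq_square[of "Re _"] power2_eq_square[of "Im _"])
  with w coeff show ?thesis by blast
qed

lemma
  assumes "onb J e"
  shows onb_expansion: "((\<lambda>j. cscale (cinner (e j) v) (e j)) has_sum v) J"
    and onb_parseval: "((\<lambda>j. (cmod (cinner (e j) v))\<^sup>2) has_sum (norm v)\<^sup>2) J"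
proof -
  obtain w where w: "((\<lambda>j. cscale (cinner (e j) v) (e j)) has_sum w) J"
    "\<And>j. j \<in> J \<Longrightarrow> cinner (e j) w = cinner (e j) v" "((\<lambda>j. (cmod (cinner (e j) v))\<^sup>2) has_sum (norm w)\<^sup>2) J"
    using orthonormal_synthesis[OF onb_orthonormal[OF assms] bessel_summable[OF onb_orthonormal[OF assms]]] by blast
  then have "w = v" by (intro onb_eqI[OF assms]) auto
  with w show "((\<lambda>j. cscale (cinner (e j) v) (e j)) has_sum v) J" "((\<lambda>j. (cmod (cinner (e j) v))\<^sup>2) has_sum (norm v)\<^sup>2) J"
    by auto
qed

lemma onb_parseval_cinner:
  assumes "onb J e"
  shows "((\<lambda>j. cnj (cinner (e j) u) * cinner (e j) v) has_sum cinner u v) J"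
  using has_sum_bounded_linear[OF bounded_linear_cinner_right[of u] onb_expansion[OF assms, of v]]
  by (simp add: o_def cinner_commute[of u] mult.commute)

section \<open>Complex-linear operators and adjoints\<close>

lemma complex_linear_opD: "complex_linear_op x \<Longrightarrow> x (cscale c u) = cscale c (x u)"
  by (simp add: complex_linear_op_def)

lemma cinner_blinfun_onb:
  assumes "onb J e" "complex_linear_op x"
  shows "((\<lambda>j. cinner (e j) u * cinner v (x (e j))) has_sum cinner v (x u)) J"
  using has_sum_bounded_linear[OF bounded_linear_compose[OF bounded_linear_cinner_right[of v]
    blinfun.bounded_linear_right[of x]] onb_expansion[OF assms(1), of u]] assms(2)
  by (simp add: o_def complex_linear_opD)

lemma op_eqI_onb:
  assumes "onb J e" "complex_linear_op x" "complex_linear_op y" "\<And>j. j \<in> J \<Longrightarrow> x (e j) = y (e j)"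
  shows "x = y"
proof (rule blinfun_eqI, rule cinner_eqI)
  fix u v
  have "((\<lambda>j. cinner (e j) u * cinner v (x (e j))) has_sum cinner v (y u)) J"
    using cinner_blinfun_onb[OF assms(1,3), of u v] by (subst has_sum_cong) (simp_all add: assms(4))
  then show "cinner v (x u) = cinner v (y u)"
    using cinner_blinfun_onb[OF assms(1,2), of u v] has_sum_unique by blast
qed

lemma complex_op_of_fun:
  assumes add: "\<And>u v. f (u + v) = f u + f v" and sc: "\<And>c u. f (cscale c u) = cscale c (f u)"
    and K: "\<And>u. norm (f u) \<le> K * norm u"
  obtains x :: "('i ell2 \<Rightarrow>\<^sub>L 'j ell2)" where "\<And>u. x u = f u"
proof -
  have "bounded_linear f"
    using sc[of "of_real _"] by (intro bounded_linear_intro[where K = K]) (auto simp: add K mult.commute[of _ K] simp flip: cscale_of_real)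
  then show thesis using that[of "Blinfun f"] by (simp add: bounded_linear_Blinfun_apply)
qed

lemma norm_le_of_cinner:
  assumes "\<And>w. cmod (cinner w v) \<le> K * norm w" shows "norm v \<le> K"
proof (cases "v = 0")
  case True
  then show ?thesis using assms[of "ket undefined"] by simp
next
  case False
  have "(norm v)\<^sup>2 = cmod (cinner v v)" by (simp add: cinner_self del: of_real_power)
  also have "\<dots> \<le> K * norm v" by (rule assms)
  finally show ?thesis using False by (simp add: power2_eq_square)
qed

text \<open>Riesz representation in coordinates: the vector with coefficients
  \<open>cinner (x (ket i)) v\<close> represents the functional, once these are known to be
  square-summable.\<close>

lemma adjoint_exists:
  fixes x :: "'i op"
  assumes "complex_linear_op x"
  shows "\<exists>y :: 'i op. \<forall>u v. cinner (x u) v = cinner u (y v)"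
proof -
  have "\<exists>w. \<forall>u. cinner (x u) v = cinner u w" for v
  proof -
    have fin: "(\<Sum>i\<in>F. (cmod (cinner (x (ket i)) v))\<^sup>2) \<le> (norm x * norm v)\<^sup>2" if "finite F" for F
    proof -
      \<comment> \<open>This is a finite section of the vector to be constructed. Testing
        \<open>x\<close> on it gives its own squared norm, so boundedness of \<open>x\<close> bounds
        the section independently of \<open>F\<close>.\<close>
      define w where "w = (\<Sum>i\<in>F. cscale (cinner (x (ket i)) v) (ket i))"
      have ww: "(norm w)\<^sup>2 = (\<Sum>i\<in>F. (cmod (cinner (x (ket i)) v))\<^sup>2)"
        unfolding w_def using norm_sum_orthonormal[OF onb_orthonormal[OF onb_ket] that] by auto
      have "cinner (x w) v = of_real ((norm w)\<^sup>2)"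
        unfolding ww by (simp add: w_def blinfun.sum_right complex_linear_opD[OF assms] cinner_sum_left
            complex_norm_square mult.commute del: of_real_power)
      then have "(norm w)\<^sup>2 = cmod (cinner (x w) v)" by (simp del: of_real_power)
      also have "\<dots> \<le> norm (x w) * norm v" by (rule cmod_cinner_le)
      also have "\<dots> \<le> norm x * norm w * norm v" by (intro mult_right_mono norm_blinfun) simp
      finally have "norm w \<le> norm x * norm v" by (cases "norm w = 0") (auto simp: power2_eq_square)
      then show ?thesis unfolding ww[symmetric] by (simp add: power_mono)
    qed
    then have "(\<lambda>i. (cmod (cinner (x (ket i)) v))\<^sup>2) summable_on UNIV"
      by (intro nonneg_bdd_above_summable_on) (auto intro!: bdd_aboveI[where M = "(norm x * norm v)\<^sup>2"])
    from orthonormal_synthesis[OF onb_orthonormal[OF onb_ket] this]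
    obtain w where w: "\<And>i. cinner (ket i) w = cinner (x (ket i)) v" by (metis UNIV_I)
    have "cinner v (x u) = cinner w u" for u
    proof -
      have "((\<lambda>i. ell2_nth u i * cinner v (x (ket i))) has_sum cinner v (x u)) UNIV"
        using cinner_blinfun_onb[OF onb_ket assms, of u v] by simp
      moreover have "((\<lambda>i. ell2_nth u i * cinner w (ket i)) has_sum cinner w u) UNIV"
        using onb_parseval_cinner[OF onb_ket, of w u] by (simp add: cinner_commute[of w] mult.commute)
      moreover have "cinner w (ket i) = cinner v (x (ket i))" for i
        using w[of i] by (metis cinner_commute)
      ultimately show ?thesis using has_sum_unique by fastforce
    qed
    then show ?thesis by (metis cinner_commute)
  qed
  then obtain f where f: "\<And>u v. cinner (x u) v = cinner u (f v)" by metis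
  obtain y :: "'i op" where "\<And>u. y u = f u"
  proof (rule complex_op_of_fun[of f "norm x"])
    show "f (u + v) = f u + f v" for u v
      by (rule cinner_eqI) (simp add: cinner_add_right flip: f)
    show "f (cscale c u) = cscale c (f u)" for c u
      by (rule cinner_eqI) (simp flip: f)
    show "norm (f u) \<le> norm x * norm u" for u
    proof (rule norm_le_of_cinner)
      fix w
      have "cmod (cinner w (f u)) \<le> norm (x w) * norm u" by (simp flip: f add: cmod_cinner_le)
      also have "\<dots> \<le> norm x * norm w * norm u" by (intro mult_right_mono norm_blinfun) simp
      finally show "cmod (cinner w (f u)) \<le> norm x * norm u * norm w" by (simp add: mult_ac)
    qed
  qed blast
  then show ?thesis using f by metis
qed

lemma cinner_adj_right:
  fixes x :: "'i op"
  assumes "complex_linear_op x"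
  shows "cinner u ((op_adj x) v) = cinner (x u) v"
proof -
  have "\<exists>!y :: 'i op. \<forall>u v. cinner (x u) v = cinner u (y v)"
    using adjoint_exists[OF assms]
  proof (rule ex_ex1I)
    fix y z :: "'i op" assume "\<forall>u v. cinner (x u) v = cinner u (y v)"
      "\<forall>u v. cinner (x u) v = cinner u (z v)"
    then show "y = z" by (intro blinfun_eqI cinner_eqI) metis
  qed
  from theI'[OF this] show ?thesis unfolding op_adj_def by metis
qed

lemma op_adj_eqI:
  fixes x y :: "'i op"
  assumes "\<And>u v. cinner (x u) v = cinner u (y v)"
  shows "op_adj x = y"
  unfolding op_adj_def
  by (rule the_equality) (use assms in \<open>auto intro!: blinfun_eqI cinner_eqI\<close>)

lemma cinner_adj_left:
  assumes "complex_linear_op x"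
  shows "cinner ((op_adj x) u) v = cinner u (x v)"
  by (subst (1 2) cinner_commute) (simp add: cinner_adj_right[OF assms])

lemma complex_linear_adj [simp]: "complex_linear_op x \<Longrightarrow> complex_linear_op (op_adj x)"
  unfolding complex_linear_op_def[of "op_adj x"] by (auto intro!: cinner_eqI simp: cinner_adj_right)

lemma op_adj_adj [simp]: "complex_linear_op x \<Longrightarrow> op_adj (op_adj x) = x"
  by (rule op_adj_eqI) (simp add: cinner_adj_left)

lemma complex_linear_compose [simp]:
  "complex_linear_op x \<Longrightarrow> complex_linear_op y \<Longrightarrow> complex_linear_op (x o\<^sub>L y)"
  by (simp add: complex_linear_op_def)

lemma complex_linear_zero [simp]: "complex_linear_op 0"
  by (simp add: complex_linear_op_def)

lemma complex_linear_add [simp]: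
  "complex_linear_op x \<Longrightarrow> complex_linear_op y \<Longrightarrow> complex_linear_op (x + y)"
  by (simp add: complex_linear_op_def blinfun.add_left cscale_add_right)

lemma complex_linear_sum:
  "(\<And>k. k \<in> A \<Longrightarrow> complex_linear_op (f k)) \<Longrightarrow> complex_linear_op (\<Sum>k\<in>A. f k)"
  by (induction A rule: infinite_finite_induct) simp_all

lemma complex_linear_scaleR [simp]: "complex_linear_op x \<Longrightarrow> complex_linear_op (r *\<^sub>R x)"
  by (simp add: complex_linear_op_def blinfun.scaleR_left cscale_scaleR)

lemma complex_linear_cscale [simp]: "complex_linear_op x \<Longrightarrow> complex_linear_op (op_cscale c x)"
  by (simp add: complex_linear_op_def mult.commute)

lemma op_adj_compose:
  "complex_linear_op x \<Longrightarrow> complex_linear_op y \<Longrightarrow> op_adj (x o\<^sub>L y) = op_adj y o\<^sub>L op_adj x"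
  by (rule op_adj_eqI) (simp add: cinner_adj_right)

lemma norm_op_adj_le:
  assumes "complex_linear_op x" shows "norm (op_adj x) \<le> norm x"
proof (rule norm_blinfun_bound)
  fix v
  show "norm ((op_adj x) v) \<le> norm x * norm v"
  proof (rule norm_le_of_cinner)
    fix w
    have "cmod (cinner w ((op_adj x) v)) \<le> norm (x w) * norm v"
      by (simp add: cinner_adj_right[OF assms] cmod_cinner_le)
    also have "\<dots> \<le> norm x * norm w * norm v" by (intro mult_right_mono norm_blinfun) simp
    finally show "cmod (cinner w ((op_adj x) v)) \<le> norm x * norm v * norm w" by (simp add: mult_ac)
  qed
qed simp

lemma norm_op_adj [simp]: "complex_linear_op x \<Longrightarrow> norm (op_adj x) = norm x"
  using norm_op_adj_le[of x] norm_op_adj_le[of "op_adj x"] by simp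

section \<open>Diagonal operators\<close>

text \<open>\<open>Blinfun\<close> is guaranteed to return the displayed map only if that map is
  bounded and linear; this is the reason for the bound \<open>K\<close> in the facts about
  it.\<close>

definition diag_op :: "'j set \<Rightarrow> ('j \<Rightarrow> 'i ell2) \<Rightarrow> ('j \<Rightarrow> complex) \<Rightarrow> 'i op" where
  "diag_op J e g = Blinfun (\<lambda>v. \<Sum>\<^sub>\<infinity>j\<in>J. cscale (g j * cinner (e j) v) (e j))"

lemma diag_op_aux:
  assumes J: "onb J e" and g: "\<And>j. j \<in> J \<Longrightarrow> cmod (g j) \<le> K" and "0 \<le> K"
  shows cinner_diag_op: "j \<in> J \<Longrightarrow> cinner (e j) ((diag_op J e g) v) = g j * cinner (e j) v"
    and norm_diag_op_le: "norm (diag_op J e g) \<le> K"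
    and complex_linear_diag_op: "complex_linear_op (diag_op J e g)"
proof -
  note on = onb_orthonormal[OF J]
  define f where "f v = (\<Sum>\<^sub>\<infinity>j\<in>J. cscale (g j * cinner (e j) v) (e j))" for v
  have le: "(cmod (g j * cinner (e j) v))\<^sup>2 \<le> K\<^sup>2 * (cmod (cinner (e j) v))\<^sup>2" if "j \<in> J" for j v
    unfolding norm_mult power_mult_distrib using g[OF that] by (intro mult_right_mono power_mono) auto
  have fs: "(\<forall>j\<in>J. cinner (e j) (f v) = g j * cinner (e j) v) \<and> norm (f v) \<le> K * norm v" for v
  proof -
    have s: "((\<lambda>j. K\<^sup>2 * (cmod (cinner (e j) v))\<^sup>2) has_sum K\<^sup>2 * (norm v)\<^sup>2) J"
      by (intro has_sum_cmult_right onb_parseval J)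
    have "(\<lambda>j. (cmod (g j * cinner (e j) v))\<^sup>2) summable_on J"
      by (rule summable_on_comparison_test[OF has_sum_imp_summable[OF s] le]) auto
    note summ = this
    obtain w where
      w: "((\<lambda>j. cscale (g j * cinner (e j) v) (e j)) has_sum w) J"
      "\<And>j. j \<in> J \<Longrightarrow> cinner (e j) w = g j * cinner (e j) v"
      "((\<lambda>j. (cmod (g j * cinner (e j) v))\<^sup>2) has_sum (norm w)\<^sup>2) J"
      using orthonormal_synthesis[OF on summ] by blast
    have "(norm w)\<^sup>2 \<le> (K * norm v)\<^sup>2"
      using has_sum_mono[OF w(3) s le] by (simp add: power_mult_distrib)
    then have "norm w \<le> K * norm v" using \<open>0 \<le> K\<close> by (simp add: power2_le_iff_abs_le)
    moreover have "f v = w" unfolding f_def using w(1) by (rule infsumI)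
    ultimately show ?thesis using w(2) by auto
  qed
  obtain x :: "'b op" where x: "\<And>v. x v = f v"
  proof (rule complex_op_of_fun[of f K])
    show "f (u + v) = f u + f v" for u v
      by (rule onb_eqI[OF J]) (simp add: fs cinner_add_right distrib_left)
    show "f (cscale c u) = cscale c (f u)" for c u
      by (rule onb_eqI[OF J]) (simp add: fs)
  qed (use fs in auto)
  then have "f = blinfun_apply x" by auto
  then have d: "diag_op J e g = x" unfolding diag_op_def by (simp add: blinfun_apply_inverse flip: f_def)
  show "j \<in> J \<Longrightarrow> cinner (e j) ((diag_op J e g) v) = g j * cinner (e j) v"
    by (simp add: d x fs)
  show "norm (diag_op J e g) \<le> K"
    unfolding d by (rule norm_blinfun_bound[OF \<open>0 \<le> K\<close>]) (simp add: x fs)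
  show "complex_linear_op (diag_op J e g)"
    unfolding d complex_linear_op_def by (intro allI onb_eqI[OF J]) (simp add: x fs)
qed

lemma diag_op_apply:
  assumes J: "onb J e" and g: "\<And>j. j \<in> J \<Longrightarrow> cmod (g j) \<le> K" and "0 \<le> K" and "j \<in> J"
  shows "(diag_op J e g) (e j) = cscale (g j) (e j)"
  by (rule onb_eqI[OF J])
     (use assms onb_orthonormal[OF J] in \<open>auto simp: cinner_diag_op[OF assms(1-3)] orthonormal_def\<close>)

section \<open>Compact operators and the spectral theorem\<close>

lemma compact_op_seq:
  assumes "compact_op x" "\<And>n::nat. norm (v n) \<le> 1"
  obtains r l where "strict_mono r" "(\<lambda>n. x (v (r n))) \<longlonglongrightarrow> l"
proof -
  have "compact (closure (blinfun_apply x ` cball 0 1))" using assms(1) by (simp add: compact_op_def)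
  moreover have "\<forall>n. x (v n) \<in> closure (blinfun_apply x ` cball 0 1)"
    using assms(2) closure_subset by fastforce
  ultimately obtain l r where "strict_mono r" "((\<lambda>n. x (v n)) \<circ> r) \<longlonglongrightarrow> l"
    unfolding compact_def by metis
  then show thesis using that by (simp add: o_def)
qed

lemma compact_opI: "blinfun_apply x ` cball 0 1 \<subseteq> K \<Longrightarrow> compact K \<Longrightarrow> compact_op x"
  unfolding compact_op_def by (metis closed_closure closure_minimal compact_Int_closed compact_imp_closed inf.absorb_iff2)

lemma compact_op_compose_left:
  assumes "compact_op x" shows "compact_op (b o\<^sub>L x)"
proof (rule compact_opI)
  let ?K = "closure (blinfun_apply x ` cball 0 1)"
  show "blinfun_apply (b o\<^sub>L x) ` cball 0 1 \<subseteq> blinfun_apply b ` ?K"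
    using closure_subset by fastforce
  show "compact (blinfun_apply b ` ?K)"
    using assms unfolding compact_op_def
    by (intro compact_continuous_image linear_continuous_on blinfun.bounded_linear_right)
qed

lemma compact_op_compose_right:
  assumes "compact_op x" shows "compact_op (x o\<^sub>L b)"
proof (rule compact_opI)
  let ?K = "closure (blinfun_apply x ` cball 0 1)"
  \<comment> \<open>The summand 1 keeps \<open>R\<close> positive when \<open>b\<close> vanishes, so
    that vectors can be divided by it.\<close>
  define R where "R = norm b + 1"
  have R: "R > 0" "norm b \<le> R" using norm_ge_zero[of b] unfolding R_def by linarith+
  show "blinfun_apply (x o\<^sub>L b) ` cball 0 1 \<subseteq> (\<lambda>v. R *\<^sub>R v) ` ?K"
  proof safe
    fix v :: "'a ell2" assume "v \<in> cball 0 1"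
    then have v: "norm v \<le> 1" by simp
    have "norm (b v) \<le> norm b * norm v" by (rule norm_blinfun)
    also have "\<dots> \<le> R * 1" using R v by (intro mult_mono) auto
    finally have "(1/R) *\<^sub>R b v \<in> cball 0 1" using R by (simp add: field_simps)
    then have "x ((1/R) *\<^sub>R b v) \<in> ?K" using closure_subset by fast
    moreover have "(x o\<^sub>L b) v = R *\<^sub>R x ((1/R) *\<^sub>R b v)"
      using R by (simp add: blinfun.scaleR_right)
    ultimately show "(x o\<^sub>L b) v \<in> (\<lambda>v. R *\<^sub>R v) ` ?K" by blast
  qed
  show "compact ((\<lambda>v. R *\<^sub>R v) ` ?K)"
    using assms unfolding compact_op_def by (rule compact_scaling)
qed

abbreviation qform :: "'i op \<Rightarrow> 'i ell2 \<Rightarrow> real" where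
  "qform a v \<equiv> Re (cinner v (blinfun_apply a v))"

definition pos_op :: "'i op \<Rightarrow> bool" where
  "pos_op a \<longleftrightarrow> complex_linear_op a
     \<and> (\<forall>u v. cinner (a u) v = cinner u (a v))
     \<and> (\<forall>v. 0 \<le> qform a v)"

lemma pos_opD:
  assumes "pos_op a"
  shows pos_op_complex_linear: "complex_linear_op a"
    and pos_op_sym: "cinner (a u) v = cinner u (a v)"
    and pos_op_ge_0: "0 \<le> qform a v"
  using assms by (auto simp: pos_op_def)

lemma pos_op_adj: "pos_op a \<Longrightarrow> op_adj a = a"
  by (rule op_adj_eqI) (rule pos_op_sym)

lemma pos_op_adj_compose [simp]:
  assumes "complex_linear_op x" shows "pos_op (op_adj x o\<^sub>L x)"
  using assms by (auto simp: pos_op_def cinner_adj_left cinner_adj_right cinner_self)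

lemma cinner_adj_compose:
  assumes "complex_linear_op x"
  shows "qform (op_adj x o\<^sub>L x) v = (norm (x v))\<^sup>2"
  using assms by (simp add: cinner_adj_right cinner_self del: of_real_power)

lemma norm_diff_sq:
  fixes x y :: "'a :: real_inner"
  shows "(norm (x - y))\<^sup>2 = (norm x)\<^sup>2 - 2 * inner x y + (norm y)\<^sup>2"
  by (simp add: power2_norm_eq_inner inner_diff_left inner_diff_right inner_commute)

text \<open>A maximising sequence for \<open>norm (a v)\<close> on the unit sphere of \<open>M\<close> converges, along a
  subsequence, to some \<open>z0\<close> with \<open>a (a z0) = \<mu>\<^sup>2 z0\<close>; then \<open>a z0 + \<mu> z0\<close> is an
  eigenvector, nonzero by positivity.\<close>

lemma positive_compact_eigenvector:
  assumes pos: "pos_op a" and comp: "compact_op a"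
    and closed: "closed M" and sub: "subspace M"
    and inv: "\<And>v. v \<in> M \<Longrightarrow> a v \<in> M"
    and v0: "v0 \<in> M" "v0 \<noteq> 0"
  obtains z t where "z \<in> M" "norm z = 1" "0 \<le> t" "a z = t *\<^sub>R z"
proof -
  let ?a = "blinfun_apply a"
  define S where "S = (\<lambda>v. norm (?a v)) ` {v \<in> M. norm v = 1}"
  define \<mu> where "\<mu> = Sup S"
  have unit: "(1 / norm v) *\<^sub>R v \<in> M" "norm ((1 / norm v) *\<^sub>R v) = 1" if "v \<in> M" "v \<noteq> 0" for v
    using that subspace_scale[OF sub] by auto
  have ne: "S \<noteq> {}" using unit[OF v0] unfolding S_def by blast
  have bdd: "bdd_above S"
    unfolding S_def by (rule bdd_aboveI[where M = "norm a"]) (use norm_blinfun[of a] in \<open>force intro: order.trans\<close>)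
  have le1: "norm (?a v) \<le> \<mu>" if "v \<in> M" "norm v = 1" for v
    unfolding \<mu>_def by (rule cSup_upper[OF _ bdd]) (use that in \<open>auto simp: S_def\<close>)
  have le: "norm (?a v) \<le> \<mu> * norm v" if "v \<in> M" for v
  proof (cases "v = 0")
    case False
    have "norm (?a ((1 / norm v) *\<^sub>R v)) \<le> \<mu>" by (rule le1) (use unit that False in auto)
    then show ?thesis using False by (simp add: blinfun.scaleR_right field_simps)
  qed simp
  have \<mu>0: "0 \<le> \<mu>" using le1[OF unit[OF v0]] norm_ge_zero order.trans by blast
  show thesis
  proof (cases "\<mu> = 0")
    case True
    then have "?a ((1 / norm v0) *\<^sub>R v0) = 0 *\<^sub>R ((1 / norm v0) *\<^sub>R v0)"
      using le[OF unit(1)[OF v0]] by simp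
    then show thesis using that unit[OF v0] by blast
  next
    case False
    then have \<mu>: "\<mu> > 0" using \<mu>0 by simp
    have "\<exists>v. v \<in> M \<and> norm v = 1 \<and> \<mu> - 1 / Suc n < norm (?a v)" for n
      using less_cSup_iff[OF ne bdd, of "\<mu> - 1 / Suc n"] unfolding \<mu>_def[symmetric] by (auto simp: S_def)
    then obtain v where v: "\<And>n. v n \<in> M" "\<And>n. norm (v n) = 1" "\<And>n. \<mu> - 1 / Suc n < norm (?a (v n))" by metis
    have lim: "(\<lambda>n. norm (?a (v n))) \<longlonglongrightarrow> \<mu>"
    proof (rule tendsto_sandwich[of "\<lambda>n. \<mu> - 1 / Suc n" _ _ "\<lambda>n. \<mu>"])
      show "(\<lambda>n. \<mu> - 1 / Suc n) \<longlonglongrightarrow> \<mu>"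
        using tendsto_diff[OF tendsto_const LIMSEQ_Suc[OF lim_1_over_n], of \<mu>] by simp
    qed (use v le1 in \<open>auto intro!: always_eventually simp: less_imp_le\<close>)
    \<comment> \<open>\<open>w n\<close> is the defect of \<open>v n\<close> as an eigenvector of
      the square of \<open>a\<close> for \<open>\<mu>\<^sup>2\<close>. Since \<open>M\<close> is
      invariant, \<open>norm (a (a v)) \<le> \<mu> * norm (a v)\<close>, and this makes the defect
      vanish as \<open>norm (a (v n))\<close> approaches \<open>\<mu>\<close>.\<close>
    define w where "w n = ?a (?a (v n)) - \<mu>\<^sup>2 *\<^sub>R v n" for n
    have w_le: "(norm (w n))\<^sup>2 \<le> \<mu>^4 - \<mu>\<^sup>2 * (norm (?a (v n)))\<^sup>2" for n
    proof -
      have e: "inner (?a (?a (v n))) (v n) = (norm (?a (v n)))\<^sup>2"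
        using pos_op_sym[OF pos, of "?a (v n)" "v n"] by (simp add: inner_ell2_def norm_sq_cinner)
      have "(norm (w n))\<^sup>2 = (norm (?a (?a (v n))))\<^sup>2 - 2 * \<mu>\<^sup>2 * (norm (?a (v n)))\<^sup>2 + (\<mu>\<^sup>2 * norm (v n))\<^sup>2"
        unfolding w_def norm_diff_sq inner_scaleR_right e by (simp add: power_mult_distrib)
      also have "\<dots> \<le> (\<mu> * norm (?a (v n)))\<^sup>2 - 2 * \<mu>\<^sup>2 * (norm (?a (v n)))\<^sup>2 + (\<mu>\<^sup>2 * norm (v n))\<^sup>2"
        using le[OF inv[OF v(1)]] by (simp add: power_mono)
      also have "\<dots> = \<mu>^4 - \<mu>\<^sup>2 * (norm (?a (v n)))\<^sup>2" by (simp add: v(2) power_mult_distrib algebra_simps flip: power_mult)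
      finally show ?thesis .
    qed
    have "(\<lambda>n. \<mu>^4 - \<mu>\<^sup>2 * (norm (?a (v n)))\<^sup>2) \<longlonglongrightarrow> \<mu>^4 - \<mu>\<^sup>2 * \<mu>\<^sup>2"
      by (intro tendsto_intros lim)
    then have "(\<lambda>n. \<mu>^4 - \<mu>\<^sup>2 * (norm (?a (v n)))\<^sup>2) \<longlonglongrightarrow> 0" by (simp add: power4_eq_xxxx power2_eq_square)
    then have "(\<lambda>n. (norm (w n))\<^sup>2) \<longlonglongrightarrow> 0"
      by (rule tendsto_sandwich[rotated 3, of _ _ _ "\<lambda>n. 0"]) (use w_le in \<open>auto intro!: always_eventually\<close>)
    then have "(\<lambda>n. sqrt ((norm (w n))\<^sup>2)) \<longlonglongrightarrow> sqrt 0" by (rule tendsto_real_sqrt)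
    then have w0: "w \<longlonglongrightarrow> 0" by (simp add: tendsto_norm_zero_iff)
    obtain r l where r: "strict_mono r" "(\<lambda>n. ?a (v (r n))) \<longlonglongrightarrow> l"
      by (rule compact_op_seq[OF comp, of v]) (simp add: v(2), blast)
    have w0r: "(\<lambda>n. w (r n)) \<longlonglongrightarrow> 0" using LIMSEQ_subseq_LIMSEQ[OF w0 r(1)] by (simp add: o_def)
    have cont: "(\<lambda>n. ?a (f n)) \<longlonglongrightarrow> ?a m" if "f \<longlonglongrightarrow> m" for f :: "nat \<Rightarrow> _" and m
      using that by (rule bounded_linear.tendsto[OF blinfun.bounded_linear_right])
    define z0 where "z0 = (1/\<mu>\<^sup>2) *\<^sub>R ?a l"
    \<comment> \<open>Compactness gives convergence of the images only; solving the definition of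
      \<open>w\<close> for \<open>v (r n)\<close> transfers it to the vectors themselves.\<close>
    have "(\<lambda>n. (1/\<mu>\<^sup>2) *\<^sub>R (?a (?a (v (r n))) - w (r n))) \<longlonglongrightarrow> (1/\<mu>\<^sup>2) *\<^sub>R (?a l - 0)"
      by (intro tendsto_intros cont r w0r)
    then have vz: "(\<lambda>n. v (r n)) \<longlonglongrightarrow> z0" using \<mu> by (simp add: w_def z0_def)
    have z0M: "z0 \<in> M" using closed_sequentially[OF closed _ vz] v(1) by blast
    have z0n: "norm z0 = 1"
      using tendsto_norm[OF vz] by (simp add: v(2) LIMSEQ_const_iff)
    have "(\<lambda>n. w (r n)) \<longlonglongrightarrow> ?a (?a z0) - \<mu>\<^sup>2 *\<^sub>R z0"
      unfolding w_def by (intro tendsto_intros cont vz)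
    then have aa: "?a (?a z0) = \<mu>\<^sup>2 *\<^sub>R z0" using LIMSEQ_unique[OF w0r] by fastforce
    define z where "z = ?a z0 + \<mu> *\<^sub>R z0"
    have az: "?a z = \<mu> *\<^sub>R z"
      by (simp add: z_def blinfun.add_right blinfun.scaleR_right aa scaleR_add_right power2_eq_square)
    have "Re (cinner z0 z) = Re (cinner z0 (?a z0)) + \<mu>"
      by (simp add: z_def cinner_add_right cinner_self z0n)
    then have "Re (cinner z0 z) > 0" using pos_op_ge_0[OF pos, of z0] \<mu> by linarith
    then have z: "z \<noteq> 0" by auto
    have zM: "z \<in> M" unfolding z_def by (intro subspace_add subspace_scale sub inv z0M)
    have "?a ((1 / norm z) *\<^sub>R z) = \<mu> *\<^sub>R ((1 / norm z) *\<^sub>R z)"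
      by (simp add: blinfun.scaleR_right az)
    then show thesis using that unit[OF zM z] \<mu>0 by blast
  qed
qed

text \<open>The basis is a set indexed by itself, with no ordering of the eigenvalues; multiplicity
  appears as several vectors with the same value of \<open>l\<close>, and vectors of the kernel are
  included with value 0.\<close>

definition eigenbasis :: "'i op \<Rightarrow> 'i ell2 set \<Rightarrow> ('i ell2 \<Rightarrow> real) \<Rightarrow> bool" where
  "eigenbasis a E l \<longleftrightarrow> onb E (\<lambda>e. e) \<and> (\<forall>e\<in>E. 0 \<le> l e \<and> a e = l e *\<^sub>R e)"

text \<open>Zorn's lemma gives a maximal orthonormal set of eigenvectors. Its orthogonal complement
  is closed and invariant by symmetry of \<open>a\<close>, so a nonzero vector in it would produce a
  further eigenvector and contradict maximality.\<close>

theorem spectral_theorem: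
  assumes pos: "pos_op a" and comp: "compact_op a"
  shows "\<exists>E l. eigenbasis a E l"
proof -
  define C where "C = {E. orthonormal E (\<lambda>e. e) \<and> (\<forall>e\<in>E. \<exists>t\<ge>0. a e = t *\<^sub>R e)}"
  have "\<exists>E\<in>C. \<forall>X\<in>C. E \<subseteq> X \<longrightarrow> X = E"
  proof (rule subset_Zorn_nonempty)
    have "{} \<in> C" by (simp add: C_def orthonormal_def)
    then show "C \<noteq> {}" by blast
    fix D assume D: "D \<noteq> {}" "subset.chain C D"
    have "cinner u v = (if u = v then 1 else 0)" if uv: "u \<in> \<Union>D" "v \<in> \<Union>D" for u v
    proof -
      obtain X Y where "u \<in> X" "X \<in> D" "v \<in> Y" "Y \<in> D" using uv by blast
      moreover have "X \<subseteq> Y \<or> Y \<subseteq> X" using D(2) \<open>X \<in> D\<close> \<open>Y \<in> D\<close> unfolding subset.chain_def by blast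
      ultimately obtain Z where "u \<in> Z" "v \<in> Z" "Z \<in> D" by blast
      moreover have "orthonormal Z (\<lambda>e. e)" using D \<open>Z \<in> D\<close> unfolding subset.chain_def C_def by blast
      ultimately show ?thesis unfolding orthonormal_def by blast
    qed
    moreover have "\<exists>t\<ge>0. a e = t *\<^sub>R e" if "e \<in> \<Union>D" for e
      using that D unfolding subset.chain_def C_def by blast
    ultimately show "\<Union>D \<in> C" unfolding C_def orthonormal_def by blast
  qed
  then obtain E where E: "E \<in> C" and max: "\<And>X. X \<in> C \<Longrightarrow> E \<subseteq> X \<Longrightarrow> X = E" by blast
  have "v0 = 0" if perp: "\<forall>e\<in>E. cinner e v0 = 0" for v0
  proof (rule ccontr)
    assume "v0 \<noteq> 0"
    define M where "M = (\<Inter>e\<in>E. {v. cinner e v = 0})"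
    have "closed M"
      unfolding M_def by (intro closed_INT ballI closed_Collect_eq continuous_on_const
          linear_continuous_on bounded_linear_cinner_right)
    moreover have "subspace M"
      by (auto simp: M_def subspace_def cinner_add_right)
    moreover have "a v \<in> M" if "v \<in> M" for v
    proof -
      have "cinner e (a v) = 0" if e: "e \<in> E" for e
      proof -
        obtain t where "a e = t *\<^sub>R e" using E e unfolding C_def by blast
        then show ?thesis using pos_op_sym[OF pos, of e v] \<open>v \<in> M\<close> e by (simp add: M_def)
      qed
      then show ?thesis by (simp add: M_def)
    qed
    moreover have "v0 \<in> M" using perp by (simp add: M_def)
    ultimately obtain z t where z: "z \<in> M" "norm z = 1" "0 \<le> t" "a z = t *\<^sub>R z"
      using positive_compact_eigenvector[OF pos comp, of M v0] \<open>v0 \<noteq> 0\<close> by blast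
    have zz: "cinner z z = 1" using z(2) by (simp add: cinner_self)
    have ez: "cinner e z = 0" "cinner z e = 0" if "e \<in> E" for e
      using z(1) that cinner_commute[of z e] by (auto simp: M_def)
    have "insert z E \<in> C"
    proof -
      have "orthonormal (insert z E) (\<lambda>e. e)"
        using E zz ez unfolding C_def orthonormal_def by auto
      moreover have "\<forall>e\<in>insert z E. \<exists>t\<ge>0. a e = t *\<^sub>R e"
        using E z(3,4) unfolding C_def by blast
      ultimately show ?thesis unfolding C_def by blast
    qed
    then have "z \<in> E" using max[of "insert z E"] by blast
    then show False using ez zz by force
  qed
  then have "onb E (\<lambda>e. e)" using E by (auto simp: onb_def C_def)
  moreover have "\<forall>e\<in>E. \<exists>t. 0 \<le> t \<and> a e = t *\<^sub>R e" using E by (auto simp: C_def)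
  then obtain l where "\<forall>e\<in>E. 0 \<le> l e \<and> a e = l e *\<^sub>R e" unfolding bchoice_iff by blast
  ultimately show ?thesis unfolding eigenbasis_def by blast
qed

lemma eigenbasisD:
  assumes "eigenbasis a E l"
  shows eigenbasis_onb: "onb E (\<lambda>e. e)"
    and eigenbasis_ge_0: "e \<in> E \<Longrightarrow> 0 \<le> l e"
    and eigenbasis_apply: "e \<in> E \<Longrightarrow> a e = l e *\<^sub>R e"
    and eigenbasis_norm: "e \<in> E \<Longrightarrow> norm e = 1"
  using assms orthonormal_norm[OF onb_orthonormal, of E "\<lambda>e. e"] by (auto simp: eigenbasis_def)

lemma eigenbasis_le_norm:
  assumes "eigenbasis a E l" "e \<in> E" shows "l e \<le> norm a"
  using norm_blinfun[of a e] eigenbasisD[OF assms(1)] assms(2) by simp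

lemma eigenbasis_powr_bound:
  assumes "eigenbasis a E l" "e \<in> E" "0 \<le> s"
  shows "cmod (of_real (l e powr s)) \<le> norm a powr s"
  using assms eigenbasis_le_norm[OF assms(1,2)] by (simp add: powr_mono2 eigenbasis_ge_0)

lemma cinner_eigenbasis:
  assumes "eigenbasis a E l" "pos_op a" "e \<in> E"
  shows "cinner e (a v) = of_real (l e) * cinner e v"
  using pos_op_sym[OF assms(2), of e v] eigenbasis_apply[OF assms(1,3)] by simp

section \<open>Real powers and traces of positive compact operators\<close>

abbreviation trace_powr :: "'i op \<Rightarrow> real \<Rightarrow> ennreal" where
  "trace_powr a s \<equiv> pos_trace (op_powr a s)"

text \<open>An eigenvector for \<open>t\<close> has components only along those \<open>e\<close>
  with \<open>l e = t\<close>, so the diagonal operator meets the description of the power.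
  Conversely, the description fixes the values on the basis, and continuity fixes the rest. In
  particular every eigenbasis computes the same power.\<close>

lemma op_powr_eigenbasis:
  assumes eb: "eigenbasis a E l" and pos: "pos_op a" and s: "0 \<le> s"
  shows "op_powr a s = diag_op E (\<lambda>e. e) (\<lambda>e. of_real (l e powr s))"
proof -
  let ?d = "diag_op E (\<lambda>e. e) (\<lambda>e. of_real (l e powr s))"
  note onb = eigenbasis_onb[OF eb]
  note D = diag_op_aux[OF onb eigenbasis_powr_bound[OF eb _ s] powr_ge_zero]
  have d: "?d v = (t powr s) *\<^sub>R v" if "t \<ge> 0" "a v = t *\<^sub>R v" for t v
  proof (rule onb_eqI[OF onb])
    fix e assume e: "e \<in> E"
    have "of_real (l e) * cinner e v = of_real t * cinner e v"
      using cinner_eigenbasis[OF eb pos e, of v] that by (metis cinner_scaleR_right)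
    then show "cinner e (?d v) = cinner e ((t powr s) *\<^sub>R v)"
      using D(1)[OF _ e] by auto
  qed
  show ?thesis
    unfolding op_powr_def
  proof (rule the_equality)
    show "\<forall>t\<ge>0. \<forall>v. a v = t *\<^sub>R v \<longrightarrow> ?d v = (t powr s) *\<^sub>R v" using d by blast
    fix b :: "'a op" assume b: "\<forall>t\<ge>0. \<forall>v. a v = t *\<^sub>R v \<longrightarrow> b v = (t powr s) *\<^sub>R v"
    show "b = ?d"
    proof (rule blinfun_eqI)
      fix v
      \<comment> \<open>The competitor \<open>b\<close> is merely real-linear, so agreement is
        needed on all complex multiples of \<open>e\<close>; these are eigenvectors too.\<close>
      have eq: "b (cscale c e) = ?d (cscale c e)" if "e \<in> E" for c e
      proof -
        have "a (cscale c e) = l e *\<^sub>R cscale c e"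
          using complex_linear_opD[OF pos_op_complex_linear[OF pos], of c e] eigenbasis_apply[OF eb that]
          by (simp add: cscale_scaleR)
        then show ?thesis using b d eigenbasis_ge_0[OF eb that] by metis
      qed
      note ex = onb_expansion[OF onb, of v]
      have "((\<lambda>e. b (cscale (cinner e v) e)) has_sum b v) E"
        by (rule has_sum_bounded_linear[OF blinfun.bounded_linear_right ex])
      moreover have "((\<lambda>e. ?d (cscale (cinner e v) e)) has_sum ?d v) E"
        by (rule has_sum_bounded_linear[OF blinfun.bounded_linear_right ex])
      then have "((\<lambda>e. b (cscale (cinner e v) e)) has_sum ?d v) E"
        by (subst has_sum_cong) (auto simp: eq)
      ultimately show "b v = ?d v" by (rule has_sum_unique)
    qed
  qed
qed

lemma op_powr_apply_eigenbasis:
  assumes eb: "eigenbasis a E l" and pos: "pos_op a" and s: "0 \<le> s"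
  shows cinner_op_powr: "e \<in> E \<Longrightarrow> cinner e ((op_powr a s) v) = of_real (l e powr s) * cinner e v"
    and op_powr_apply: "e \<in> E \<Longrightarrow> (op_powr a s) e = (l e powr s) *\<^sub>R e"
    and op_powr_complex_linear: "complex_linear_op (op_powr a s)"
  using diag_op_aux[OF eigenbasis_onb[OF eb] eigenbasis_powr_bound[OF eb _ s] powr_ge_zero]
    diag_op_apply[OF eigenbasis_onb[OF eb] eigenbasis_powr_bound[OF eb _ s] powr_ge_zero]
  unfolding op_powr_eigenbasis[OF assms] by (auto simp: cscale_of_real)

lemma has_sum_op_powr_form:
  assumes eb: "eigenbasis a E l" and pos: "pos_op a" and s: "0 \<le> s"
  shows "((\<lambda>e. l e powr s * (cmod (cinner e v))\<^sup>2) has_sum qform (op_powr a s) v) E"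
proof -
  have "((\<lambda>e. Re (cnj (cinner e v) * cinner e ((op_powr a s) v))) has_sum
     qform (op_powr a s) v) E"
    by (rule has_sum_Re[OF onb_parseval_cinner[OF eigenbasis_onb[OF eb]]])
  also have "?this \<longleftrightarrow> ?thesis"
  proof (rule has_sum_cong)
    fix e assume "e \<in> E"
    have "cnj (cinner e v) * cinner e ((op_powr a s) v) = of_real (l e powr s) * of_real ((cmod (cinner e v))\<^sup>2)"
      unfolding cinner_op_powr[OF assms \<open>e \<in> E\<close>] complex_norm_square by (simp add: mult_ac)
    then show "Re (cnj (cinner e v) * cinner e ((op_powr a s) v)) = l e powr s * (cmod (cinner e v))\<^sup>2"
      by (simp del: of_real_power flip: of_real_mult)
  qed
  finally show ?thesis .
qed

lemma has_sum_eigenbasis_form: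
  assumes eb: "eigenbasis a E l" and pos: "pos_op a"
  shows "((\<lambda>e. l e * (cmod (cinner e v))\<^sup>2) has_sum qform a v) E"
proof -
  have "(op_powr a 1) v = a v"
    by (rule onb_eqI[OF eigenbasis_onb[OF eb]])
       (use eigenbasis_ge_0[OF eb] cinner_op_powr[OF eb pos, of 1] cinner_eigenbasis[OF eb pos] in auto)
  then show ?thesis using has_sum_op_powr_form[OF eb pos, of 1 v] eigenbasis_ge_0[OF eb]
    by (subst has_sum_cong[where g = "\<lambda>e. l e powr 1 * (cmod (cinner e v))\<^sup>2"]) auto
qed

lemma pos_op_powr:
  assumes pos: "pos_op a" "compact_op a" and s: "0 \<le> s"
  shows "pos_op (op_powr a s)"
proof -
  obtain E l where eb: "eigenbasis a E l" using spectral_theorem[OF assms(1,2)] by blast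
  note onb = eigenbasis_onb[OF eb]
  have "cinner ((op_powr a s) u) v = cinner u ((op_powr a s) v)" for u v
  proof -
    have "((\<lambda>e. cnj (cinner e ((op_powr a s) u)) * cinner e v) has_sum cinner ((op_powr a s) u) v) E"
      by (rule onb_parseval_cinner[OF onb])
    also have "?this \<longleftrightarrow> ((\<lambda>e. cnj (cinner e u) * cinner e ((op_powr a s) v)) has_sum cinner ((op_powr a s) u) v) E"
      by (rule has_sum_cong) (simp add: cinner_op_powr[OF eb assms(1) s])
    finally show ?thesis using onb_parseval_cinner[OF onb] has_sum_unique by blast
  qed
  moreover have "0 \<le> qform (op_powr a s) v" for v
    by (rule has_sum_nonneg[OF has_sum_op_powr_form[OF eb assms(1) s]]) simp
  ultimately show ?thesis using op_powr_complex_linear[OF eb assms(1) s] by (simp add: pos_op_def)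
qed

section \<open>Unordered sums with values in the extended nonnegative reals\<close>

lemma ennreal_infsum_has_sum:
  assumes "(f has_sum S) A" "\<And>x. x \<in> A \<Longrightarrow> 0 \<le> f x"
  shows "(\<Sum>\<^sub>\<infinity>x\<in>A. ennreal (f x)) = ennreal S"
proof -
  have s: "f summable_on A" "infsum f A = S" using assms(1) infsumI has_sum_imp_summable by auto
  have "ennreal (infsum f A) = (SUP F\<in>{F. finite F \<and> F \<subseteq> A}. ennreal (sum f F))"
    by (rule infsum_nonneg_is_SUPREMUM_ennreal) (use s assms in auto)
  also have "\<dots> = (SUP F\<in>{F. finite F \<and> F \<subseteq> A}. \<Sum>x\<in>F. ennreal (f x))"
    by (intro SUP_cong refl) (use assms(2) in \<open>auto simp: subset_iff intro!: sum_ennreal[symmetric]\<close>)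
  also have "\<dots> = (\<Sum>\<^sub>\<infinity>x\<in>A. ennreal (f x))" by (rule nonneg_infsum_complete[symmetric]) simp
  finally show ?thesis by (simp add: s)
qed

lemma ennreal_summable: "(f :: 'a \<Rightarrow> ennreal) summable_on A"
  by (rule nonneg_summable_on_complete) simp

lemma finite_sum_le_ennreal_infsum:
  fixes f :: "'a \<Rightarrow> ennreal"
  assumes "finite F" "F \<subseteq> A" shows "sum f F \<le> infsum f A"
  by (subst nonneg_infsum_complete) (use assms in \<open>auto intro: SUP_upper\<close>)

lemma ennreal_infsum_finite_summable:
  assumes fin: "(\<Sum>\<^sub>\<infinity>x\<in>A. ennreal (f x)) < \<infinity>" and nn: "\<And>x. x \<in> A \<Longrightarrow> 0 \<le> f x"
  shows "f summable_on A"
proof (rule nonneg_bdd_above_summable_on[OF nn])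
  show "bdd_above (sum f ` {F. F \<subseteq> A \<and> finite F})"
  proof (rule bdd_aboveI)
    fix S assume "S \<in> sum f ` {F. F \<subseteq> A \<and> finite F}"
    then obtain F where F: "F \<subseteq> A" "finite F" "S = sum f F" by blast
    have "ennreal S = (\<Sum>x\<in>F. ennreal (f x))" using F nn by (subst sum_ennreal) (auto simp: subset_iff)
    also have "\<dots> \<le> (\<Sum>\<^sub>\<infinity>x\<in>A. ennreal (f x))" by (rule finite_sum_le_ennreal_infsum) (use F in auto)
    finally have "enn2real (ennreal S) \<le> enn2real (\<Sum>\<^sub>\<infinity>x\<in>A. ennreal (f x))"
      by (rule enn2real_mono) (use fin in simp)
    moreover have "0 \<le> S" using F nn by (auto intro!: sum_nonneg)
    ultimately show "S \<le> enn2real (\<Sum>\<^sub>\<infinity>x\<in>A. ennreal (f x))" by simp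
  qed
qed

lemma infsum_sum_ennreal:
  fixes f :: "'a \<Rightarrow> 'b \<Rightarrow> ennreal"
  assumes "finite F" shows "(\<Sum>\<^sub>\<infinity>y\<in>B. \<Sum>x\<in>F. f x y) = (\<Sum>x\<in>F. \<Sum>\<^sub>\<infinity>y\<in>B. f x y)"
  using assms by (induction F) (simp_all add: infsum_add ennreal_summable)

text \<open>Finite sums commute with unordered ones, and the left side is a supremum over finite
  sets. The inequality is symmetric in the two index sets, so it already contains Tonelli's
  theorem.\<close>

lemma infsum_swap_ennreal_le:
  fixes f :: "'a \<Rightarrow> 'b \<Rightarrow> ennreal"
  shows "(\<Sum>\<^sub>\<infinity>x\<in>A. \<Sum>\<^sub>\<infinity>y\<in>B. f x y) \<le> (\<Sum>\<^sub>\<infinity>y\<in>B. \<Sum>\<^sub>\<infinity>x\<in>A. f x y)"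
proof -
  have "(\<Sum>x\<in>F. \<Sum>\<^sub>\<infinity>y\<in>B. f x y) \<le> (\<Sum>\<^sub>\<infinity>y\<in>B. \<Sum>\<^sub>\<infinity>x\<in>A. f x y)" if "finite F" "F \<subseteq> A" for F
    unfolding infsum_sum_ennreal[OF that(1), symmetric]
    by (rule infsum_mono) (use that in \<open>auto intro: finite_sum_le_ennreal_infsum ennreal_summable\<close>)
  then show ?thesis by (subst nonneg_infsum_complete) (auto intro: SUP_least)
qed

lemma infsum_swap_ennreal:
  fixes f :: "'a \<Rightarrow> 'b \<Rightarrow> ennreal"
  shows "(\<Sum>\<^sub>\<infinity>x\<in>A. \<Sum>\<^sub>\<infinity>y\<in>B. f x y) = (\<Sum>\<^sub>\<infinity>y\<in>B. \<Sum>\<^sub>\<infinity>x\<in>A. f x y)"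
  by (intro antisym infsum_swap_ennreal_le)

lemma infsum_cmult_ennreal:
  fixes f :: "'a \<Rightarrow> ennreal"
  shows "(\<Sum>\<^sub>\<infinity>x\<in>A. c * f x) = c * (\<Sum>\<^sub>\<infinity>x\<in>A. f x)"
proof -
  have "c * (\<Sum>\<^sub>\<infinity>x\<in>A. f x) = (SUP F\<in>{F. finite F \<and> F \<subseteq> A}. c * sum f F)"
    by (subst nonneg_infsum_complete) (auto simp: SUP_mult_left_ennreal image_image)
  also have "\<dots> = (\<Sum>\<^sub>\<infinity>x\<in>A. c * f x)"
    by (subst nonneg_infsum_complete) (auto simp: sum_distrib_left)
  finally show ?thesis by simp
qed

text \<open>The family \<open>f\<close> is left arbitrary on purpose: the inner sum equals 1 for a
  basis, is at most 1 for an orthonormal family, and measures a truncated eigenvector when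
  \<open>f\<close> is a projected basis. All three cases are used.\<close>

lemma trace_form_swap:
  assumes eb: "eigenbasis a E l" and pos: "pos_op a" and s: "0 \<le> s"
  shows "(\<Sum>\<^sub>\<infinity>j\<in>J. ennreal (qform (op_powr a s) (f j)))
     = (\<Sum>\<^sub>\<infinity>e\<in>E. ennreal (l e powr s) * (\<Sum>\<^sub>\<infinity>j\<in>J. ennreal ((cmod (cinner (f j) e))\<^sup>2)))"
proof -
  have "(\<Sum>\<^sub>\<infinity>j\<in>J. ennreal (qform (op_powr a s) (f j)))
     = (\<Sum>\<^sub>\<infinity>j\<in>J. \<Sum>\<^sub>\<infinity>e\<in>E. ennreal (l e powr s * (cmod (cinner e (f j)))\<^sup>2))"
    by (intro infsum_cong ennreal_infsum_has_sum[symmetric] has_sum_op_powr_form[OF assms]) simp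
  also have "\<dots> = (\<Sum>\<^sub>\<infinity>e\<in>E. \<Sum>\<^sub>\<infinity>j\<in>J. ennreal (l e powr s) * ennreal ((cmod (cinner (f j) e))\<^sup>2))"
    by (subst infsum_swap_ennreal) (simp add: ennreal_mult cinner_commute[of "f _"])
  finally show ?thesis by (simp add: infsum_cmult_ennreal)
qed

lemma trace_powr_onb_eigenbasis:
  assumes eb: "eigenbasis a E l" and pos: "pos_op a" and s: "0 \<le> s" and J: "onb J f"
  shows "(\<Sum>\<^sub>\<infinity>j\<in>J. ennreal (qform (op_powr a s) (f j))) = (\<Sum>\<^sub>\<infinity>e\<in>E. ennreal (l e powr s))"
  unfolding trace_form_swap[OF assms(1-3)]
  by (intro infsum_cong) (simp add: ennreal_infsum_has_sum[OF onb_parseval[OF J]] eigenbasis_norm[OF eb])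

lemma pos_trace_eigenbasis:
  assumes "eigenbasis a E l" "pos_op a" "0 \<le> s"
  shows "trace_powr a s = (\<Sum>\<^sub>\<infinity>e\<in>E. ennreal (l e powr s))"
  unfolding pos_trace_def by (rule trace_powr_onb_eigenbasis[OF assms onb_ket])

lemma pos_trace_onb:
  assumes "pos_op a" "compact_op a" "0 \<le> s" "onb J f"
  shows "trace_powr a s = (\<Sum>\<^sub>\<infinity>j\<in>J. ennreal (qform (op_powr a s) (f j)))"
  using spectral_theorem[OF assms(1,2)] pos_trace_eigenbasis trace_powr_onb_eigenbasis assms by metis

lemma pos_trace_orthonormal_le:
  assumes "pos_op a" "compact_op a" "0 \<le> s" and J: "orthonormal J f"
  shows "(\<Sum>\<^sub>\<infinity>j\<in>J. ennreal (qform (op_powr a s) (f j))) \<le> trace_powr a s"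
proof -
  obtain E l where eb: "eigenbasis a E l" using spectral_theorem[OF assms(1,2)] by blast
  have "(\<Sum>\<^sub>\<infinity>j\<in>J. ennreal ((cmod (cinner (f j) e))\<^sup>2)) \<le> 1" if "e \<in> E" for e
  proof (subst nonneg_infsum_complete)
    show "(SUP F\<in>{F. finite F \<and> F \<subseteq> J}. \<Sum>j\<in>F. ennreal ((cmod (cinner (f j) e))\<^sup>2)) \<le> 1"
      by (rule SUP_least)
         (use bessel_finite[OF J, of _ e] eigenbasis_norm[OF eb that] in \<open>auto simp: sum_ennreal\<close>)
  qed simp
  then have "(\<Sum>\<^sub>\<infinity>e\<in>E. ennreal (l e powr s) * (\<Sum>\<^sub>\<infinity>j\<in>J. ennreal ((cmod (cinner (f j) e))\<^sup>2))) \<le> (\<Sum>\<^sub>\<infinity>e\<in>E. ennreal (l e powr s))"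
    by (intro infsum_mono ennreal_summable) (auto intro: mult_left_le)
  then show ?thesis unfolding trace_form_swap[OF eb assms(1,3)] pos_trace_eigenbasis[OF eb assms(1,3)] .
qed

section \<open>Trace inequalities\<close>

text \<open>The convex function \<open>t powr s\<close> lies above its tangent at \<open>u\<close>;
  this is Young's inequality with weights \<open>1/s\<close> and \<open>1 - 1/s\<close>.\<close>

lemma powr_tangent_ge:
  fixes t u s :: real
  assumes "s \<ge> 1" "t \<ge> 0" "u > 0"
  shows "s * u powr (s - 1) * t \<le> t powr s + (s - 1) * u powr s"
proof (cases "t = 0")
  case False
  then have t: "t > 0" using assms by simp
  have "(t powr s) powr (1/s) * (u powr s) powr (1 - 1/s) \<le> (1/s) * t powr s + (1 - 1/s) * u powr s"
    by (rule Youngs_inequality_0) (use assms t in auto)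
  moreover have "(t powr s) powr (1/s) = t" "(u powr s) powr (1 - 1/s) = u powr (s - 1)"
    using assms t by (simp_all add: powr_powr right_diff_distrib)
  ultimately have "s * (t * u powr (s - 1)) \<le> s * ((1/s) * t powr s + (1 - 1/s) * u powr s)"
    using assms by (intro mult_left_mono) auto
  also have "\<dots> = t powr s + (s - 1) * u powr s" using assms by (simp add: field_simps)
  finally show ?thesis by (simp add: mult_ac)
qed (use assms in simp)

lemma powr_tangent_le:
  fixes t u s :: real
  assumes "0 < s" "s \<le> 1" "t \<ge> 0" "u > 0"
  shows "t powr s \<le> s * u powr (s - 1) * t + (1 - s) * u powr s"
proof (cases "t = 0")
  case False
  then have t: "t > 0" using assms by simp
  have "t powr s * u powr (1 - s) \<le> s * t + (1 - s) * u"
    by (rule Youngs_inequality_0) (use assms t in auto)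
  then have "(t powr s * u powr (1 - s)) * u powr (s - 1) \<le> (s * t + (1 - s) * u) * u powr (s - 1)"
    by (rule mult_right_mono) simp
  moreover have "u powr (1 - s) * u powr (s - 1) = 1" "u * u powr (s - 1) = u powr s"
    using assms by (simp_all add: powr_mult_base flip: powr_add)
  ultimately show ?thesis by (simp add: algebra_simps)
qed (use assms in simp)

text \<open>Jensen's inequality for the weights \<open>(cmod (cinner e f))\<^sup>2\<close> on the
  eigenvalues, obtained by summing the tangent inequality at the mean \<open>t0\<close>. Total mass
  below 1 is harmless because the constant term of the tangent has a favourable sign; this admits
  the shortened vectors produced by projections.\<close>

lemma jensen_form_ge:
  assumes a: "pos_op a" "compact_op a" and s: "s \<ge> 1" and f: "norm f \<le> 1"
  shows "(qform a f) powr s \<le> qform (op_powr a s) f"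
proof (cases "qform a f = 0")
  case True
  then show ?thesis using pos_op_ge_0[OF pos_op_powr[OF a]] s by simp
next
  case False
  define t0 where "t0 = qform a f"
  define S where "S = qform (op_powr a s) f"
  have t0: "t0 > 0" using False pos_op_ge_0[OF a(1), of f] by (simp add: t0_def)
  obtain E l where eb: "eigenbasis a E l" using spectral_theorem[OF a] by blast
  let ?w = "\<lambda>e. (cmod (cinner e f))\<^sup>2"
  have "((\<lambda>e. s * t0 powr (s - 1) * (l e * ?w e)) has_sum s * t0 powr (s - 1) * t0) E"
    unfolding t0_def by (intro has_sum_cmult_right has_sum_eigenbasis_form[OF eb a(1)])
  moreover have "((\<lambda>e. l e powr s * ?w e + (s - 1) * t0 powr s * ?w e) has_sum S + (s - 1) * t0 powr s * (norm f)\<^sup>2) E"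
    unfolding S_def using s
    by (intro has_sum_add has_sum_cmult_right has_sum_op_powr_form[OF eb a(1)] onb_parseval eigenbasis_onb[OF eb]) auto
  moreover have "s * t0 powr (s - 1) * (l e * ?w e) \<le> l e powr s * ?w e + (s - 1) * t0 powr s * ?w e" if "e \<in> E" for e
    using mult_right_mono[OF powr_tangent_ge[OF s eigenbasis_ge_0[OF eb that] t0], of "?w e"] by (simp add: algebra_simps)
  ultimately have "s * t0 powr (s - 1) * t0 \<le> S + (s - 1) * t0 powr s * (norm f)\<^sup>2" by (rule has_sum_mono)
  also have "\<dots> \<le> S + (s - 1) * t0 powr s * 1"
    using s f by (intro add_left_mono mult_left_mono) (auto simp: power_le_one)
  finally have "s * t0 powr s \<le> S + (s - 1) * t0 powr s"
    using t0 powr_mult_base[of t0 "s - 1"] by (simp add: mult_ac)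
  then show ?thesis unfolding t0_def[symmetric] S_def[symmetric] by (simp add: algebra_simps)
qed

lemma jensen_form_le:
  assumes a: "pos_op a" "compact_op a" and s: "0 < s" "s \<le> 1" and f: "norm f = 1"
  shows "qform (op_powr a s) f \<le> (qform a f) powr s"
proof -
  define t0 where "t0 = qform a f"
  define S where "S = qform (op_powr a s) f"
  have t00: "t0 \<ge> 0" using pos_op_ge_0[OF a(1), of f] by (simp add: t0_def)
  obtain E l where eb: "eigenbasis a E l" using spectral_theorem[OF a] by blast
  let ?w = "\<lambda>e. (cmod (cinner e f))\<^sup>2"
  have hS: "((\<lambda>e. l e powr s * ?w e) has_sum S) E"
    unfolding S_def using s by (intro has_sum_op_powr_form[OF eb a(1)]) auto
  have h0: "((\<lambda>e. l e * ?w e) has_sum t0) E"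
    unfolding t0_def by (rule has_sum_eigenbasis_form[OF eb a(1)])
  show ?thesis
  proof (cases "t0 = 0")
    \<comment> \<open>At mean 0 the tangent of the concave power is vertical; instead all weighted
      eigenvalues vanish.\<close>
    case True
    have "l e * ?w e = 0" if "e \<in> E" for e
      by (rule nonneg_has_sum_le_0D[OF h0 _ _ that]) (use True eigenbasis_ge_0[OF eb] in auto)
    then have "((\<lambda>e. 0) has_sum S) E"
      by (subst has_sum_cong[where g = "\<lambda>e. l e powr s * ?w e"]) (use hS in auto)
    then have "S = 0" using has_sum_0_simp has_sum_unique by blast
    then show ?thesis using True unfolding t0_def[symmetric] S_def[symmetric] by simp
  next
    case False
    then have t0: "t0 > 0" using t00 by simp
    have "((\<lambda>e. s * t0 powr (s - 1) * (l e * ?w e) + (1 - s) * t0 powr s * ?w e) has_sum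
        s * t0 powr (s - 1) * t0 + (1 - s) * t0 powr s * (norm f)\<^sup>2) E"
      by (intro has_sum_add has_sum_cmult_right h0 onb_parseval eigenbasis_onb[OF eb])
    moreover have "l e powr s * ?w e \<le> s * t0 powr (s - 1) * (l e * ?w e) + (1 - s) * t0 powr s * ?w e" if "e \<in> E" for e
      using mult_right_mono[OF powr_tangent_le[OF s eigenbasis_ge_0[OF eb that] t0], of "?w e"] by (simp add: algebra_simps)
    ultimately have "S \<le> s * t0 powr (s - 1) * t0 + (1 - s) * t0 powr s * (norm f)\<^sup>2"
      using has_sum_mono[OF hS] by blast
    also have "\<dots> = t0 powr s"
      using t0 powr_mult_base[of t0 "s - 1"] f by (simp add: algebra_simps)
    finally show ?thesis unfolding t0_def[symmetric] S_def[symmetric] .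
  qed
qed

lemma eigenbasis_form:
  assumes "eigenbasis a E l" "e \<in> E"
  shows "qform a e = l e"
  using eigenbasisD[OF assms(1)] assms(2) by (simp add: cinner_self)

text \<open>For concave powers the diagonal in any basis, not only in an eigenbasis, bounds the
  trace from above, so the basis can be adapted to another operator.\<close>

lemma pos_trace_le_form_sum:
  assumes a: "pos_op a" "compact_op a" and s: "0 < s" "s \<le> 1" and J: "onb J f"
  shows "trace_powr a s \<le> (\<Sum>\<^sub>\<infinity>j\<in>J. ennreal (qform a (f j) powr s))"
  unfolding pos_trace_onb[OF a less_imp_le[OF s(1)] J]
  by (intro infsum_mono ennreal_summable ennreal_leI jensen_form_le[OF a s] orthonormal_norm[OF onb_orthonormal[OF J]])

text \<open>Jensen's inequality is used in an eigenbasis of \<open>a\<close> if \<open>s \<ge> 1\<close> and in one of \<open>b\<close> if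
  \<open>s < 1\<close>, so the eigenvalues never have to be ordered.\<close>

theorem pos_trace_powr_mono:
  assumes a: "pos_op a" "compact_op a" and b: "pos_op b" "compact_op b" and s: "0 < s"
    and le: "\<And>v. qform a v \<le> qform b v"
  shows "trace_powr a s \<le> trace_powr b s"
proof (cases "s \<ge> 1")
  case True
  obtain E l where eb: "eigenbasis a E l" using spectral_theorem[OF a] by blast
  note onb = eigenbasis_onb[OF eb]
  have "trace_powr a s = (\<Sum>\<^sub>\<infinity>e\<in>E. ennreal (qform a e powr s))"
    unfolding pos_trace_eigenbasis[OF eb a(1) less_imp_le[OF s]]
    by (intro infsum_cong) (simp add: eigenbasis_form[OF eb])
  also have "\<dots> \<le> (\<Sum>\<^sub>\<infinity>e\<in>E. ennreal (qform (op_powr b s) e))"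
  proof (intro infsum_mono ennreal_summable ennreal_leI)
    fix e assume "e \<in> E"
    have "qform a e powr s \<le> qform b e powr s"
      using s by (intro powr_mono2 pos_op_ge_0[OF a(1)] le) auto
    also have "\<dots> \<le> qform (op_powr b s) e"
      using eigenbasis_norm[OF eb \<open>e \<in> E\<close>] by (intro jensen_form_ge b True) simp
    finally show "qform a e powr s \<le> qform (op_powr b s) e" .
  qed
  also have "\<dots> = trace_powr b s"
    by (rule pos_trace_onb[OF b less_imp_le[OF s] onb, symmetric])
  finally show ?thesis .
next
  case False
  obtain E l where eb: "eigenbasis b E l" using spectral_theorem[OF b] by blast
  have "trace_powr a s \<le> (\<Sum>\<^sub>\<infinity>e\<in>E. ennreal (qform a e powr s))"
    by (rule pos_trace_le_form_sum[OF a s _ eigenbasis_onb[OF eb]]) (use False in auto)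
  also have "\<dots> \<le> (\<Sum>\<^sub>\<infinity>e\<in>E. ennreal (l e powr s))"
  proof (intro infsum_mono ennreal_summable ennreal_leI)
    fix e assume "e \<in> E"
    then show "qform a e powr s \<le> l e powr s"
      using le[of e] s eigenbasis_form[OF eb] by (intro powr_mono2 pos_op_ge_0[OF a(1)]) auto
  qed
  finally show ?thesis by (simp add: pos_trace_eigenbasis[OF eb b(1) less_imp_le[OF s]])
qed

lemma op_powr_eigenvector:
  assumes a: "pos_op a" "compact_op a" and s: "0 \<le> s" and v: "a v = t *\<^sub>R v"
  shows "(op_powr a s) v = (t powr s) *\<^sub>R v"
proof -
  obtain E l where eb: "eigenbasis a E l" using spectral_theorem[OF a] by blast
  show ?thesis
  proof (rule onb_eqI[OF eigenbasis_onb[OF eb]])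
    fix e assume e: "e \<in> E"
    have "of_real (l e) * cinner e v = of_real t * cinner e v"
      using cinner_eigenbasis[OF eb a(1) e, of v] v by (metis cinner_scaleR_right)
    then show "cinner e ((op_powr a s) v) = cinner e ((t powr s) *\<^sub>R v)"
      using cinner_op_powr[OF eb a(1) s e, of v] by auto
  qed
qed

lemma pos_trace_scaleR:
  assumes a: "pos_op a" "compact_op a" and s: "0 < s" and c: "0 \<le> c"
  shows "pos_op (c *\<^sub>R a)" "compact_op (c *\<^sub>R a)"
    "trace_powr (c *\<^sub>R a) s = ennreal (c powr s) * trace_powr a s"
proof -
  show p: "pos_op (c *\<^sub>R a)"
    using a(1) c by (auto simp: pos_op_def blinfun.scaleR_left)
  have "c *\<^sub>R a = (c *\<^sub>R id_blinfun) o\<^sub>L a" by (rule blinfun_eqI) (simp add: blinfun.scaleR_left)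
  then show "compact_op (c *\<^sub>R a)" using compact_op_compose_left[OF a(2)] by simp
  obtain E l where eb: "eigenbasis a E l" using spectral_theorem[OF a] by blast
  have "eigenbasis (c *\<^sub>R a) E (\<lambda>e. c * l e)"
    using eb c by (auto simp: eigenbasis_def blinfun.scaleR_left)
  from pos_trace_eigenbasis[OF this p less_imp_le[OF s]]
  have "trace_powr (c *\<^sub>R a) s = (\<Sum>\<^sub>\<infinity>e\<in>E. ennreal (c powr s) * ennreal (l e powr s))"
    using eigenbasis_ge_0[OF eb] c by (simp add: powr_mult ennreal_mult cong: infsum_cong)
  then show "trace_powr (c *\<^sub>R a) s = ennreal (c powr s) * trace_powr a s"
    by (simp add: infsum_cmult_ennreal pos_trace_eigenbasis[OF eb a(1) less_imp_le[OF s]])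
qed

text \<open>As in the polar decomposition, the vectors \<open>x e\<close> divided by the singular
  values \<open>sqrt (l e)\<close> are orthonormal eigenvectors of
  \<open>x o\<^sub>L op_adj x\<close> for the same eigenvalues. They need not form a basis, which
  costs an inequality; applying it to the adjoint as well restores equality.\<close>

lemma pos_trace_adj_le:
  assumes x: "complex_linear_op x" "compact_op (op_adj x o\<^sub>L x)" "compact_op (x o\<^sub>L op_adj x)" and s: "0 < s"
  shows "trace_powr (op_adj x o\<^sub>L x) s \<le> trace_powr (x o\<^sub>L op_adj x) s"
proof -
  have p: "pos_op (op_adj x o\<^sub>L x)" "pos_op (x o\<^sub>L op_adj x)"
    using pos_op_adj_compose[OF x(1)] pos_op_adj_compose[OF complex_linear_adj[OF x(1)]] x(1) by simp_all
  obtain E l where eb: "eigenbasis (op_adj x o\<^sub>L x) E l"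
    using spectral_theorem[OF p(1) x(2)] by blast
  define E' where "E' = {e \<in> E. l e \<noteq> 0}"
  define f where "f e = (1 / sqrt (l e)) *\<^sub>R x e" for e
  have lp: "l e > 0" if "e \<in> E'" for e using that eigenbasis_ge_0[OF eb] by (force simp: E'_def)
  have ax: "(op_adj x) (x e) = l e *\<^sub>R e" if "e \<in> E" for e
    using eigenbasis_apply[OF eb that] by simp
  have on: "orthonormal E' f"
    unfolding orthonormal_def
  proof (intro ballI)
    fix e e' assume e: "e \<in> E'" "e' \<in> E'"
    then have eE: "e \<in> E" "e' \<in> E" by (auto simp: E'_def)
    have "cinner (x e) (x e') = cinner e ((op_adj x) (x e'))"
      by (simp add: cinner_adj_right[OF x(1)])
    also have "\<dots> = of_real (l e') * (if e = e' then 1 else 0)"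
      using onb_orthonormal[OF eigenbasis_onb[OF eb]] eE by (simp add: ax orthonormal_def)
    finally have "cinner (f e) (f e') = of_real (1 / sqrt (l e) * (1 / sqrt (l e')) * l e') * (if e = e' then 1 else 0)"
      by (simp add: f_def)
    then show "cinner (f e) (f e') = (if e = e' then 1 else 0)"
      using lp[OF e(1)] by (auto simp flip: of_real_mult)
  qed
  have fe: "qform (op_powr (x o\<^sub>L op_adj x) s) (f e) = l e powr s" if e: "e \<in> E'" for e
  proof -
    have "e \<in> E" using e by (simp add: E'_def)
    then have "(x o\<^sub>L op_adj x) (f e) = l e *\<^sub>R f e"
      by (simp add: f_def blinfun.scaleR_right ax)
    from op_powr_eigenvector[OF p(2) x(3) less_imp_le[OF s] this] orthonormal_norm[OF on e]
    show ?thesis by (simp add: cinner_self)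
  qed
  have "trace_powr (op_adj x o\<^sub>L x) s = (\<Sum>\<^sub>\<infinity>e\<in>E. ennreal (l e powr s))"
    by (rule pos_trace_eigenbasis[OF eb p(1) less_imp_le[OF s]])
  also have "\<dots> = (\<Sum>\<^sub>\<infinity>e\<in>E'. ennreal (l e powr s))"
    by (rule infsum_cong_neutral) (use s in \<open>auto simp: E'_def\<close>)
  also have "\<dots> = (\<Sum>\<^sub>\<infinity>e\<in>E'. ennreal (qform (op_powr (x o\<^sub>L op_adj x) s) (f e)))"
    by (rule infsum_cong) (simp add: fe)
  also have "\<dots> \<le> trace_powr (x o\<^sub>L op_adj x) s"
    by (rule pos_trace_orthonormal_le[OF p(2) x(3) less_imp_le[OF s] on])
  finally show ?thesis .
qed

lemma pos_trace_adj_commute: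
  assumes x: "complex_linear_op x" "compact_op (op_adj x o\<^sub>L x)" "compact_op (x o\<^sub>L op_adj x)" and s: "0 < s"
  shows "trace_powr (op_adj x o\<^sub>L x) s = trace_powr (x o\<^sub>L op_adj x) s"
  using pos_trace_adj_le[OF assms] pos_trace_adj_le[of "op_adj x" s] assms by (simp add: antisym)

text \<open>The power of each eigenvalue is a single term of the trace, so all eigenvalues, and with
  them the form on the unit ball, are bounded. This makes the Schatten norm dominate the operator
  norm.\<close>

lemma form_powr_le_pos_trace:
  assumes a: "pos_op a" "compact_op a" and s: "0 < s" and f: "norm f \<le> 1"
  shows "ennreal (qform a f powr s) \<le> trace_powr a s"
proof (cases "trace_powr a s < \<infinity>")
  case True
  obtain E l where eb: "eigenbasis a E l" using spectral_theorem[OF a] by blast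
  define K where "K = enn2real (trace_powr a s)"
  have K: "ennreal K = trace_powr a s" using True by (simp add: K_def)
  have l: "l e \<le> K powr (1/s)" if "e \<in> E" for e
  proof -
    have "ennreal (l e powr s) \<le> ennreal K"
      unfolding K pos_trace_eigenbasis[OF eb a(1) less_imp_le[OF s]]
      using finite_sum_le_ennreal_infsum[of "{e}" E "\<lambda>e. ennreal (l e powr s)"] that by simp
    then have "l e powr s \<le> K" by (simp add: K_def)
    then have "(l e powr s) powr (1/s) \<le> K powr (1/s)" using s by (intro powr_mono2) auto
    then show ?thesis using s eigenbasis_ge_0[OF eb that] by (simp add: powr_powr)
  qed
  have "qform a f \<le> K powr (1/s) * (norm f)\<^sup>2"
  proof (rule has_sum_mono[OF has_sum_eigenbasis_form[OF eb a(1)]])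
    show "((\<lambda>e. K powr (1/s) * (cmod (cinner e f))\<^sup>2) has_sum K powr (1/s) * (norm f)\<^sup>2) E"
      by (intro has_sum_cmult_right onb_parseval eigenbasis_onb[OF eb])
  qed (intro mult_right_mono l zero_le_power2)
  also have "\<dots> \<le> K powr (1/s) * 1" using f by (intro mult_left_mono) (auto simp: power_le_one)
  finally have "qform a f powr s \<le> (K powr (1/s)) powr s"
    using s by (intro powr_mono2 pos_op_ge_0[OF a(1)]) auto
  also have "\<dots> = K" using s by (simp add: powr_powr K_def)
  finally show ?thesis unfolding K[symmetric] by (rule ennreal_leI)
next
  case False
  then have "trace_powr a s = top" by (metis top.not_eq_extremum infinity_ennreal_def)
  then show ?thesis by simp
qed

section \<open>Coordinate projections\<close>

definition coord_proj :: "'i set \<Rightarrow> 'i op" where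
  "coord_proj A = diag_op UNIV ket (\<lambda>i. if i \<in> A then 1 else 0)"

lemma
  shows coord_proj_nth [simp]: "ell2_nth ((coord_proj A) v) i = (if i \<in> A then ell2_nth v i else 0)"
    and coord_proj_complex_linear [simp]: "complex_linear_op (coord_proj A)"
    and norm_coord_proj_le: "norm (coord_proj A) \<le> 1"
  using diag_op_aux[OF onb_ket, of "\<lambda>i. if i \<in> A then 1 else 0" 1] unfolding coord_proj_def by auto

lemma coord_proj_adj [simp]: "op_adj (coord_proj A) = coord_proj A"
proof (rule op_adj_eqI)
  fix u v
  show "cinner ((coord_proj A) u) v = cinner u ((coord_proj A) v)"
    unfolding cinner.rep_eq by (rule infsum_cong) simp
qed

lemma coord_proj_compl: "coord_proj (- A) = id_blinfun - coord_proj A"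
  by (intro blinfun_eqI ell2_eqI) (simp add: blinfun.diff_left)

lemma norm_coord_proj_apply_le: "norm ((coord_proj A) v) \<le> norm v"
  using norm_blinfun[of "coord_proj A" v] mult_right_mono[OF norm_coord_proj_le, of "norm v" A] by simp

lemma coord_proj_tendsto_0:
  "((\<lambda>F. norm ((coord_proj (- F)) v)) \<longlongrightarrow> 0) (finite_subsets_at_top UNIV)"
proof -
  have eq: "(norm ((coord_proj (- F)) v))\<^sup>2 = (norm v)\<^sup>2 - (\<Sum>i\<in>F. (cmod (ell2_nth v i))\<^sup>2)" if "finite F" for F
  proof -
    have "((\<lambda>i. (cmod (ell2_nth v i))\<^sup>2) has_sum (norm v)\<^sup>2 - (\<Sum>i\<in>F. (cmod (ell2_nth v i))\<^sup>2)) (UNIV - F)"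
      by (rule has_sum_Diff[OF has_sum_norm_ell2]) (use that in auto)
    then have "((\<lambda>i. (cmod (ell2_nth ((coord_proj (- F)) v) i))\<^sup>2) has_sum (norm v)\<^sup>2 - (\<Sum>i\<in>F. (cmod (ell2_nth v i))\<^sup>2)) UNIV"
      by (subst has_sum_cong_neutral[where T = "UNIV - F" and g = "\<lambda>i. (cmod (ell2_nth v i))\<^sup>2"]) auto
    then show ?thesis using has_sum_norm_ell2 has_sum_unique by blast
  qed
  have "((\<lambda>F. (norm v)\<^sup>2 - (\<Sum>i\<in>F. (cmod (ell2_nth v i))\<^sup>2)) \<longlongrightarrow> (norm v)\<^sup>2 - (norm v)\<^sup>2) (finite_subsets_at_top UNIV)"
    using has_sum_norm_ell2[of v] unfolding has_sum_def by (intro tendsto_intros)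
  then have "((\<lambda>F. sqrt ((norm v)\<^sup>2 - (\<Sum>i\<in>F. (cmod (ell2_nth v i))\<^sup>2))) \<longlongrightarrow> sqrt 0) (finite_subsets_at_top UNIV)"
    by (intro tendsto_intros) simp
  moreover have "\<forall>\<^sub>F F in finite_subsets_at_top UNIV. sqrt ((norm v)\<^sup>2 - (\<Sum>i\<in>F. (cmod (ell2_nth v i))\<^sup>2)) = norm ((coord_proj (- F)) v)"
    by (rule eventually_finite_subsets_at_top_weakI) (simp flip: eq)
  ultimately show ?thesis by (simp add: tendsto_cong)
qed

text \<open>Dominated convergence along the net of finite sets: a finite \<open>G0\<close> carries
  all but \<open>r/2\<close> of the sum of \<open>H\<close>, and on \<open>G0\<close> finitely many
  limits become small simultaneously.\<close>

lemma infsum_dominated_small: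
  fixes h :: "'f set \<Rightarrow> 'g \<Rightarrow> real"
  assumes fin: "(\<Sum>\<^sub>\<infinity>g\<in>G. ennreal (H g)) < \<infinity>"
    and h: "\<And>F g. g \<in> G \<Longrightarrow> 0 \<le> h F g" "\<And>F g. g \<in> G \<Longrightarrow> h F g \<le> H g"
    and lim: "\<And>g. g \<in> G \<Longrightarrow> ((\<lambda>F. h F g) \<longlongrightarrow> 0) (finite_subsets_at_top UNIV)" and r: "r > 0"
  shows "\<exists>F. finite F \<and> (\<Sum>\<^sub>\<infinity>g\<in>G. ennreal (h F g)) \<le> ennreal r"
proof -
  have H: "H summable_on G" using h by (intro ennreal_infsum_finite_summable fin) (metis order.trans)
  have hs: "h F summable_on G" for F by (rule summable_on_comparison_test[OF H]) (use h in auto)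
  obtain G0 where G0: "finite G0" "G0 \<subseteq> G" "dist (sum H G0) (infsum H G) \<le> r/2"
    using infsum_finite_approximation[OF H, of "r/2"] r by auto
  have "((\<lambda>F. \<Sum>g\<in>G0. h F g) \<longlongrightarrow> (\<Sum>g\<in>G0. 0)) (finite_subsets_at_top UNIV)"
    by (intro tendsto_sum lim) (use G0 in auto)
  then have "\<forall>\<^sub>F F in finite_subsets_at_top UNIV. (\<Sum>g\<in>G0. h F g) < r/2"
    using r by (intro order_tendstoD(2)) auto
  then obtain F where F: "finite F" "(\<Sum>g\<in>G0. h F g) < r/2"
    unfolding eventually_finite_subsets_at_top by blast
  have "infsum (h F) G = sum (h F) G0 + infsum (h F) (G - G0)"
    using infsum_Diff[OF hs[of F] summable_on_finite[OF G0(1), of "h F"] G0(2)] G0(1) by simp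
  also have "infsum (h F) (G - G0) \<le> infsum H (G - G0)"
    by (rule infsum_mono) (use h in \<open>auto intro: summable_on_subset_banach[OF hs] summable_on_subset_banach[OF H]\<close>)
  also have "infsum H (G - G0) = infsum H G - sum H G0"
    using infsum_Diff[OF H summable_on_finite[OF G0(1), of H] G0(2)] G0(1) by simp
  finally have "infsum (h F) G \<le> r" using F(2) G0(3) unfolding dist_real_def by linarith
  moreover have "(\<Sum>\<^sub>\<infinity>g\<in>G. ennreal (h F g)) = ennreal (infsum (h F) G)"
    by (rule ennreal_infsum_has_sum) (use hs h in auto)
  ultimately show ?thesis using F(1) ennreal_leI by metis
qed

text \<open>Smallness of tails has to be shown separately for exponents above and below 1, for which
  Jensen's inequality points in opposite directions.\<close>

lemma pos_trace_compression_small: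
  assumes c: "pos_op c" "compact_op c" and s: "s \<ge> 1" and fin: "trace_powr c s < \<infinity>" and r: "r > 0"
  shows "\<exists>F. finite F \<and> trace_powr (coord_proj (- F) o\<^sub>L c o\<^sub>L coord_proj (- F)) s \<le> ennreal r"
proof -
  have s0: "0 \<le> s" using s by simp
  obtain G l where eb: "eigenbasis c G l" using spectral_theorem[OF c] by blast
  define h where "h F g = l g powr s * (norm ((coord_proj (- F)) g))\<^sup>2" for F g
  have "\<exists>F. finite F \<and> (\<Sum>\<^sub>\<infinity>g\<in>G. ennreal (h F g)) \<le> ennreal r"
  proof (rule infsum_dominated_small[where H = "\<lambda>g. l g powr s"])
    show "(\<Sum>\<^sub>\<infinity>g\<in>G. ennreal (l g powr s)) < \<infinity>" using fin unfolding pos_trace_eigenbasis[OF eb c(1) s0] .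
    show "h F g \<le> l g powr s" if "g \<in> G" for F g
      unfolding h_def using norm_coord_proj_apply_le[of "- F" g] eigenbasis_norm[OF eb that]
      by (intro mult_left_le) (auto simp: power_le_one)
    show "((\<lambda>F. h F g) \<longlongrightarrow> 0) (finite_subsets_at_top UNIV)" for g
      using tendsto_mult[OF tendsto_const tendsto_power[OF coord_proj_tendsto_0, of g 2], of "l g powr s"]
      unfolding h_def by simp
  qed (use r in \<open>auto simp: h_def\<close>)
  moreover have "trace_powr (coord_proj (- F) o\<^sub>L c o\<^sub>L coord_proj (- F)) s \<le> (\<Sum>\<^sub>\<infinity>g\<in>G. ennreal (h F g))" for F
  proof -
    let ?q = "coord_proj (- F)" let ?a = "?q o\<^sub>L c o\<^sub>L ?q"
    have q: "cinner (?q u) v = cinner u (?q v)" for u v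
      using cinner_adj_right[of ?q u v] by simp
    have a: "pos_op ?a"
      using c(1) by (auto simp: pos_op_def q) (simp add: q[symmetric])
    have ac: "compact_op ?a" by (intro compact_op_compose_left compact_op_compose_right c)
    obtain E m where ebE: "eigenbasis ?a E m" using spectral_theorem[OF a ac] by blast
    have "trace_powr ?a s = (\<Sum>\<^sub>\<infinity>e\<in>E. ennreal (m e powr s))"
      by (rule pos_trace_eigenbasis[OF ebE a s0])
    also have "\<dots> \<le> (\<Sum>\<^sub>\<infinity>e\<in>E. ennreal (qform (op_powr c s) (?q e)))"
    proof (intro infsum_mono ennreal_summable ennreal_leI)
      fix e assume e: "e \<in> E"
      \<comment> \<open>The eigenvalue of the compression is a value of the form of \<open>c\<close>
        at a vector of norm at most 1, to which convexity applies.\<close>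
      have "m e = qform c (?q e)"
        using eigenbasis_form[OF ebE e] by (simp add: q)
      then show "m e powr s \<le> qform (op_powr c s) (?q e)"
        using jensen_form_ge[OF c s, of "?q e"] norm_coord_proj_apply_le[of "- F" e] eigenbasis_norm[OF ebE e] by simp
    qed
    also have "\<dots> = (\<Sum>\<^sub>\<infinity>g\<in>G. ennreal (l g powr s) * (\<Sum>\<^sub>\<infinity>e\<in>E. ennreal ((cmod (cinner (?q e) g))\<^sup>2)))"
      by (rule trace_form_swap[OF eb c(1) s0])
    also have "\<dots> = (\<Sum>\<^sub>\<infinity>g\<in>G. ennreal (h F g))"
    proof (rule infsum_cong)
      fix g
      have "(\<Sum>\<^sub>\<infinity>e\<in>E. ennreal ((cmod (cinner (?q e) g))\<^sup>2)) = ennreal ((norm (?q g))\<^sup>2)"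
        unfolding q by (rule ennreal_infsum_has_sum[OF onb_parseval[OF eigenbasis_onb[OF ebE]]]) simp
      then show "ennreal (l g powr s) * (\<Sum>\<^sub>\<infinity>e\<in>E. ennreal ((cmod (cinner (?q e) g))\<^sup>2)) = ennreal (h F g)"
        by (simp add: h_def ennreal_mult)
    qed
    finally show ?thesis .
  qed
  ultimately show ?thesis by (meson order.trans)
qed

text \<open>Here the upper bound comes from the diagonal in an eigenbasis of
  \<open>op_adj z o\<^sub>L z\<close>: a projection on the left leaves the argument \<open>g\<close>
  alone, and the entries \<open>(norm (q (z g)))\<^sup>2\<close> decrease below the eigenvalues
  \<open>(norm (z g))\<^sup>2\<close>, whose powers are summable.\<close>

lemma pos_trace_tail_small:
  assumes z: "complex_linear_op z" "compact_op (op_adj z o\<^sub>L z)" and s: "0 < s" "s \<le> 1"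
    and fin: "trace_powr (op_adj z o\<^sub>L z) s < \<infinity>" and r: "r > 0"
    and comp: "\<And>F. compact_op (op_adj (coord_proj (- F) o\<^sub>L z) o\<^sub>L (coord_proj (- F) o\<^sub>L z))"
  shows "\<exists>F. finite F \<and> trace_powr (op_adj (coord_proj (- F) o\<^sub>L z) o\<^sub>L (coord_proj (- F) o\<^sub>L z)) s \<le> ennreal r"
proof -
  have s0: "0 \<le> s" using s by simp
  have p: "pos_op (op_adj z o\<^sub>L z)" using z by simp
  obtain G l where eb: "eigenbasis (op_adj z o\<^sub>L z) G l" using spectral_theorem[OF p z(2)] by blast
  have l: "l g = (norm (z g))\<^sup>2" if "g \<in> G" for g
    using eigenbasis_form[OF eb that] unfolding cinner_adj_compose[OF z(1)] by simp
  define h where "h F g = ((norm ((coord_proj (- F)) (z g)))\<^sup>2) powr s" for F g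
  have "\<exists>F. finite F \<and> (\<Sum>\<^sub>\<infinity>g\<in>G. ennreal (h F g)) \<le> ennreal r"
  proof (rule infsum_dominated_small[where H = "\<lambda>g. l g powr s"])
    show "(\<Sum>\<^sub>\<infinity>g\<in>G. ennreal (l g powr s)) < \<infinity>" using fin unfolding pos_trace_eigenbasis[OF eb p s0] .
    show "h F g \<le> l g powr s" if "g \<in> G" for F g
      unfolding h_def l[OF that] using s by (intro powr_mono2 power_mono norm_coord_proj_apply_le) auto
    show "((\<lambda>F. h F g) \<longlongrightarrow> 0) (finite_subsets_at_top UNIV)" for g
    proof -
      have "((\<lambda>F. ((norm ((coord_proj (- F)) (z g)))\<^sup>2)) \<longlongrightarrow> 0\<^sup>2) (finite_subsets_at_top UNIV)"
        by (intro tendsto_power coord_proj_tendsto_0)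
      then have "((\<lambda>F. h F g) \<longlongrightarrow> 0 powr s) (finite_subsets_at_top UNIV)"
        unfolding h_def using s by (intro tendsto_powr') auto
      then show ?thesis by simp
    qed
  qed (use r in \<open>auto simp: h_def\<close>)
  moreover have "trace_powr (op_adj (coord_proj (- F) o\<^sub>L z) o\<^sub>L (coord_proj (- F) o\<^sub>L z)) s \<le> (\<Sum>\<^sub>\<infinity>g\<in>G. ennreal (h F g))" for F
  proof -
    have cl: "complex_linear_op (coord_proj (- F) o\<^sub>L z)" using z by simp
    show ?thesis
      using pos_trace_le_form_sum[OF pos_op_adj_compose[OF cl] comp s eigenbasis_onb[OF eb]]
      unfolding cinner_adj_compose[OF cl] by (simp add: h_def)
  qed
  ultimately show ?thesis by (meson order.trans)
qed

section \<open>Schatten classes\<close>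

abbreviation schatten_trace :: "real \<Rightarrow> 'i op \<Rightarrow> ennreal" where
  "schatten_trace p x \<equiv> trace_powr (op_adj x o\<^sub>L x) (p/2)"

lemma schattenD:
  assumes "x \<in> schatten p"
  shows schatten_complex_linear: "complex_linear_op x" and schatten_compact: "compact_op x"
    and schatten_trace_finite: "schatten_trace p x < \<infinity>"
  using assms by (auto simp: schatten_def)

lemma schatten_norm_nonneg [simp]: "0 \<le> schatten_norm p x"
  by (simp add: schatten_norm_def)

lemma schatten_norm_leI:
  assumes "0 < p" "0 \<le> r" "schatten_trace p x \<le> ennreal (r powr p)"
  shows "schatten_norm p x \<le> r"
proof -
  have "enn2real (schatten_trace p x) \<le> r powr p"
    using enn2real_mono[OF assms(3)] by simp
  then have "schatten_norm p x \<le> (r powr p) powr (1/p)"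
    unfolding schatten_norm_def using assms(1) by (intro powr_mono2) auto
  then show ?thesis using assms by (simp add: powr_powr)
qed

lemma schatten_trace_eq:
  assumes "0 < p" "x \<in> schatten p"
  shows "schatten_trace p x = ennreal (schatten_norm p x powr p)"
  using assms schatten_trace_finite[OF assms(2)] by (simp add: schatten_norm_def powr_powr)

lemma schatten_comparison:
  assumes p: "0 < p" and x: "x \<in> schatten p" and y: "complex_linear_op y" "compact_op y" and K: "0 \<le> K"
    and le: "schatten_trace p y \<le> ennreal (K powr p) * schatten_trace p x"
  shows "y \<in> schatten p" "schatten_norm p y \<le> K * schatten_norm p x"
proof -
  have *: "schatten_trace p y \<le> ennreal ((K * schatten_norm p x) powr p)"
    using le K unfolding schatten_trace_eq[OF p x] by (simp add: ennreal_mult powr_mult)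
  then have "schatten_trace p y < \<infinity>"
    by (metis ennreal_less_top infinity_ennreal_def order.strict_trans1)
  then show "y \<in> schatten p" using y by (simp add: schatten_def)
  show "schatten_norm p y \<le> K * schatten_norm p x"
    by (rule schatten_norm_leI[OF p _ *]) (use K in simp)
qed

lemma norm_sq_powr: "0 < p \<Longrightarrow> 0 \<le> r \<Longrightarrow> (r\<^sup>2) powr (p/2) = r powr p" for r p :: real
  by (cases "r = 0") (auto simp: powr_powr simp flip: powr_numeral)

text \<open>Pointwise domination of norms says that \<open>op_adj y o\<^sub>L y\<close> lies below
  \<open>K\<^sup>2\<close> times \<open>op_adj x o\<^sub>L x\<close> as a form, and traces of powers
  are monotone. Both ideal properties come from this.\<close>

lemma pos_trace_adj_compose_bound:
  assumes p: "0 < p" and x: "complex_linear_op x" "compact_op (op_adj x o\<^sub>L x)"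
    and y: "complex_linear_op y" "compact_op (op_adj y o\<^sub>L y)" and K: "0 \<le> K"
    and le: "\<And>v. norm (y v) \<le> K * norm (x v)"
  shows "schatten_trace p y \<le> ennreal (K powr p) * schatten_trace p x"
proof -
  note a = pos_op_adj_compose[OF x(1)] x(2)
  have s: "0 < p/2" "0 \<le> K\<^sup>2" using p by simp_all
  note sc = pos_trace_scaleR[OF a s]
  have "schatten_trace p y \<le> trace_powr (K\<^sup>2 *\<^sub>R (op_adj x o\<^sub>L x)) (p/2)"
  proof (rule pos_trace_powr_mono[OF pos_op_adj_compose[OF y(1)] y(2) sc(1,2) s(1)])
    fix v
    have "qform (K\<^sup>2 *\<^sub>R (op_adj x o\<^sub>L x)) v = K\<^sup>2 * (norm (x v))\<^sup>2"
      using cinner_adj_compose[OF x(1), of v] by (simp add: blinfun.scaleR_left del: of_real_power)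
    moreover have "(norm (y v))\<^sup>2 \<le> (K * norm (x v))\<^sup>2"
      by (intro power_mono le) simp
    ultimately show "qform (op_adj y o\<^sub>L y) v \<le> qform (K\<^sup>2 *\<^sub>R (op_adj x o\<^sub>L x)) v"
      unfolding cinner_adj_compose[OF y(1)] by (simp add: power_mult_distrib)
  qed
  then show ?thesis unfolding sc(3) norm_sq_powr[OF p K] .
qed

lemma schatten_mult_left:
  assumes p: "0 < p" and x: "x \<in> schatten p" and b: "complex_linear_op b"
  shows "b o\<^sub>L x \<in> schatten p" "schatten_norm p (b o\<^sub>L x) \<le> norm b * schatten_norm p x"
proof -
  note xs = schatten_complex_linear[OF x] schatten_compact[OF x]
  have "schatten_trace p (b o\<^sub>L x)
    \<le> ennreal (norm b powr p) * schatten_trace p x"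
    by (rule pos_trace_adj_compose_bound[OF p])
       (use xs b in \<open>auto intro!: compact_op_compose_left norm_blinfun\<close>)
  from schatten_comparison[OF p x _ _ _ this]
  show "b o\<^sub>L x \<in> schatten p" "schatten_norm p (b o\<^sub>L x) \<le> norm b * schatten_norm p x"
    using xs b compact_op_compose_left by auto
qed

lemma schatten_trace_commute:
  assumes "complex_linear_op x" "compact_op x" "0 < p"
  shows "schatten_trace p x = trace_powr (x o\<^sub>L op_adj x) (p/2)"
  by (rule pos_trace_adj_commute) (use assms in \<open>auto intro: compact_op_compose_left compact_op_compose_right\<close>)

text \<open>The traces of \<open>(y\<^sup>* y)\<^sup>s\<close> and \<open>(y y\<^sup>*)\<^sup>s\<close> agree, which turns right into left multiplication
  without appealing to the compactness of \<open>y\<^sup>*\<close>.\<close>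

lemma schatten_mult_right:
  assumes p: "0 < p" and x: "x \<in> schatten p" and b: "complex_linear_op b"
  shows "x o\<^sub>L b \<in> schatten p" "schatten_norm p (x o\<^sub>L b) \<le> norm b * schatten_norm p x"
proof -
  note xs = schatten_complex_linear[OF x] schatten_compact[OF x]
  have cl: "complex_linear_op (x o\<^sub>L b)" using xs b by simp
  have comp: "compact_op (x o\<^sub>L b)" by (intro compact_op_compose_right xs)
  have "trace_powr (op_adj (op_adj (x o\<^sub>L b)) o\<^sub>L op_adj (x o\<^sub>L b)) (p/2)
    \<le> ennreal (norm b powr p) * trace_powr (op_adj (op_adj x) o\<^sub>L op_adj x) (p/2)"
  proof (rule pos_trace_adj_compose_bound[OF p])
    show "compact_op (op_adj (op_adj x) o\<^sub>L op_adj x)" "compact_op (op_adj (op_adj (x o\<^sub>L b)) o\<^sub>L op_adj (x o\<^sub>L b))"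
      using xs cl comp by (simp_all add: compact_op_compose_right)
    show "norm ((op_adj (x o\<^sub>L b)) v) \<le> norm b * norm ((op_adj x) v)" for v
      using norm_blinfun[of "op_adj b"] xs b by (simp add: op_adj_compose)
  qed (use xs b cl in auto)
  then have "schatten_trace p (x o\<^sub>L b)
    \<le> ennreal (norm b powr p) * schatten_trace p x"
    using xs cl comp p by (simp add: schatten_trace_commute)
  from schatten_comparison[OF p x cl comp norm_ge_zero this]
  show "x o\<^sub>L b \<in> schatten p" "schatten_norm p (x o\<^sub>L b) \<le> norm b * schatten_norm p x" .
qed

lemma norm_le_schatten_norm:
  assumes p: "0 < p" and x: "x \<in> schatten p"
  shows "norm x \<le> schatten_norm p x"
proof (rule norm_blinfun_bound)
  note xs = schatten_complex_linear[OF x] schatten_compact[OF x]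
  have unit: "norm (x v) \<le> schatten_norm p x" if "norm v \<le> 1" for v
  proof -
    have "ennreal (((norm (x v))\<^sup>2) powr (p/2)) \<le> ennreal (schatten_norm p x powr p)"
      using form_powr_le_pos_trace[OF pos_op_adj_compose[OF xs(1)] compact_op_compose_left[OF xs(2)], of "p/2" v] p that
      unfolding cinner_adj_compose[OF xs(1)] schatten_trace_eq[OF p x] by simp
    then have "norm (x v) powr p \<le> schatten_norm p x powr p"
      using p by (simp add: norm_sq_powr)
    then show ?thesis using p powr_less_mono2[of p "schatten_norm p x" "norm (x v)"] by force
  qed
  fix v
  show "norm (x v) \<le> schatten_norm p x * norm v"
  proof (cases "v = 0")
    case False
    then have "norm (x ((1 / norm v) *\<^sub>R v)) \<le> schatten_norm p x" by (intro unit) simp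
    then show ?thesis using False by (simp add: blinfun.scaleR_right field_simps)
  qed simp
qed simp

text \<open>Coordinates of vectors in the unit ball lie in the closed unit disc, and
  \<open>x\<close> depends continuously on the coordinates in \<open>F\<close>. The image of the
  ball is thus contained in a continuous image of a product of discs, which is compact by
  Tychonoff's theorem.\<close>

lemma compact_op_finite_columns:
  fixes x :: "'i op"
  assumes x: "complex_linear_op x" and F: "finite F" "\<And>i. i \<notin> F \<Longrightarrow> x (ket i) = 0"
  shows "compact_op x"
proof (rule compact_opI)
  define f where "f c = (\<Sum>i\<in>F. cscale (c i) (x (ket i)))" for c :: "'i \<Rightarrow> complex"
  define P where "P = PiE UNIV (\<lambda>_ :: 'i. cball (0 :: complex) 1)"
  have "compactin (product_topology (\<lambda>_. euclidean) UNIV) P" unfolding P_def by (simp add: compactin_PiE)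
  then have "compact P" by (simp add: euclidean_product_topology)
  moreover have "continuous_on P f"
    unfolding f_def
  proof (rule continuous_on_sum)
    fix i
    have "bounded_linear (\<lambda>c. cscale c (x (ket i)))"
      by (rule bounded_linear_intro[where K = "norm (x (ket i))"])
         (simp_all add: cscale_add_left scaleR_conv_of_real cscale_of_real flip: cscale_cscale)
    then show "continuous_on P (\<lambda>c. cscale (c i) (x (ket i)))"
      by (rule bounded_linear.continuous_on) (rule continuous_on_product_then_coordinatewise[OF continuous_on_id])
  qed
  ultimately show "compact (f ` P)" by (intro compact_continuous_image)
  show "x ` cball 0 1 \<subseteq> f ` P"
  proof (rule image_subsetI, rule image_eqI)
    fix v :: "'i ell2" assume v: "v \<in> cball 0 1"
    have "((\<lambda>i. x (cscale (cinner (ket i) v) (ket i))) has_sum x v) UNIV"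
      by (rule has_sum_bounded_linear[OF blinfun.bounded_linear_right onb_expansion[OF onb_ket]])
    then have "((\<lambda>i. cscale (ell2_nth v i) (x (ket i))) has_sum x v) F"
      by (subst has_sum_cong_neutral[where T = UNIV and g = "\<lambda>i. cscale (ell2_nth v i) (x (ket i))"])
         (use F in \<open>auto simp: complex_linear_opD[OF x]\<close>)
    then show "x v = f (ell2_nth v)" unfolding f_def using F(1) has_sum_finite has_sum_unique by blast
    show "ell2_nth v \<in> P" unfolding P_def using v order.trans[OF cmod_ell2_nth_le] by auto
  qed
qed

lemma pos_trace_finite_columns:
  assumes a: "pos_op a" "compact_op a" and s: "0 < s" and F: "finite F" "\<And>i. i \<notin> F \<Longrightarrow> a (ket i) = 0"
  shows "trace_powr a s = ennreal (\<Sum>i\<in>F. qform (op_powr a s) (ket i))"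
proof -
  have z: "(op_powr a s) (ket i) = 0" if "i \<notin> F" for i
    using op_powr_eigenvector[OF a, of s "ket i" 0] F(2)[OF that] s by simp
  have "trace_powr a s = (\<Sum>\<^sub>\<infinity>i\<in>F. ennreal (qform (op_powr a s) (ket i)))"
    unfolding pos_trace_def by (rule infsum_cong_neutral) (use z in auto)
  also have "\<dots> = ennreal (\<Sum>i\<in>F. qform (op_powr a s) (ket i))"
    using F(1) pos_op_ge_0[OF pos_op_powr[OF a]] s by (simp add: sum_ennreal del: cinner_ket_left)
  finally show ?thesis .
qed

lemma schatten_finite_columns:
  assumes p: "0 < p" and x: "complex_linear_op x" and F: "finite F" "\<And>i. i \<notin> F \<Longrightarrow> x (ket i) = 0"
  shows "x \<in> schatten p"
proof -
  have c: "compact_op x" by (rule compact_op_finite_columns[OF x F])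
  have "schatten_trace p x < \<infinity>"
    by (subst pos_trace_finite_columns[OF pos_op_adj_compose[OF x] compact_op_compose_left[OF c] _ F(1)])
       (use F p in auto)
  then show ?thesis using x c by (simp add: schatten_def)
qed

section \<open>Approximation of Schatten operators by truncations\<close>

lemma schatten_norm_less_of_trace:
  assumes "0 < p" "0 < r" and "schatten_trace p x \<le> ennreal ((r/2) powr p)"
  shows "schatten_norm p x < r"
  using schatten_norm_leI[OF assms(1) _ assms(3)] assms(2) by simp

text \<open>With \<open>q\<close> the projection, the square of \<open>q o\<^sub>L x\<close> taken
  on the other side is the compression of \<open>x o\<^sub>L op_adj x\<close> by \<open>q\<close>,
  which suits convex powers; for concave powers the tail estimate applies to \<open>x\<close>
  itself.\<close>

lemma schatten_coord_proj_left_small: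
  assumes p: "0 < p" and x: "x \<in> schatten p" and r: "0 < r"
  shows "\<exists>F. finite F \<and> schatten_norm p (coord_proj (- F) o\<^sub>L x) < r"
proof -
  note xs = schatten_complex_linear[OF x] schatten_compact[OF x]
  have r': "(r/2) powr p > 0" using r by simp
  have "\<exists>F. finite F \<and> schatten_trace p (coord_proj (- F) o\<^sub>L x) \<le> ennreal ((r/2) powr p)"
  proof (cases "p/2 \<ge> 1")
    case True
    have "pos_op (x o\<^sub>L op_adj x)" using pos_op_adj_compose[of "op_adj x"] xs by simp
    moreover have "compact_op (x o\<^sub>L op_adj x)" by (intro compact_op_compose_right xs)
    moreover have "trace_powr (x o\<^sub>L op_adj x) (p/2) < \<infinity>"
      using schatten_trace_finite[OF x] by (simp add: schatten_trace_commute xs p)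
    ultimately obtain F where F: "finite F" "trace_powr (coord_proj (- F) o\<^sub>L (x o\<^sub>L op_adj x) o\<^sub>L coord_proj (- F)) (p/2) \<le> ennreal ((r/2) powr p)"
      using pos_trace_compression_small[OF _ _ True _ r'] by blast
    have "coord_proj (- F) o\<^sub>L (x o\<^sub>L op_adj x) o\<^sub>L coord_proj (- F) = (coord_proj (- F) o\<^sub>L x) o\<^sub>L op_adj (coord_proj (- F) o\<^sub>L x)"
      using xs by (intro blinfun_eqI) (simp add: op_adj_compose)
    then show ?thesis
      using F schatten_trace_commute[OF _ compact_op_compose_left p, of "coord_proj (- F)" x] xs by auto
  next
    case False
    show ?thesis
      by (rule pos_trace_tail_small)
         (use False p r' xs schatten_trace_finite[OF x] in \<open>auto intro!: compact_op_compose_left\<close>)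
  qed
  then show ?thesis using schatten_norm_less_of_trace[OF p r] by blast
qed

text \<open>The roles are exchanged: the compression is now that of
  \<open>op_adj x o\<^sub>L x\<close>, and for concave powers the tail estimate is applied to the
  adjoint and carried back by commuting the factors under the trace.\<close>

lemma schatten_coord_proj_right_small:
  assumes p: "0 < p" and x: "x \<in> schatten p" and r: "0 < r"
  shows "\<exists>F. finite F \<and> schatten_norm p (x o\<^sub>L coord_proj (- F)) < r"
proof -
  note xs = schatten_complex_linear[OF x] schatten_compact[OF x]
  have r': "(r/2) powr p > 0" using r by simp
  have "\<exists>F. finite F \<and> schatten_trace p (x o\<^sub>L coord_proj (- F)) \<le> ennreal ((r/2) powr p)"
  proof (cases "p/2 \<ge> 1")
    case True
    obtain F where F: "finite F" "trace_powr (coord_proj (- F) o\<^sub>L (op_adj x o\<^sub>L x) o\<^sub>L coord_proj (- F)) (p/2) \<le> ennreal ((r/2) powr p)"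
      using pos_trace_compression_small[OF pos_op_adj_compose[OF xs(1)] compact_op_compose_left[OF xs(2)] True schatten_trace_finite[OF x] r'] by blast
    have "coord_proj (- F) o\<^sub>L (op_adj x o\<^sub>L x) o\<^sub>L coord_proj (- F) = op_adj (x o\<^sub>L coord_proj (- F)) o\<^sub>L (x o\<^sub>L coord_proj (- F))"
      using xs by (intro blinfun_eqI) (simp add: op_adj_compose)
    then show ?thesis using F by auto
  next
    case False
    have eq: "op_adj (coord_proj (- F) o\<^sub>L op_adj x) o\<^sub>L (coord_proj (- F) o\<^sub>L op_adj x) = (x o\<^sub>L coord_proj (- F)) o\<^sub>L op_adj (x o\<^sub>L coord_proj (- F))" for F
      using xs by (simp add: op_adj_compose)
    have fin: "trace_powr (x o\<^sub>L op_adj x) (p/2) < \<infinity>"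
      using schatten_trace_finite[OF x] by (simp add: schatten_trace_commute xs p)
    have "\<exists>F. finite F \<and> schatten_trace p (coord_proj (- F) o\<^sub>L op_adj x) \<le> ennreal ((r/2) powr p)"
      by (rule pos_trace_tail_small)
         (use False p r' xs fin in \<open>auto simp: eq intro!: compact_op_compose_right\<close>)
    then show ?thesis
      unfolding eq using schatten_trace_commute[OF _ compact_op_compose_right p, of x] xs by auto
  qed
  then show ?thesis using schatten_norm_less_of_trace[OF p r] by blast
qed

section \<open>Rank-one operators\<close>

definition rank_one :: "'i ell2 \<Rightarrow> 'i ell2 \<Rightarrow> 'i op" where
  "rank_one u v = Blinfun (\<lambda>w. cscale (cinner v w) u)"

lemma rank_one_apply [simp]: "(rank_one u v) w = cscale (cinner v w) u"
proof -
  obtain x :: "'a op" where x: "\<And>w. x w = cscale (cinner v w) u"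
  proof (rule complex_op_of_fun[of "\<lambda>w. cscale (cinner v w) u" "norm v * norm u"])
    show "norm (cscale (cinner v w) u) \<le> norm v * norm u * norm w" for w
      using mult_right_mono[OF cmod_cinner_le[of v w] norm_ge_zero[of u]] by (simp add: mult_ac)
    show "cscale (cinner v (w + w')) u = cscale (cinner v w) u + cscale (cinner v w') u" for w w'
      by (simp add: cinner_add_right cscale_add_left)
    show "cscale (cinner v (cscale c w)) u = cscale c (cscale (cinner v w) u)" for c w by simp
  qed blast
  then have "(\<lambda>w. cscale (cinner v w) u) = blinfun_apply x" by auto
  then show ?thesis unfolding rank_one_def by (simp add: blinfun_apply_inverse x)
qed

lemma complex_linear_rank_one [simp]: "complex_linear_op (rank_one u v)"
  by (simp add: complex_linear_op_def)

lemma op_adj_rank_one [simp]: "op_adj (rank_one u v) = rank_one v u"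
  by (rule op_adj_eqI) (simp add: cinner_commute[of _ v])

lemma schatten_rank_one_ket: "0 < p \<Longrightarrow> rank_one u (ket i) \<in> schatten p"
  by (rule schatten_finite_columns[where F = "{i}"]) (auto simp: ell2_nth_ket)

lemma coord_proj_corner:
  assumes x: "complex_linear_op x" and F: "finite F"
  shows "coord_proj F o\<^sub>L x o\<^sub>L coord_proj F
    = (\<Sum>(i, j)\<in>F \<times> F. op_cscale (cinner (ket i) (x (ket j))) (rank_one (ket i) (ket j)))"
proof (rule op_eqI_onb[OF onb_ket])
  fix k
  have "(coord_proj F) (ket k) = (if k \<in> F then ket k else 0)"
    by (rule ell2_eqI) (auto simp: ell2_nth_ket)
  then have L: "ell2_nth ((coord_proj F o\<^sub>L x o\<^sub>L coord_proj F) (ket k)) m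
      = (if k \<in> F \<and> m \<in> F then cinner (ket m) (x (ket k)) else 0)" for m
    by simp
  have "ell2_nth ((\<Sum>(i, j)\<in>F \<times> F. op_cscale (cinner (ket i) (x (ket j))) (rank_one (ket i) (ket j))) (ket k)) m
      = (\<Sum>(i, j)\<in>F \<times> F. if j = k then if i = m then cinner (ket i) (x (ket j)) else 0 else 0)" for m
    unfolding blinfun.sum_left ell2_nth_sum by (rule sum.cong) (auto simp: blinfun.sum_left ell2_nth_sum ell2_nth_ket)
  also have "\<dots> m = (\<Sum>i\<in>F. \<Sum>j\<in>F. if j = k then if i = m then cinner (ket i) (x (ket j)) else 0 else 0)" for m
    by (simp add: sum.cartesian_product)
  also have "\<dots> m = (if k \<in> F \<and> m \<in> F then cinner (ket m) (x (ket k)) else 0)" for m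
    using F by (cases "k \<in> F") (simp_all add: sum.delta)
  finally show "(coord_proj F o\<^sub>L x o\<^sub>L coord_proj F) (ket k)
    = (\<Sum>(i, j)\<in>F \<times> F. op_cscale (cinner (ket i) (x (ket j))) (rank_one (ket i) (ket j))) (ket k)"
    by (intro ell2_eqI) (simp only: L)
qed (use x in \<open>auto intro!: complex_linear_sum\<close>)

section \<open>Tensor products of operators\<close>

lemma ell2_eqI_pair: "(\<And>i j. ell2_nth u (i, j) = ell2_nth v (i, j)) \<Longrightarrow> u = v"
  by (rule ell2_eqI) (metis surj_pair)

text \<open>Currying: a vector over pairs is a square-summable family of vectors over the second
  index, and summing in two stages identifies the norms. The reverse direction follows.\<close>

lemma slice_exists:
  fixes f :: "('i \<times> 'j) ell2"
  shows "\<exists>h :: 'i \<Rightarrow> 'j ell2. (\<forall>i j. ell2_nth (h i) j = ell2_nth f (i, j)) \<and> ((\<lambda>i. (norm (h i))\<^sup>2) has_sum (norm f)\<^sup>2) UNIV"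
proof -
  have f: "(\<lambda>(i, j). (cmod (ell2_nth f (i, j)))\<^sup>2) summable_on UNIV \<times> UNIV"
    using has_sum_imp_summable[OF has_sum_norm_ell2[of f]] by (simp add: case_prod_unfold)
  have "(\<lambda>j. (cmod (ell2_nth f (i, j)))\<^sup>2) summable_on UNIV" for i
    by (rule summable_on_SigmaD1[OF f UNIV_I])
  then have ex: "\<exists>u. \<forall>j. ell2_nth u j = ell2_nth f (i, j)" for i
    using Abs_ell2_inverse[of "\<lambda>j. ell2_nth f (i, j)"] by (metis mem_Collect_eq)
  obtain h where h: "\<And>i j. ell2_nth (h i) j = ell2_nth f (i, j)" using ex by metis
  have "((\<lambda>i. (norm (h i))\<^sup>2) has_sum (norm f)\<^sup>2) UNIV"
  proof (rule has_sum_SigmaD)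
    show "((\<lambda>x. (cmod (ell2_nth f x))\<^sup>2) has_sum (norm f)\<^sup>2) (UNIV \<times> UNIV)"
      using has_sum_norm_ell2[of f] by simp
    show "((\<lambda>j. (cmod (ell2_nth f (i, j)))\<^sup>2) has_sum (norm (h i))\<^sup>2) UNIV" for i
      using has_sum_norm_ell2[of "h i"] by (simp add: h)
  qed
  then show ?thesis using h by (intro exI[of _ h]) simp
qed

lemma unslice_exists:
  fixes h :: "'i \<Rightarrow> 'j ell2"
  assumes "((\<lambda>i. (norm (h i))\<^sup>2) has_sum S) UNIV"
  shows "\<exists>f. (\<forall>i j. ell2_nth f (i, j) = ell2_nth (h i) j) \<and> (norm f)\<^sup>2 = S"
proof -
  let ?f = "\<lambda>x. ell2_nth (h (fst x)) (snd x)"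
  have s: "((\<lambda>j. (cmod (?f (i, j)))\<^sup>2) has_sum (norm (h i))\<^sup>2) UNIV" for i
    using has_sum_norm_ell2[of "h i"] by simp
  have "(\<lambda>x. (cmod (?f x))\<^sup>2) summable_on UNIV \<times> UNIV"
    by (rule summable_on_SigmaI[OF s has_sum_imp_summable[OF assms]]) simp
  then have "?f \<in> {f. (\<lambda>i. (cmod (f i))\<^sup>2) summable_on UNIV}" by simp
  from Abs_ell2_inverse[OF this] obtain f where f: "ell2_nth f = ?f" by metis
  have "((\<lambda>i. (norm (h i))\<^sup>2) has_sum (norm f)\<^sup>2) UNIV"
    using has_sum_norm_ell2[of f] s unfolding f
    by (intro has_sum_SigmaD[where B = "\<lambda>_. UNIV" and f = "\<lambda>x. (cmod (?f x))\<^sup>2"]) auto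
  then show ?thesis using f assms has_sum_unique by (intro exI[of _ f]) auto
qed

text \<open>The operator \<open>b\<close> acts on each slice separately. Speaking about any family
  \<open>h\<close> of slices lets a later proof name the slices of a simple tensor, which are
  multiples of one vector, without computing a choice.\<close>

lemma id_tensor_exists:
  fixes b :: "'j op"
  assumes b: "complex_linear_op b"
  shows "\<exists>z :: ('i \<times> 'j) op. \<forall>f h. (\<forall>i j. ell2_nth (h i) j = ell2_nth f (i, j)) \<longrightarrow>
       (\<forall>i j. ell2_nth (z f) (i, j) = ell2_nth (b (h i)) j)"
proof -
  define sl where "sl f i = (SOME u. \<forall>j. ell2_nth u j = ell2_nth f (i, j))" for f :: "('i \<times> 'j) ell2" and i
  have sl: "ell2_nth (sl f i) j = ell2_nth f (i, j)" for f i j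
  proof -
    obtain h :: "'i \<Rightarrow> 'j ell2" where "\<forall>i j. ell2_nth (h i) j = ell2_nth f (i, j)" using slice_exists[of f] by blast
    then have "\<forall>j. ell2_nth (h i) j = ell2_nth f (i, j)" by simp
    then have "\<forall>j. ell2_nth (sl f i) j = ell2_nth f (i, j)" unfolding sl_def by (rule someI)
    then show ?thesis by blast
  qed
  have sl_eq: "sl f i = u" if "\<And>j. ell2_nth u j = ell2_nth f (i, j)" for f i u
    by (rule ell2_eqI) (simp add: sl that)
  have sl_norm: "((\<lambda>i. (norm (sl f i))\<^sup>2) has_sum (norm f)\<^sup>2) UNIV" for f
  proof -
    obtain h :: "'i \<Rightarrow> 'j ell2" where h: "\<forall>i j. ell2_nth (h i) j = ell2_nth f (i, j)"
      "((\<lambda>i. (norm (h i))\<^sup>2) has_sum (norm f)\<^sup>2) UNIV" using slice_exists[of f] by blast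
    have "sl f = h" by (intro ext sl_eq) (simp add: h)
    then show ?thesis using h by simp
  qed
  have "\<exists>g. (\<forall>i j. ell2_nth g (i, j) = ell2_nth (b (sl f i)) j) \<and> norm g \<le> norm b * norm f" for f
  proof -
    have s: "((\<lambda>i. (norm b)\<^sup>2 * (norm (sl f i))\<^sup>2) has_sum (norm b)\<^sup>2 * (norm f)\<^sup>2) UNIV"
      by (intro has_sum_cmult_right sl_norm)
    have le: "(norm (b (sl f i)))\<^sup>2 \<le> (norm b)\<^sup>2 * (norm (sl f i))\<^sup>2" for i
      unfolding power_mult_distrib[symmetric] by (intro power_mono norm_blinfun) simp
    have "(\<lambda>i. (norm (b (sl f i)))\<^sup>2) summable_on UNIV"
      by (rule summable_on_comparison_test[OF has_sum_imp_summable[OF s] le]) simp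
    then obtain S where S: "((\<lambda>i. (norm (b (sl f i)))\<^sup>2) has_sum S) UNIV"
      using has_sum_infsum by blast
    obtain g where g: "\<forall>i j. ell2_nth g (i, j) = ell2_nth (b (sl f i)) j" "(norm g)\<^sup>2 = S"
      using unslice_exists[OF S] by blast
    have "(norm g)\<^sup>2 \<le> (norm b * norm f)\<^sup>2"
      using has_sum_mono[OF S s le] g(2) by (simp add: power_mult_distrib)
    then have "norm g \<le> norm b * norm f" by (simp add: power2_le_iff_abs_le)
    then show ?thesis using g by blast
  qed
  then obtain T where T: "\<And>f i j. ell2_nth (T f) (i, j) = ell2_nth (b (sl f i)) j"
    "\<And>f. norm (T f) \<le> norm b * norm f" by metis
  obtain z :: "('i \<times> 'j) op" where "\<And>f. z f = T f"
  proof (rule complex_op_of_fun[of T "norm b"])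
    fix u v :: "('i \<times> 'j) ell2" and c
    have "sl (u + v) i = sl u i + sl v i" for i by (rule sl_eq) (simp add: sl)
    then show "T (u + v) = T u + T v" by (intro ell2_eqI_pair) (simp add: T blinfun.add_right)
    have "sl (cscale c u) i = cscale c (sl u i)" for i by (rule sl_eq) (simp add: sl)
    then show "T (cscale c u) = cscale c (T u)" by (intro ell2_eqI_pair) (simp add: T complex_linear_opD[OF b])
  qed (use T in auto)
  then have z: "ell2_nth (z f) (i, j) = ell2_nth (b (sl f i)) j" for f i j
    by (simp add: T(1))
  show ?thesis
  proof (intro exI[of _ z] allI impI)
    fix f :: "('i \<times> 'j) ell2" and h i j assume "\<forall>i j. ell2_nth (h i) j = ell2_nth f (i, j)"
    then have "sl f i = h i" by (intro sl_eq) blast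
    then show "ell2_nth (z f) (i, j) = ell2_nth (b (h i)) j" by (simp add: z)
  qed
qed

text \<open>Conjugation by this flip turns an operator acting on the second factor into one acting
  on the first.\<close>

lemma swap_exists:
  "\<exists>S :: ('i \<times> 'j) ell2 \<Rightarrow>\<^sub>L ('j \<times> 'i) ell2. \<forall>f i j. ell2_nth (S f) (j, i) = ell2_nth f (i, j)"
proof -
  have bij: "bij_betw prod.swap (UNIV :: ('j \<times> 'i) set) (UNIV :: ('i \<times> 'j) set)"
    by (rule bij_betwI[where g = prod.swap]) auto
  have "\<exists>g. (\<forall>x. ell2_nth g x = ell2_nth f (prod.swap x)) \<and> norm g = norm f" for f :: "('i \<times> 'j) ell2"
  proof -
    have s: "((\<lambda>x. (cmod (ell2_nth f (prod.swap x)))\<^sup>2) has_sum (norm f)\<^sup>2) (UNIV :: ('j \<times> 'i) set)"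
      using has_sum_norm_ell2[of f]
      by (subst has_sum_reindex_bij_betw[OF bij, of "\<lambda>x. (cmod (ell2_nth f x))\<^sup>2"])
    have "(\<lambda>x. ell2_nth f (prod.swap x)) \<in> {f. (\<lambda>i. (cmod (f i))\<^sup>2) summable_on UNIV}"
      using has_sum_imp_summable[OF s] by simp
    from Abs_ell2_inverse[OF this] obtain g where g: "ell2_nth g = (\<lambda>x. ell2_nth f (prod.swap x))" by metis
    have "((\<lambda>x. (cmod (ell2_nth f (prod.swap x)))\<^sup>2) has_sum (norm g)\<^sup>2) UNIV"
      using has_sum_norm_ell2[of g] unfolding g .
    then have "(norm g)\<^sup>2 = (norm f)\<^sup>2" using s has_sum_unique by blast
    then have "norm g = norm f" by (simp add: power2_eq_iff_nonneg)
    then show ?thesis using g by (intro exI[of _ g]) simp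
  qed
  then obtain T :: "('i \<times> 'j) ell2 \<Rightarrow> ('j \<times> 'i) ell2"
    where T: "\<And>f x. ell2_nth (T f) x = ell2_nth f (prod.swap x)" "\<And>f. norm (T f) = norm f" by metis
  obtain S :: "('i \<times> 'j) ell2 \<Rightarrow>\<^sub>L ('j \<times> 'i) ell2" where "\<And>f. S f = T f"
  proof (rule complex_op_of_fun[of T 1])
    show "T (u + v) = T u + T v" "T (cscale c u) = cscale c (T u)" "norm (T u) \<le> 1 * norm u" for u v c
      by (auto intro!: ell2_eqI simp: T)
  qed blast
  then show ?thesis by (intro exI[of _ S]) (simp add: T)
qed

lemma ell2_tensor_nth [simp]: "ell2_nth (ell2_tensor u v) (i, j) = ell2_nth u i * ell2_nth v j"
  by (simp add: ell2_tensor.rep_eq)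

lemma op_tensor_exists:
  fixes a :: "'i op" and b :: "'j op"
  assumes a: "complex_linear_op a" and b: "complex_linear_op b"
  shows "\<exists>z :: ('i \<times> 'j) op. \<forall>u v. z (ell2_tensor u v) = ell2_tensor (a u) (b v)"
proof -
  obtain zb :: "('i \<times> 'j) op" where zb: "\<forall>f h. (\<forall>i j. ell2_nth (h i) j = ell2_nth f (i, j)) \<longrightarrow>
       (\<forall>i j. ell2_nth (zb f) (i, j) = ell2_nth (b (h i)) j)"
    using id_tensor_exists[OF b] by (rule exE)
  obtain za :: "('j \<times> 'i) op" where za: "\<forall>f h. (\<forall>i j. ell2_nth (h i) j = ell2_nth f (i, j)) \<longrightarrow>
       (\<forall>i j. ell2_nth (za f) (i, j) = ell2_nth (a (h i)) j)"
    using id_tensor_exists[OF a] by (rule exE)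
  obtain S :: "('i \<times> 'j) ell2 \<Rightarrow>\<^sub>L ('j \<times> 'i) ell2" where S: "\<forall>f i j. ell2_nth (S f) (j, i) = ell2_nth f (i, j)"
    using swap_exists by (rule exE)
  obtain S' :: "('j \<times> 'i) ell2 \<Rightarrow>\<^sub>L ('i \<times> 'j) ell2" where S': "\<forall>f i j. ell2_nth (S' f) (j, i) = ell2_nth f (i, j)"
    using swap_exists by (rule exE)
  have 1: "zb (ell2_tensor u v) = ell2_tensor u (b v)" for u v
    by (rule ell2_eqI_pair) (simp add: zb[rule_format, where h = "\<lambda>i. cscale (ell2_nth u i) v"] complex_linear_opD[OF b])
  have 2: "za (ell2_tensor v u) = ell2_tensor v (a u)" for u v
    by (rule ell2_eqI_pair) (simp add: za[rule_format, where h = "\<lambda>i. cscale (ell2_nth v i) u"] complex_linear_opD[OF a])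
  have 3: "S (ell2_tensor u v) = ell2_tensor v u" for u v
    by (rule ell2_eqI_pair) (simp add: S)
  have 4: "S' (ell2_tensor v u) = ell2_tensor u v" for u v
    by (rule ell2_eqI_pair) (simp add: S')
  show ?thesis
    by (rule exI[of _ "S' o\<^sub>L za o\<^sub>L S o\<^sub>L zb"]) (simp add: 1 2 3 4)
qed

text \<open>The description of \<open>op_tensor\<close> ranges over real-linear maps, for which
  values on the \<open>ket k\<close> alone do not suffice. A complex multiple of a basis vector over
  pairs is again a simple tensor, so the description does determine the operator.\<close>

lemma op_eqI_cscale_ket:
  fixes x y :: "'i op"
  assumes "\<And>c k. x (cscale c (ket k)) = y (cscale c (ket k))"
  shows "x = y"
proof (rule blinfun_eqI)
  fix v
  note ex = onb_expansion[OF onb_ket, of v]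
  have "((\<lambda>k. x (cscale (cinner (ket k) v) (ket k))) has_sum x v) UNIV"
    by (rule has_sum_bounded_linear[OF blinfun.bounded_linear_right ex])
  moreover have "((\<lambda>k. x (cscale (cinner (ket k) v) (ket k))) has_sum y v) UNIV"
    unfolding assms by (rule has_sum_bounded_linear[OF blinfun.bounded_linear_right ex])
  ultimately show "x v = y v" by (rule has_sum_unique)
qed

lemma cscale_ket_pair: "cscale c (ket (i, j)) = ell2_tensor (cscale c (ket i)) (ket j)"
proof (rule ell2_eqI)
  fix x :: "'a \<times> 'b"
  obtain k l where "x = (k, l)" by fastforce
  then show "ell2_nth (cscale c (ket (i, j))) x = ell2_nth (ell2_tensor (cscale c (ket i)) (ket j)) x"
    by (simp add: ell2_nth_ket)
qed

lemma op_eqI_tensor: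
  fixes x y :: "('i \<times> 'j) op"
  assumes "\<And>u v. x (ell2_tensor u v) = y (ell2_tensor u v)"
  shows "x = y"
  by (rule op_eqI_cscale_ket) (metis assms cscale_ket_pair surj_pair)

lemma op_tensor_eqI:
  fixes a :: "'i op" and b :: "'j op" and z :: "('i \<times> 'j) op"
  assumes "\<And>u v. z (ell2_tensor u v) = ell2_tensor (a u) (b v)"
  shows "op_tensor a b = z"
  unfolding op_tensor_def
  by (rule the_equality) (use assms in \<open>auto intro: op_eqI_tensor\<close>)

lemma op_tensor_apply:
  assumes "complex_linear_op a" "complex_linear_op b"
  shows "(op_tensor a b) (ell2_tensor u v) = ell2_tensor (a u) (b v)"
  using op_tensor_exists[OF assms] op_tensor_eqI by metis

text \<open>Matrix units over pairs are tensors of matrix units; any two extensions of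
  \<open>I \<otimes> V\<close> therefore agree on them.\<close>

lemma op_tensor_rank_one_ket:
  "op_tensor (rank_one (ket i) (ket k)) (rank_one (ket j) (ket l)) = rank_one (ket (i, j)) (ket (k, l))"
proof (rule op_tensor_eqI, rule ell2_eqI)
  fix u :: "'a ell2" and v :: "'b ell2" and x :: "'a \<times> 'b"
  obtain m n where "x = (m, n)" by fastforce
  then show "ell2_nth ((rank_one (ket (i, j)) (ket (k, l))) (ell2_tensor u v)) x =
      ell2_nth (ell2_tensor ((rank_one (ket i) (ket k)) u) ((rank_one (ket j) (ket l)) v)) x"
    by (simp add: ell2_nth_ket)
qed

section \<open>Multiplication operators on Schatten classes\<close>

definition multiplier :: "('i \<Rightarrow> complex) \<Rightarrow> 'i op" where
  "multiplier g = diag_op UNIV ket g"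

lemma
  assumes "\<And>i. cmod (g i) \<le> K"
  shows multiplier_nth: "ell2_nth ((multiplier g) v) i = g i * ell2_nth v i"
    and multiplier_complex_linear: "complex_linear_op (multiplier g)"
    and norm_multiplier_le: "norm (multiplier g) \<le> K"
proof -
  have "0 \<le> K" using assms norm_ge_zero order.trans by blast
  note D = diag_op_aux[OF onb_ket assms this]
  show "ell2_nth ((multiplier g) v) i = g i * ell2_nth v i"
    "complex_linear_op (multiplier g)" "norm (multiplier g) \<le> K"
    using D(1)[of i] D(2,3) by (simp_all add: multiplier_def)
qed

lemma coord_proj_multiplier: "coord_proj F = multiplier (\<lambda>i. if i \<in> F then 1 else 0)"
  by (simp add: coord_proj_def multiplier_def)

lemma multiplier_compose:
  assumes "\<And>i. cmod (g i) \<le> K" "\<And>i. cmod (h i) \<le> L"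
  shows "multiplier g o\<^sub>L multiplier h = multiplier (\<lambda>i. g i * h i)"
proof (intro blinfun_eqI ell2_eqI)
  fix v i
  have gh: "cmod (g i * h i) \<le> K * L" for i
    unfolding norm_mult using assms(1)[of i] assms(2)[of i] norm_ge_zero order.trans
    by (intro mult_mono) blast+
  show "ell2_nth ((multiplier g o\<^sub>L multiplier h) v) i = ell2_nth ((multiplier (\<lambda>i. g i * h i)) v) i"
    by (simp add: multiplier_nth[OF assms(1)] multiplier_nth[OF assms(2)] multiplier_nth[where g = "\<lambda>i. g i * h i", OF gh])
qed

lemma multiplier_diff:
  assumes "\<And>i. cmod (g i) \<le> K" "\<And>i. cmod (h i) \<le> L"
  shows "multiplier g - multiplier h = multiplier (\<lambda>i. g i - h i)"
proof (intro blinfun_eqI ell2_eqI)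
  fix v i
  have gh: "cmod (g i - h i) \<le> K + L" for i
    using assms(1)[of i] assms(2)[of i] norm_triangle_ineq4[of "g i" "h i"] by linarith
  show "ell2_nth ((multiplier g - multiplier h) v) i = ell2_nth ((multiplier (\<lambda>i. g i - h i)) v) i"
    by (simp add: multiplier_nth[OF assms(1)] multiplier_nth[OF assms(2)] multiplier_nth[where g = "\<lambda>i. g i - h i", OF gh] blinfun.diff_left left_diff_distrib)
qed

lemma multiplier_1: "multiplier (\<lambda>i. 1) = id_blinfun"
  by (intro blinfun_eqI ell2_eqI) (simp add: multiplier_nth[where g = "\<lambda>i. 1" and K = 1])

text \<open>Left and right multiplication are treated together, selected by the flag \<^term>\<open>d\<close>.\<close>

definition mult_by :: "bool \<Rightarrow> 'i op \<Rightarrow> 'i op \<Rightarrow> 'i op" where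
  "mult_by d b x = (if d then b o\<^sub>L x else x o\<^sub>L b)"

lemma mult_by_add_right: "mult_by d b (x + y) = mult_by d b x + mult_by d b y"
  by (intro blinfun_eqI) (simp add: mult_by_def blinfun.add_left blinfun.add_right)

lemma mult_by_diff_left: "mult_by d (b - c) x = mult_by d b x - mult_by d c x"
  by (intro blinfun_eqI) (simp add: mult_by_def blinfun.diff_left blinfun.diff_right)

lemma mult_by_cscale_right:
  "complex_linear_op b \<Longrightarrow> mult_by d b (op_cscale c x) = op_cscale c (mult_by d b x)"
  by (intro blinfun_eqI) (simp add: mult_by_def complex_linear_opD)

lemma mult_by_id [simp]: "mult_by d id_blinfun x = x"
  by (intro blinfun_eqI) (simp add: mult_by_def)

lemma blinfun_compose_assoc: "(x o\<^sub>L y) o\<^sub>L z = x o\<^sub>L (y o\<^sub>L z)"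
  by (rule blinfun_eqI) simp

lemma mult_by_mult_by_multiplier:
  assumes "\<And>i. cmod (g i) \<le> K" "\<And>i. cmod (h i) \<le> L"
  shows "mult_by d (multiplier g) (mult_by d (multiplier h) x) = mult_by d (multiplier (\<lambda>i. g i * h i)) x"
proof -
  have 1: "multiplier h o\<^sub>L multiplier g = multiplier (\<lambda>i. g i * h i)"
    using multiplier_compose[OF assms(2,1)] by (simp add: mult.commute)
  have 2: "multiplier g o\<^sub>L multiplier h = multiplier (\<lambda>i. g i * h i)" by (rule multiplier_compose[OF assms])
  show ?thesis
  proof (cases d)
    case True
    then show ?thesis by (simp add: mult_by_def 2 flip: blinfun_compose_assoc)
  next
    case False
    then show ?thesis by (simp add: mult_by_def 1 blinfun_compose_assoc)
  qed
qed

lemma schatten_mult_by: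
  assumes "0 < p" "x \<in> schatten p" "complex_linear_op b"
  shows "mult_by d b x \<in> schatten p" "schatten_norm p (mult_by d b x) \<le> norm b * schatten_norm p x"
  using schatten_mult_left[OF assms] schatten_mult_right[OF assms] by (simp_all add: mult_by_def)

lemma op_cscale_eq_mult: "op_cscale c x = op_cscale c id_blinfun o\<^sub>L x"
  by (intro blinfun_eqI) simp

lemma schatten_cscale:
  assumes "0 < p" "x \<in> schatten p"
  shows "op_cscale c x \<in> schatten p" "schatten_norm p (op_cscale c x) \<le> cmod c * schatten_norm p x"
proof -
  have cl: "complex_linear_op (op_cscale c id_blinfun)" by (simp add: complex_linear_op_def mult.commute)
  have n: "norm (op_cscale c id_blinfun :: 'a op) \<le> cmod c" by (rule norm_blinfun_bound) simp_all
  note m = schatten_mult_left[OF assms cl, folded op_cscale_eq_mult]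
  show "op_cscale c x \<in> schatten p" by (rule m)
  show "schatten_norm p (op_cscale c x) \<le> cmod c * schatten_norm p x"
    using m(2) mult_right_mono[OF n schatten_norm_nonneg[of p x]] by linarith
qed

text \<open>The value of \<open>V\<close> at a sum is a separate hypothesis because closedness of
  the Schatten class under addition is not among the facts established here.\<close>

lemma schatten_linear_mult_by:
  fixes V :: "'a op \<Rightarrow> 'a op"
  assumes "0 < p" "complex_linear_op b" and V: "\<And>x. x \<in> schatten p \<Longrightarrow> V x = mult_by d b x"
    and add: "\<And>x y. x \<in> schatten p \<Longrightarrow> y \<in> schatten p \<Longrightarrow> V (x + y) = mult_by d b (x + y)"
  shows "schatten_linear p V"
  unfolding schatten_linear_def
proof (intro conjI ballI allI)
  fix x y :: "'a op" assume x: "x \<in> schatten p" and y: "y \<in> schatten p"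
  show "V (x + y) = V x + V y" by (simp add: add x y V mult_by_add_right)
next
  fix c and x :: "'a op" assume x: "x \<in> schatten p"
  show "V x \<in> schatten p" using schatten_mult_by(1)[OF assms(1) x assms(2)] by (simp add: V x)
  show "V (op_cscale c x) = op_cscale c (V x)"
    by (simp add: V x schatten_cscale(1)[OF assms(1) x] mult_by_cscale_right[OF assms(2)])
qed

lemma schatten_opnorm_mult_by_le:
  fixes V :: "'i op \<Rightarrow> 'i op"
  assumes "0 < p" "complex_linear_op b" "norm b \<le> K" and V: "\<And>x. x \<in> schatten p \<Longrightarrow> V x = mult_by d b x"
  shows "schatten_opnorm p V \<le> ennreal K"
  unfolding schatten_opnorm_def
proof (rule SUP_least)
  fix x :: "'i op" assume "x \<in> {x \<in> schatten p. schatten_norm p x \<le> 1}"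
  then have x: "x \<in> schatten p" "schatten_norm p x \<le> 1" by auto
  have "schatten_norm p (V x) \<le> norm b * schatten_norm p x" using schatten_mult_by(2)[OF assms(1) x(1) assms(2)] V[OF x(1)] by simp
  also have "\<dots> \<le> K * 1" using assms(3) x(2) order.trans[OF norm_ge_zero assms(3)] by (intro mult_mono) auto
  finally show "ennreal (schatten_norm p (V x)) \<le> ennreal K" by (simp add: ennreal_leI)
qed

lemma schatten_bounded_bound:
  assumes p: "0 < p" and W: "schatten_bounded p W"
  obtains M where "0 \<le> M" "\<And>x. x \<in> schatten p \<Longrightarrow> schatten_norm p (W x) \<le> M * schatten_norm p x"
proof -
  have lin: "schatten_linear p W" and fin: "schatten_opnorm p W < \<infinity>" using W by (auto simp: schatten_bounded_def)
  define M where "M = enn2real (schatten_opnorm p W)"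
  have M: "ennreal M = schatten_opnorm p W" using fin by (simp add: M_def)
  have unit: "schatten_norm p (W x) \<le> M" if "x \<in> schatten p" "schatten_norm p x \<le> 1" for x
  proof -
    have "ennreal (schatten_norm p (W x)) \<le> ennreal M"
      unfolding M schatten_opnorm_def by (rule SUP_upper) (use that in auto)
    then show ?thesis by (simp add: M_def)
  qed
  have "schatten_norm p (W x) \<le> M * schatten_norm p x" if x: "x \<in> schatten p" for x
  proof -
    define t where "t = schatten_norm p x"
    have cs: "W (op_cscale c y) = op_cscale c (W y)" "W y \<in> schatten p" if "y \<in> schatten p" for c y
      using lin that by (auto simp: schatten_linear_def)
    show ?thesis
    proof (cases "t = 0")
      \<comment> \<open>Vanishing norm forces \<open>x = 0\<close>, since it dominates the operator
        norm; homogeneity with the scalar 0 then treats the value of \<open>W\<close>.\<close>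
      case True
      then have "x = 0" using norm_le_schatten_norm[OF p x] by (simp add: t_def)
      then have "op_cscale 0 x = x" by (intro blinfun_eqI) simp
      then have "W x = op_cscale 0 (W x)" using cs(1)[OF x, of 0] by simp
      then have "schatten_norm p (W x) \<le> 0" using schatten_cscale(2)[OF p cs(2)[OF x], of 0] by simp
      then show ?thesis using True by (simp add: t_def)
    next
      case False
      then have t: "t > 0" using schatten_norm_nonneg[of p x] by (simp add: t_def order_less_le)
      define y where "y = op_cscale (of_real (1/t)) x"
      have y: "y \<in> schatten p" "schatten_norm p y \<le> 1"
        using schatten_cscale[OF p x, of "of_real (1/t)"] t by (simp_all add: y_def t_def norm_divide)
      have "x = op_cscale (of_real t) y"
        using t by (intro blinfun_eqI) (simp add: y_def flip: of_real_mult)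
      then have "schatten_norm p (W x) \<le> t * schatten_norm p (W y)"
        using schatten_cscale(2)[OF p cs(2)[OF y(1)], of "of_real t"] cs(1)[OF y(1)] t by simp
      also have "\<dots> \<le> t * M" using t unit[OF y] by (intro mult_left_mono) auto
      finally show ?thesis by (simp add: t_def mult.commute)
    qed
  qed
  then show thesis using that[of M] by (simp add: M_def)
qed

lemma schatten_rank_one_sum:
  assumes "0 < p" "finite A"
  shows "(\<Sum>(i, j)\<in>A. op_cscale (c i j) (rank_one (ket i) (ket j))) \<in> schatten p"
proof (rule schatten_finite_columns[OF assms(1), where F = "snd ` A"])
  show "complex_linear_op (\<Sum>(i, j)\<in>A. op_cscale (c i j) (rank_one (ket i) (ket j)))"
    by (intro complex_linear_sum) auto
  show "(\<Sum>(i, j)\<in>A. op_cscale (c i j) (rank_one (ket i) (ket j))) (ket k) = 0" if "k \<notin> snd ` A" for k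
    unfolding blinfun.sum_left by (rule sum.neutral) (use that in \<open>force simp: ell2_nth_ket\<close>)
qed (use assms in simp)

text \<open>A bounded linear map is determined by its values on the matrix units, because the finite
  corners of an element of the Schatten class approximate it.\<close>

lemma schatten_bounded_eqI:
  assumes p: "0 < p" and W: "schatten_bounded p W" "schatten_bounded p W'"
    and unit: "\<And>i j. W (rank_one (ket i) (ket j)) = W' (rank_one (ket i) (ket j))"
    and x: "x \<in> schatten p"
  shows "W x = W' x"
proof -
  obtain M where M: "0 \<le> M" "\<And>x. x \<in> schatten p \<Longrightarrow> schatten_norm p (W x) \<le> M * schatten_norm p x"
    by (rule schatten_bounded_bound[OF p W(1)]) blast
  obtain M' where M': "0 \<le> M'" "\<And>x. x \<in> schatten p \<Longrightarrow> schatten_norm p (W' x) \<le> M' * schatten_norm p x"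
    by (rule schatten_bounded_bound[OF p W(2)]) blast
  have add: "W (x + y) = W x + W y" "W' (x + y) = W' x + W' y" if "x \<in> schatten p" "y \<in> schatten p" for x y
    using W that by (auto simp: schatten_bounded_def schatten_linear_def)
  have cs: "W (op_cscale c x) = op_cscale c (W x)" "W' (op_cscale c x) = op_cscale c (W' x)" if "x \<in> schatten p" for c x
    using W that by (auto simp: schatten_bounded_def schatten_linear_def)
  have mem: "W x \<in> schatten p" "W' x \<in> schatten p" if "x \<in> schatten p" for x
    using W that by (auto simp: schatten_bounded_def schatten_linear_def)
  have zero: "W 0 = W' 0"
  proof -
    have z: "op_cscale 0 y = 0" for y :: "'a op" by (rule blinfun_eqI) simp
    have "(0 :: 'a op) \<in> schatten p" using schatten_cscale(1)[OF p x, of 0] by (simp add: z)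
    then show ?thesis using cs[of 0 0] by (simp add: z)
  qed
  have fin: "W (\<Sum>(i, j)\<in>A. op_cscale (c i j) (rank_one (ket i) (ket j))) = W' (\<Sum>(i, j)\<in>A. op_cscale (c i j) (rank_one (ket i) (ket j)))"
    if "finite A" for A and c :: "'a \<Rightarrow> 'a \<Rightarrow> complex"
    using that
  proof (induction A)
    case (insert k A)
    obtain i j where k: "k = (i, j)" by fastforce
    have r: "rank_one (ket i) (ket j) \<in> schatten p" by (rule schatten_rank_one_ket[OF p])
    show ?case
      using insert add[OF schatten_cscale(1)[OF p r] schatten_rank_one_sum[OF p insert.hyps(1)]] cs[OF r] unit
      by (simp add: k)
  qed (simp add: zero)
  \<comment> \<open>The values of \<open>W\<close> and \<open>W'\<close> are compared in the
    operator norm, so only the triangle inequality for operators enters.\<close>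
  have approx: "W y = W' y"
    if y: "y \<in> schatten p" and small: "\<And>r. r > 0 \<Longrightarrow> \<exists>z w. z \<in> schatten p \<and> w \<in> schatten p \<and> y = z + w \<and> W z = W' z \<and> schatten_norm p w < r" for y
  proof (rule ccontr)
    assume "W y \<noteq> W' y"
    define s where "s = norm (W y - W' y)"
    have s: "s > 0" using \<open>W y \<noteq> W' y\<close> by (simp add: s_def)
    have MM: "M + M' + 1 > 0" using M(1) M'(1) by simp
    obtain z w where zw: "z \<in> schatten p" "w \<in> schatten p" "y = z + w" "W z = W' z" "schatten_norm p w < s / (M + M' + 1)"
      using small[of "s / (M + M' + 1)"] s MM by auto
    have "W y - W' y = W w - W' w" using add[OF zw(1,2)] zw(3,4) by simp
    then have "s \<le> norm (W w) + norm (W' w)" unfolding s_def using norm_triangle_ineq4 by metis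
    also have "\<dots> \<le> schatten_norm p (W w) + schatten_norm p (W' w)"
      by (intro add_mono norm_le_schatten_norm p mem zw)
    also have "\<dots> \<le> M * schatten_norm p w + M' * schatten_norm p w" by (intro add_mono M M' zw)
    also have "\<dots> \<le> (M + M' + 1) * schatten_norm p w" by (simp add: algebra_simps)
    also have "\<dots> < s" using zw(5) MM by (simp add: field_simps)
    finally show False by simp
  qed
  have proj: "coord_proj F o\<^sub>L y \<in> schatten p" "y o\<^sub>L coord_proj F \<in> schatten p" if "y \<in> schatten p" for F and y :: "'a op"
    using schatten_mult_left(1)[OF p that, of "coord_proj F"] schatten_mult_right(1)[OF p that, of "coord_proj F"] by simp_all
  have splitl: "y = (coord_proj F o\<^sub>L y) + (coord_proj (- F) o\<^sub>L y)" for F and y :: "'a op"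
    by (intro blinfun_eqI) (simp add: coord_proj_compl blinfun.add_left blinfun.diff_left)
  have splitr: "y = (y o\<^sub>L coord_proj F) + (y o\<^sub>L coord_proj (- F))" for F and y :: "'a op"
    by (intro blinfun_eqI) (simp add: coord_proj_compl blinfun.add_left blinfun.diff_left blinfun.diff_right)
  \<comment> \<open>The corner formula is available for equal truncations on both sides; a
    rectangular corner is a square one for \<open>F \<union> G\<close>.\<close>
  have corner: "W (coord_proj F o\<^sub>L x o\<^sub>L coord_proj G) = W' (coord_proj F o\<^sub>L x o\<^sub>L coord_proj G)" if "finite F" "finite G" for F G
  proof -
    have "coord_proj F o\<^sub>L x o\<^sub>L coord_proj G = coord_proj (F \<union> G) o\<^sub>L (coord_proj F o\<^sub>L x o\<^sub>L coord_proj G) o\<^sub>L coord_proj (F \<union> G)"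
    proof (intro blinfun_eqI ell2_eqI)
      fix v i
      have "(coord_proj G) ((coord_proj (F \<union> G)) v) = (coord_proj G) v"
        by (rule ell2_eqI) simp
      then show "ell2_nth ((coord_proj F o\<^sub>L x o\<^sub>L coord_proj G) v) i =
        ell2_nth ((coord_proj (F \<union> G) o\<^sub>L (coord_proj F o\<^sub>L x o\<^sub>L coord_proj G) o\<^sub>L coord_proj (F \<union> G)) v) i"
        by simp
    qed
    moreover have "complex_linear_op (coord_proj F o\<^sub>L x o\<^sub>L coord_proj G)" using schatten_complex_linear[OF x] by simp
    ultimately show ?thesis
      using coord_proj_corner[of "coord_proj F o\<^sub>L x o\<^sub>L coord_proj G" "F \<union> G"] fin[of "(F \<union> G) \<times> (F \<union> G)"] that by auto
  qed
  \<comment> \<open>Truncation is done one side at a time: for fixed \<open>F\<close> the right side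
    is approximated, and afterwards the left side, each step using the equality already known for
    the smaller piece.\<close>
  have left: "W (coord_proj F o\<^sub>L x) = W' (coord_proj F o\<^sub>L x)" if F: "finite F" for F
  proof (rule approx)
    show "coord_proj F o\<^sub>L x \<in> schatten p" by (rule proj(1)[OF x])
    fix r :: real assume "r > 0"
    then obtain G where G: "finite G" "schatten_norm p ((coord_proj F o\<^sub>L x) o\<^sub>L coord_proj (- G)) < r"
      using schatten_coord_proj_right_small[OF p proj(1)[OF x]] by blast
    show "\<exists>z w. z \<in> schatten p \<and> w \<in> schatten p \<and> coord_proj F o\<^sub>L x = z + w \<and> W z = W' z \<and> schatten_norm p w < r"
      using proj(2)[OF proj(1)[OF x]] splitr corner[OF F G(1)] G(2)
      by (intro exI[of _ "coord_proj F o\<^sub>L x o\<^sub>L coord_proj G"] exI[of _ "coord_proj F o\<^sub>L x o\<^sub>L coord_proj (- G)"] conjI)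
  qed
  show ?thesis
  proof (rule approx[OF x])
    fix r :: real assume "r > 0"
    then obtain G where G: "finite G" "schatten_norm p (coord_proj (- G) o\<^sub>L x) < r"
      using schatten_coord_proj_left_small[OF p x] by blast
    show "\<exists>z w. z \<in> schatten p \<and> w \<in> schatten p \<and> x = z + w \<and> W z = W' z \<and> schatten_norm p w < r"
      using proj(1)[OF x] splitl left[OF G(1)] G(2)
      by (intro exI[of _ "coord_proj G o\<^sub>L x"] exI[of _ "coord_proj (- G) o\<^sub>L x"] conjI)
  qed
qed

lemma multiplier_tensor:
  assumes g: "\<And>i. cmod (g i) \<le> K" and a: "complex_linear_op a" and b: "complex_linear_op b"
  shows "mult_by d (multiplier (\<lambda>x. g (snd x))) (op_tensor a b) = op_tensor a (mult_by d (multiplier g) b)"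
proof (rule op_tensor_eqI[symmetric])
  fix u v
  have gs: "cmod (g (snd x)) \<le> K" for x by (rule g)
  have m: "(multiplier (\<lambda>x. g (snd x))) (ell2_tensor u v) = ell2_tensor u ((multiplier g) v)" for u :: "'c ell2" and v
    by (rule ell2_eqI_pair) (simp add: multiplier_nth[OF g] multiplier_nth[OF gs])
  show "(mult_by d (multiplier (\<lambda>x. g (snd x))) (op_tensor a b)) (ell2_tensor u v)
    = ell2_tensor (a u) ((mult_by d (multiplier g) b) v)"
    by (cases d) (simp_all add: mult_by_def m op_tensor_apply[OF a b])
qed

text \<open>Since \<^const>\<open>cb_norm\<close> refers to an arbitrary bounded extension of \<open>I \<otimes> V\<close>, that extension first
  has to be identified with the multiplication operator by \<open>1 \<otimes> g\<close>.\<close>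

lemma cb_norm_multiplier_le:
  assumes p: "0 < p" and g: "\<And>i. cmod (g i) \<le> K"
    and V: "\<And>x. complex_linear_op x \<Longrightarrow> V x = mult_by d (multiplier g) x"
  shows "completely_bounded p V" "cb_norm p V \<le> ennreal K"
proof -
  define W0 where "W0 = mult_by d (multiplier (\<lambda>x :: nat \<times> nat. g (snd x)))"
  have gs: "cmod (g (snd x)) \<le> K" for x :: "nat \<times> nat" by (rule g)
  note m = multiplier_complex_linear[OF g] norm_multiplier_le[OF g]
  note ms = multiplier_complex_linear[OF gs] norm_multiplier_le[OF gs]
  have lin: "schatten_linear p V"
    by (rule schatten_linear_mult_by[OF p m(1), where d = d]) (simp_all add: V schatten_complex_linear)
  have W0_norm: "schatten_opnorm p W0 \<le> ennreal K"
    by (rule schatten_opnorm_mult_by_le[OF p ms]) (simp add: W0_def)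
  have W0_lin: "schatten_linear p W0"
    by (rule schatten_linear_mult_by[OF p ms(1), where d = d]) (simp_all add: W0_def)
  have W0_bdd: "schatten_bounded p W0"
    using W0_lin order.strict_trans1[OF W0_norm ennreal_less_top] by (simp add: schatten_bounded_def)
  have ext0: "cb_extension p V W0"
    using W0_bdd unfolding cb_extension_def W0_def
    by (auto simp: V schatten_complex_linear intro!: multiplier_tensor[where g = g, OF g])
  then show "completely_bounded p V" using lin by (auto simp: completely_bounded_def)
  define W where "W = (SOME W. cb_extension p V W)"
  have ext: "cb_extension p V W" unfolding W_def by (rule someI[of _ W0]) (rule ext0)
  have "W (rank_one (ket x) (ket y)) = W0 (rank_one (ket x) (ket y))" for x y
  proof -
    obtain i j k l where "x = (i, j)" "y = (k, l)" by (metis surj_pair)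
    moreover have "W (op_tensor (rank_one (ket i) (ket k)) (rank_one (ket j) (ket l)))
        = W0 (op_tensor (rank_one (ket i) (ket k)) (rank_one (ket j) (ket l)))"
      using ext ext0 by (simp add: cb_extension_def schatten_rank_one_ket[OF p])
    ultimately show ?thesis by (simp add: op_tensor_rank_one_ket)
  qed
  then have "W x = W0 x" if "x \<in> schatten p" for x
    using schatten_bounded_eqI[OF p _ W0_bdd _ that, of W] ext by (simp add: cb_extension_def)
  then have "schatten_opnorm p W = schatten_opnorm p W0"
    unfolding schatten_opnorm_def by (intro SUP_cong refl) auto
  then show "cb_norm p V \<le> ennreal K" using W0_norm by (simp add: cb_norm_def W_def)
qed

section \<open>The Ritt operators\<close>

definition weight :: "nat \<Rightarrow> real" where
  "weight i = 1 - 1 / 2 ^ (i + 1)"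

lemma weight_bounds: "0 < weight i" "weight i < 1" "0 \<le> weight i" "weight i \<le> 1"
proof -
  have "(1::real) < 2 ^ (i + 1)" by (rule one_less_power) auto
  then show "0 < weight i" by (simp add: weight_def)
  then show "0 \<le> weight i" by simp
  show "weight i < 1" by (simp add: weight_def)
  then show "weight i \<le> 1" by simp
qed

definition ritt_mult :: "bool \<Rightarrow> nat op \<Rightarrow> nat op" where
  "ritt_mult d = mult_by d (multiplier (\<lambda>i. of_real (weight i)))"

lemma cmod_weight_powr_le: "cmod (of_real (weight i) ^ n) \<le> 1"
  using weight_bounds[of i] by (simp add: norm_power power_le_one)

lemma cmod_weight_le: "cmod (of_real (weight i)) \<le> 1"
  using weight_bounds[of i] by simp

lemma ritt_mult_funpow:
  "(ritt_mult d ^^ n) x = mult_by d (multiplier (\<lambda>i. of_real (weight i) ^ n)) x"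
proof (induction n)
  case (Suc n)
  then show ?case
    using mult_by_mult_by_multiplier[where g = "\<lambda>i. of_real (weight i)" and h = "\<lambda>i. of_real (weight i) ^ n", OF cmod_weight_le cmod_weight_powr_le, of d x]
    by (simp add: ritt_mult_def)
qed (simp add: multiplier_1)

text \<open>The scalar Ritt estimate: powers of \<open>weight i\<close> decrease, so
  \<open>n\<close> copies of the last one are at most the geometric sum, and the factor
  \<open>1 - weight i\<close> telescopes it.\<close>

lemma n_weight_power_le: "real n * (weight i ^ (n - 1) * (1 - weight i)) \<le> 1" if "n \<ge> 1"
proof -
  have "real n * weight i ^ (n - 1) = (\<Sum>k<n. weight i ^ (n - 1))" by simp
  also have "\<dots> \<le> (\<Sum>k<n. weight i ^ k)"
    by (intro sum_mono power_decreasing) (use weight_bounds[of i] in auto)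
  finally have "real n * weight i ^ (n - 1) * (1 - weight i) \<le> (\<Sum>k<n. weight i ^ k) * (1 - weight i)"
    using weight_bounds[of i] by (intro mult_right_mono) auto
  also have "\<dots> = 1 - weight i ^ n" using one_diff_power_eq[of "weight i" n] by (simp add: mult.commute)
  also have "\<dots> \<le> 1" using weight_bounds[of i] by simp
  finally show ?thesis by (simp add: mult.assoc)
qed

lemma ritt_ritt_mult:
  assumes p: "0 < p" shows "ritt p (ritt_mult d)"
proof -
  note m = multiplier_complex_linear[OF cmod_weight_le] norm_multiplier_le[OF cmod_weight_le]
  note mp = multiplier_complex_linear[OF cmod_weight_powr_le] norm_multiplier_le[OF cmod_weight_powr_le]
  have "schatten_linear p (ritt_mult d)"
    by (rule schatten_linear_mult_by[OF p m(1), where d = d]) (simp_all add: ritt_mult_def)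
  moreover have 1: "schatten_opnorm p (ritt_mult d ^^ n) \<le> ennreal 1" for n
    by (rule schatten_opnorm_mult_by_le[OF p mp]) (rule ritt_mult_funpow)
  moreover have 2: "schatten_opnorm p (\<lambda>x. real n *\<^sub>R ((ritt_mult d ^^ n) x - (ritt_mult d ^^ (n - 1)) x)) \<le> ennreal 1" if "n \<in> {1..}" for n
  proof -
    define g where "g i = complex_of_real (real n * (weight i ^ n - weight i ^ (n - 1)))" for i
    have g: "cmod (g i) \<le> 1" for i
    proof -
      have "weight i ^ n = weight i * weight i ^ (n - 1)" using that by (cases n) auto
      then have "real n * (weight i ^ n - weight i ^ (n - 1)) = - (real n * (weight i ^ (n - 1) * (1 - weight i)))"
        by (simp add: algebra_simps)
      then have "cmod (g i) = real n * (weight i ^ (n - 1) * (1 - weight i))"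
        using weight_bounds[of i] unfolding g_def by (simp add: abs_mult del: of_real_mult)
      then show ?thesis using n_weight_power_le[of n i] that by simp
    qed
    have "real n *\<^sub>R ((ritt_mult d ^^ n) x - (ritt_mult d ^^ (n - 1)) x) = mult_by d (multiplier g) x" for x
    proof -
      have c: "cmod (complex_of_real (weight i) ^ n - of_real (weight i) ^ (n - 1)) \<le> 2" for i
        using norm_triangle_ineq4[of "complex_of_real (weight i) ^ n" "of_real (weight i) ^ (n - 1)"]
          cmod_weight_powr_le[of i n] cmod_weight_powr_le[of i "n - 1"] by linarith
      have "multiplier g = real n *\<^sub>R multiplier (\<lambda>i. of_real (weight i) ^ n - of_real (weight i) ^ (n - 1))"
        by (intro blinfun_eqI ell2_eqI)
           (simp only: ell2_nth_simps blinfun.scaleR_left multiplier_nth[where g = "\<lambda>i. of_real (weight i) ^ n - of_real (weight i) ^ (n - 1)", OF c]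
              multiplier_nth[where g = g, OF g], simp add: g_def)
      also have "\<dots> = real n *\<^sub>R (multiplier (\<lambda>i. of_real (weight i) ^ n) - multiplier (\<lambda>i. of_real (weight i) ^ (n - 1)))"
        by (subst multiplier_diff[where g = "\<lambda>i. of_real (weight i) ^ n" and h = "\<lambda>i. of_real (weight i) ^ (n - 1)", OF cmod_weight_powr_le cmod_weight_powr_le]) simp
      finally have "mult_by d (multiplier g) x = real n *\<^sub>R mult_by d (multiplier (\<lambda>i. of_real (weight i) ^ n) - multiplier (\<lambda>i. of_real (weight i) ^ (n - 1))) x"
        by (intro blinfun_eqI) (simp add: mult_by_def blinfun.scaleR_left blinfun.scaleR_right)
      then show ?thesis by (simp add: ritt_mult_funpow mult_by_diff_left)
    qed
    then show ?thesis
      by (intro schatten_opnorm_mult_by_le[OF p multiplier_complex_linear[OF g] norm_multiplier_le[OF g]])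
  qed
  moreover have "(SUP n. schatten_opnorm p (ritt_mult d ^^ n)) \<le> ennreal 1" by (rule SUP_least) (rule 1)
  moreover have "(SUP n\<in>{1..}. schatten_opnorm p (\<lambda>x. real n *\<^sub>R ((ritt_mult d ^^ n) x - (ritt_mult d ^^ (n - 1)) x))) \<le> ennreal 1"
    by (rule SUP_least) (rule 2)
  moreover have "schatten_opnorm p (ritt_mult d) \<le> ennreal 1" using 1[of 1] by simp
  ultimately show ?thesis
    unfolding ritt_def schatten_bounded_def infinity_ennreal_def
    by (intro conjI) (assumption | rule order.strict_trans1[OF _ ennreal_less_top[of 1]])+
qed

text \<open>On finitely many coordinates \<open>I - T\<close> is inverted exactly by dividing by
  \<open>1 - weight i\<close>. With \<open>x\<close> obtained in this way from \<open>y\<close>, the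
  error is precisely the truncation of \<open>y\<close> to the remaining coordinates.\<close>

lemma dense_range_ritt_mult:
  assumes p: "0 < p" shows "dense_range_I_minus p (ritt_mult d)"
  unfolding dense_range_I_minus_def
proof (intro ballI allI impI)
  fix y :: "nat op" and r :: real assume y: "y \<in> schatten p" and r: "0 < r"
  have "\<exists>F. finite F \<and> schatten_norm p (mult_by d (coord_proj (- F)) y) < r"
    using schatten_coord_proj_left_small[OF p y r] schatten_coord_proj_right_small[OF p y r]
    by (cases d) (simp_all add: mult_by_def)
  then obtain F where F: "finite F" "schatten_norm p (mult_by d (coord_proj (- F)) y) < r" by blast
  define h where "h i = (if i \<in> F then 1 / (1 - complex_of_real (weight i)) else 0)" for i
  define K where "K = (\<Sum>i\<in>F. cmod (h i))"
  have h: "cmod (h i) \<le> K" for i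
  proof (cases "i \<in> F")
    case True
    then show ?thesis unfolding K_def by (intro member_le_sum F) auto
  next
    case False
    then show ?thesis by (simp add: h_def K_def sum_nonneg)
  qed
  have d1: "cmod (1 - complex_of_real (weight i)) \<le> 2" for i
    using norm_triangle_ineq4[of 1 "complex_of_real (weight i)"] cmod_weight_le[of i] by simp
  define x where "x = mult_by d (multiplier h) y"
  have "x - ritt_mult d x = mult_by d (multiplier (\<lambda>i. 1) - multiplier (\<lambda>i. of_real (weight i))) x"
    by (simp add: mult_by_diff_left multiplier_1 ritt_mult_def)
  also have "\<dots> = mult_by d (multiplier (\<lambda>i. 1 - of_real (weight i))) x"
    by (subst multiplier_diff[where K = 1 and L = 1]) (simp_all add: weight_bounds)
  also have "\<dots> = mult_by d (multiplier (\<lambda>i. (1 - of_real (weight i)) * h i)) y"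
    unfolding x_def by (rule mult_by_mult_by_multiplier[OF d1 h])
  also have "(\<lambda>i. (1 - of_real (weight i)) * h i) = (\<lambda>i. if i \<in> F then 1 else 0)"
  proof
    fix i
    have "1 - complex_of_real (weight i) \<noteq> 0" using weight_bounds(2)[of i] of_real_eq_1_iff[of "weight i", where 'a = complex] by force
    then show "(1 - of_real (weight i)) * h i = (if i \<in> F then 1 else 0)" by (simp add: h_def)
  qed
  finally have "y - (x - ritt_mult d x) = mult_by d id_blinfun y - mult_by d (coord_proj F) y"
    by (simp add: coord_proj_multiplier)
  also have "\<dots> = mult_by d (coord_proj (- F)) y" by (simp add: coord_proj_compl mult_by_diff_left)
  finally have "schatten_norm p (y - (x - ritt_mult d x)) < r" using F(2) by simp
  moreover have "x \<in> schatten p" unfolding x_def by (rule schatten_mult_by(1)[OF p y multiplier_complex_linear[OF h]])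
  ultimately show "\<exists>x\<in>schatten p. schatten_norm p (y - (x - ritt_mult d x)) < r" by blast
qed

text \<open>The homothety with centre 1 and ratio \<open>1 - weight i\<close> sends the disc of
  radius \<open>sin \<gamma>\<close> about 0 to a disc about \<open>weight i\<close>. Its image
  consists of convex combinations of 1 and points of the disc.\<close>

lemma weight_in_stolz_domain:
  assumes "0 < sin \<gamma>" shows "complex_of_real (weight i) \<in> stolz_domain \<gamma>"
  unfolding stolz_domain_def
proof (rule interiorI)
  let ?w = "complex_of_real (weight i)"
  let ?r = "(1 - weight i) * sin \<gamma>"
  show "open (ball ?w ?r)" by simp
  show "?w \<in> ball ?w ?r" using assms weight_bounds[of i] by simp
  show "ball ?w ?r \<subseteq> convex hull insert 1 (ball 0 (sin \<gamma>))"
  proof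
    fix z assume z: "z \<in> ball ?w ?r"
    define y where "y = (1 / (1 - weight i)) *\<^sub>R (z - ?w)"
    have "cmod (z - ?w) < ?r" using z by (simp add: dist_norm norm_minus_commute)
    then have "cmod y < sin \<gamma>" using weight_bounds[of i] unfolding y_def norm_scaleR by (simp add: field_simps)
    then have "y \<in> convex hull insert 1 (ball 0 (sin \<gamma>))" by (intro hull_inc) simp
    moreover have "1 \<in> convex hull insert (1::complex) (ball 0 (sin \<gamma>))" by (intro hull_inc) simp
    ultimately have "weight i *\<^sub>R 1 + (1 - weight i) *\<^sub>R y \<in> convex hull insert 1 (ball 0 (sin \<gamma>))"
      using weight_bounds[of i] by (intro convexD[OF convex_convex_hull]) auto
    moreover have "weight i *\<^sub>R 1 + (1 - weight i) *\<^sub>R y = z"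
      using weight_bounds[of i] by (simp add: y_def scaleR_conv_of_real)
    ultimately show "z \<in> convex hull insert 1 (ball 0 (sin \<gamma>))" by simp
  qed
qed

lemma bounded_stolz_domain: "bounded (stolz_domain \<gamma>)"
  unfolding stolz_domain_def by (intro bounded_interior bounded_convex_hull) simp

text \<open>The supremum is a real one and bounds the values only when they are bounded above;
  compactness of the closure of the domain ensures this.\<close>

lemma cmod_poly_le_SUP_stolz_domain:
  assumes "z \<in> stolz_domain \<gamma>"
  shows "cmod (poly \<phi> z) \<le> (SUP z\<in>stolz_domain \<gamma>. cmod (poly \<phi> z))"
proof (rule cSUP_upper[OF assms])
  have "compact ((\<lambda>z. cmod (poly \<phi> z)) ` closure (stolz_domain \<gamma>))"
    using bounded_stolz_domain by (intro compact_continuous_image continuous_intros) (simp add: compact_closure)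
  then have "bdd_above ((\<lambda>z. cmod (poly \<phi> z)) ` closure (stolz_domain \<gamma>))"
    by (intro bounded_imp_bdd_above compact_imp_bounded)
  then show "bdd_above ((\<lambda>z. cmod (poly \<phi> z)) ` stolz_domain \<gamma>)"
    by (rule bdd_above_mono) (use closure_subset in auto)
qed

lemma poly_op_ritt_mult:
  assumes K: "\<And>i. cmod (poly \<phi> (of_real (weight i))) \<le> K" and x: "complex_linear_op x"
  shows "poly_op \<phi> (ritt_mult d) x = mult_by d (multiplier (\<lambda>i. poly \<phi> (of_real (weight i)))) x"
proof (rule blinfun_eqI)
  fix v
  note mp = multiplier_nth[where g = "\<lambda>i. of_real (weight i) ^ n" for n, OF cmod_weight_powr_le]
  have m: "(multiplier (\<lambda>i. poly \<phi> (of_real (weight i)))) u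
      = (\<Sum>n\<le>degree \<phi>. cscale (coeff \<phi> n) ((multiplier (\<lambda>i. of_real (weight i) ^ n)) u))" for u
  proof (rule ell2_eqI)
    fix i
    have "ell2_nth ((multiplier (\<lambda>i. poly \<phi> (of_real (weight i)))) u) i = poly \<phi> (of_real (weight i)) * ell2_nth u i"
      by (rule multiplier_nth[where g = "\<lambda>i. poly \<phi> (of_real (weight i))", OF K])
    then show "ell2_nth ((multiplier (\<lambda>i. poly \<phi> (of_real (weight i)))) u) i
      = ell2_nth (\<Sum>n\<le>degree \<phi>. cscale (coeff \<phi> n) ((multiplier (\<lambda>i. of_real (weight i) ^ n)) u)) i"
      by (simp only: ell2_nth_simps mp ell2_nth_sum poly_altdef sum_distrib_right mult.assoc)
  qed
  show "(poly_op \<phi> (ritt_mult d) x) v = (mult_by d (multiplier (\<lambda>i. poly \<phi> (of_real (weight i)))) x) v"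
    by (cases d) (simp_all add: poly_op_def ritt_mult_funpow mult_by_def m blinfun.sum_left blinfun.sum_right complex_linear_opD[OF x])
qed

lemma cb_functional_calculus_ritt_mult:
  assumes p: "0 < p" and \<gamma>: "0 < sin \<gamma>"
  shows "cb_functional_calculus p \<gamma> (ritt_mult d)"
  unfolding cb_functional_calculus_def
proof (intro exI[of _ 1] allI)
  fix \<phi> :: "complex poly"
  have K: "cmod (poly \<phi> (of_real (weight i))) \<le> (SUP z\<in>stolz_domain \<gamma>. cmod (poly \<phi> z))" for i
    by (rule cmod_poly_le_SUP_stolz_domain[OF weight_in_stolz_domain[OF \<gamma>]])
  show "completely_bounded p (poly_op \<phi> (ritt_mult d)) \<and>
    cb_norm p (poly_op \<phi> (ritt_mult d)) \<le> ennreal (1 * (SUP z\<in>stolz_domain \<gamma>. cmod (poly \<phi> z)))"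
    using cb_norm_multiplier_le[OF p K poly_op_ritt_mult[OF K]] by simp
qed

section \<open>Square functions\<close>

lemma op_powr_half_square:
  assumes a: "pos_op a" "compact_op a"
  shows "op_powr a (1/2) o\<^sub>L op_powr a (1/2) = a"
proof -
  obtain E l where eb: "eigenbasis a E l" using spectral_theorem[OF a] by blast
  note r = op_powr_apply[OF eb a(1), of "1/2"] op_powr_complex_linear[OF eb a(1), of "1/2"]
  show ?thesis
  proof (rule op_eqI_onb[OF eigenbasis_onb[OF eb]])
    fix e assume e: "e \<in> E"
    have "l e powr (1/2) * l e powr (1/2) = l e"
      using eigenbasis_ge_0[OF eb e] by (simp add: powr_half_sqrt)
    then show "(op_powr a (1/2) o\<^sub>L op_powr a (1/2)) e = a e"
      using r(1)[OF _ e] by (simp add: blinfun.scaleR_right eigenbasis_apply[OF eb e])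
  qed (use r a in \<open>auto simp: pos_op_complex_linear\<close>)
qed

lemma op_powr_1:
  assumes a: "pos_op a" "compact_op a"
  shows "op_powr a 1 = a"
proof -
  obtain E l where eb: "eigenbasis a E l" using spectral_theorem[OF a] by blast
  note r = op_powr_apply[OF eb a(1), of "1"] op_powr_complex_linear[OF eb a(1), of "1"]
  show ?thesis
    by (rule op_eqI_onb[OF eigenbasis_onb[OF eb]])
       (use r a eigenbasisD[OF eb] in \<open>auto simp: pos_op_complex_linear\<close>)
qed

lemma op_abs_square:
  assumes "complex_linear_op x" "compact_op x"
  shows "op_abs x o\<^sub>L op_abs x = op_adj x o\<^sub>L x"
  unfolding op_abs_def by (intro op_powr_half_square pos_op_adj_compose compact_op_compose_left assms)

lemma pos_op_sum: "(\<And>k. k \<in> I \<Longrightarrow> pos_op (f k)) \<Longrightarrow> pos_op (\<Sum>k\<in>I. f k)"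
proof (induction I rule: infinite_finite_induct)
  case (insert k I)
  then have "pos_op (f k)" "pos_op (\<Sum>k\<in>I. f k)" by auto
  then show ?case using insert.hyps
    by (auto simp: pos_op_def blinfun.add_left cinner_add_left cinner_add_right)
qed (simp_all add: pos_op_def)

text \<open>The root is self-adjoint with square \<open>a\<close>, so the absolute value and the
  root cancel and only the power \<open>p/2\<close> of \<open>a\<close> remains.\<close>

lemma schatten_norm_op_powr_half:
  assumes a: "pos_op a" "compact_op a"
  shows "schatten_norm p (op_powr a (1/2)) = enn2real (trace_powr a (p/2)) powr (1/p)"
  unfolding schatten_norm_def
  using op_powr_half_square[OF a] pos_op_adj[OF pos_op_powr[OF a, of "1/2"]] by simp

lemma column_norm_eq:
  assumes "\<And>k. k \<in> I \<Longrightarrow> complex_linear_op (x k) \<and> compact_op (x k)"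
    and "compact_op (\<Sum>k\<in>I. op_adj (x k) o\<^sub>L x k)"
  shows "column_norm p I x = enn2real (trace_powr (\<Sum>k\<in>I. op_adj (x k) o\<^sub>L x k) (p/2)) powr (1/p)"
proof -
  have "(\<Sum>k\<in>I. op_abs (x k) o\<^sub>L op_abs (x k)) = (\<Sum>k\<in>I. op_adj (x k) o\<^sub>L x k)"
    by (intro sum.cong refl op_abs_square) (use assms(1) in auto)
  then show ?thesis
    unfolding column_norm_def
    using assms by (simp add: schatten_norm_op_powr_half pos_op_sum)
qed

lemma row_norm_eq_column_norm_adj: "row_norm p I x = column_norm p I (\<lambda>k. op_adj (x k))"
  by (simp add: row_norm_def column_norm_def)

lemma compact_rank_one_ket: "compact_op (rank_one u (ket i))"
  by (rule compact_op_finite_columns[where F = "{i}"]) (auto simp: ell2_nth_ket)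

lemma compact_rank_one_finite:
  assumes "finite F" "\<And>i. i \<notin> F \<Longrightarrow> ell2_nth v i = 0"
  shows "compact_op (rank_one u v)"
proof (rule compact_op_finite_columns[OF _ assms(1)])
  fix i assume "i \<notin> F"
  then have "cinner v (ket i) = 0" using assms(2)[of i] cinner_commute[of v "ket i"] by simp
  then show "(rank_one u v) (ket i) = 0" by simp
qed simp

text \<open>All the products \<open>op_adj (x k) o\<^sub>L x k\<close> are multiples of the same
  rank-one projection, whose powers all have trace 1; hence the result does not depend on
  \<open>p\<close>.\<close>

lemma column_norm_rank_one:
  assumes p: "0 < p" and I: "finite I"
  shows "column_norm p I (\<lambda>k. rank_one (u k) (ket i)) = sqrt (\<Sum>k\<in>I. (norm (u k))\<^sup>2)"
proof -
  let ?c = "\<Sum>k\<in>I. (norm (u k))\<^sup>2" and ?P = "rank_one (ket i) (ket i)"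
  have c: "0 \<le> ?c" by (simp add: sum_nonneg)
  have s: "0 < p/2" using p by simp
  have "op_adj (rank_one (u k) (ket i)) o\<^sub>L rank_one (u k) (ket i) = (norm (u k))\<^sup>2 *\<^sub>R ?P" for k
    by (rule blinfun_eqI) (simp add: blinfun.scaleR_left cinner_self mult.commute scaleR_conv_of_real flip: cscale_of_real)
  then have A: "(\<Sum>k\<in>I. op_adj (rank_one (u k) (ket i)) o\<^sub>L rank_one (u k) (ket i)) = ?c *\<^sub>R ?P"
    by (simp add: scaleR_sum_left)
  have P: "pos_op ?P" "compact_op ?P"
  proof -
    have "?P = op_adj ?P o\<^sub>L ?P" by (rule blinfun_eqI) (simp add: ell2_nth_ket)
    then show "pos_op ?P" using pos_op_adj_compose[OF complex_linear_rank_one] by metis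
  qed (rule compact_rank_one_ket)
  have "?P (ket i) = 1 *\<^sub>R ket i" by (simp add: ell2_nth_ket)
  from op_powr_eigenvector[OF P less_imp_le[OF s] this]
  have "trace_powr ?P (p/2) = 1"
    by (subst pos_trace_finite_columns[OF P s, of "{i}"]) (auto simp: ell2_nth_ket)
  then have "trace_powr (?c *\<^sub>R ?P) (p/2) = ennreal (?c powr (p/2))"
    by (simp add: pos_trace_scaleR(3)[OF P s c])
  moreover have "compact_op (?c *\<^sub>R ?P)" by (rule pos_trace_scaleR(2)[OF P s c])
  moreover have "column_norm p I (\<lambda>k. rank_one (u k) (ket i)) = enn2real (trace_powr (?c *\<^sub>R ?P) (p/2)) powr (1/p)"
    unfolding A[symmetric]
    by (rule column_norm_eq) (use \<open>compact_op (?c *\<^sub>R ?P)\<close> in \<open>simp_all only: A complex_linear_rank_one compact_rank_one_ket simp_thms\<close>)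
  ultimately have "column_norm p I (\<lambda>k. rank_one (u k) (ket i)) = (?c powr (p/2)) powr (1/p)" by simp
  also have "\<dots> = sqrt ?c" using p c by (simp add: powr_powr powr_half_sqrt)
  finally show ?thesis .
qed

text \<open>For \<open>x k = rank_one (u k) e\<close> with a unit vector \<open>e\<close> this is the sum of the \<open>x k (x k)\<^sup>*\<close>.\<close>

definition gram :: "'k set \<Rightarrow> ('k \<Rightarrow> 'i ell2) \<Rightarrow> 'i op" where
  "gram I u = (\<Sum>k\<in>I. rank_one (u k) (u k))"

lemma gram_form: "qform (gram I u) v = (\<Sum>k\<in>I. (cmod (cinner (u k) v))\<^sup>2)"
proof -
  have "qform (rank_one (u k) (u k)) v = (cmod (cinner (u k) v))\<^sup>2" for k
  proof -
    have "cinner v ((rank_one (u k) (u k)) v) = of_real ((cmod (cinner (u k) v))\<^sup>2)"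
      unfolding complex_norm_square by (simp add: cinner_commute[of v])
    then show ?thesis by (simp del: of_real_power)
  qed
  then show ?thesis unfolding gram_def by (simp add: blinfun.sum_left cinner_sum_right del: rank_one_apply)
qed

lemma pos_op_rank_one: "pos_op (rank_one u u)"
proof -
  have "qform (rank_one u u) v = (cmod (cinner u v))\<^sup>2" for v
    using gram_form[of v "{()}" "\<lambda>_. u"] by (simp add: gram_def)
  then show ?thesis
    unfolding pos_op_def by (auto simp: cinner_commute[of _ u] simp del: rank_one_apply) (simp add: cinner_commute[of _ u])
qed

text \<open>A common finite support turns the Gram operators into finite matrices: they are compact,
  and their traces are finite sums over the \<open>ket i\<close> with
  \<open>i \<in> F\<close>.\<close>

locale finite_gram =
  fixes F :: "'i set" and u :: "nat \<Rightarrow> 'i ell2"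
  assumes F: "finite F" and supp: "\<And>k i. i \<notin> F \<Longrightarrow> ell2_nth (u k) i = 0"
begin

lemma pos_op_gram: "pos_op (gram I u)"
  unfolding gram_def by (intro pos_op_sum pos_op_rank_one)

lemma gram_ket: "i \<notin> F \<Longrightarrow> (gram I u) (ket i) = 0"
  using supp cinner_commute[of _ "ket i"] by (auto simp: gram_def blinfun.sum_left)

lemma compact_gram: "compact_op (gram I u)"
  by (rule compact_op_finite_columns[OF pos_op_complex_linear[OF pos_op_gram] F gram_ket])

lemma row_norm_rank_one:
  "row_norm p I (\<lambda>k. rank_one (u k) (ket j)) = enn2real (trace_powr (gram I u) (p/2)) powr (1/p)"
proof -
  have "rank_one (u k) (ket j) o\<^sub>L rank_one (ket j) (u k) = rank_one (u k) (u k)" for k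
    by (rule blinfun_eqI) (simp add: ell2_nth_ket)
  then have eq: "(\<Sum>k\<in>I. op_adj (rank_one (ket j) (u k)) o\<^sub>L rank_one (ket j) (u k)) = gram I u"
    by (simp add: gram_def)
  show ?thesis
    unfolding row_norm_eq_column_norm_adj op_adj_rank_one
    by (subst column_norm_eq) (use F supp in \<open>auto simp: eq[simplified] compact_gram intro: compact_rank_one_finite\<close>)
qed

lemma pos_trace_gram_finite: "0 < s \<Longrightarrow> trace_powr (gram I u) s < \<infinity>"
  by (subst pos_trace_finite_columns[OF pos_op_gram compact_gram _ F gram_ket]) auto

lemma pos_trace_gram: "trace_powr (gram I u) 1 = ennreal (\<Sum>k\<in>I. (norm (u k))\<^sup>2)"
proof -
  have "(norm (u k))\<^sup>2 = (\<Sum>i\<in>F. (cmod (ell2_nth (u k) i))\<^sup>2)" for k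
  proof -
    have "((\<lambda>i. (cmod (ell2_nth (u k) i))\<^sup>2) has_sum (norm (u k))\<^sup>2) F"
      using has_sum_norm_ell2[of "u k"] supp
      by (subst has_sum_cong_neutral[where T = UNIV and g = "\<lambda>i. (cmod (ell2_nth (u k) i))\<^sup>2"]) auto
    then show ?thesis using F has_sum_finite has_sum_unique by blast
  qed
  moreover have "qform (gram I u) (ket i) = (\<Sum>k\<in>I. (cmod (ell2_nth (u k) i))\<^sup>2)" for i
    unfolding gram_form using cinner_commute[of _ "ket i"] by simp
  ultimately show ?thesis
    using sum.swap[of "\<lambda>i k. (cmod (ell2_nth (u k) i))\<^sup>2" I F]
    by (subst pos_trace_finite_columns[OF pos_op_gram compact_gram _ F gram_ket])
       (simp_all add: op_powr_1[OF pos_op_gram compact_gram] del: cinner_ket_left)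
qed

lemma gram_mono:
  assumes "0 < s" "I \<subseteq> J" "finite J"
  shows "trace_powr (gram I u) s \<le> trace_powr (gram J u) s"
  by (rule pos_trace_powr_mono[OF pos_op_gram compact_gram pos_op_gram compact_gram assms(1)])
     (use assms in \<open>auto simp: gram_form intro!: sum_mono2\<close>)

context
  fixes I L
  assumes L: "\<And>v. (\<Sum>k\<in>I. (cmod (cinner (u k) v))\<^sup>2) \<le> L * (norm v)\<^sup>2"
begin

lemma gram_eigenvalue_le:
  assumes "eigenbasis (gram I u) E l" "e \<in> E" shows "l e \<le> L"
  using L[of e] eigenbasis_form[OF assms] eigenbasis_norm[OF assms] by (simp add: gram_form)

text \<open>Eigenvalues are at most \<open>L\<close>, so each \<open>l e powr s\<close> is at most
  \<open>L powr (s - 1)\<close> times \<open>l e\<close>, and the trace of the Gram operator itself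
  is the sum of the squared norms. For exponents below 1 the comparison reverses.\<close>

lemma pos_trace_gram_le:
  assumes s: "1 \<le> s"
  shows "trace_powr (gram I u) s \<le> ennreal (L powr (s - 1) * (\<Sum>k\<in>I. (norm (u k))\<^sup>2))"
proof -
  obtain E l where eb: "eigenbasis (gram I u) E l"
    using spectral_theorem[OF pos_op_gram compact_gram] by blast
  have "(\<Sum>\<^sub>\<infinity>e\<in>E. ennreal (l e powr s)) \<le> (\<Sum>\<^sub>\<infinity>e\<in>E. ennreal (L powr (s - 1)) * ennreal (l e powr 1))"
  proof (intro infsum_mono ennreal_summable)
    fix e assume e: "e \<in> E"
    have le: "0 \<le> l e" "l e \<le> L" using eigenbasis_ge_0[OF eb e] gram_eigenvalue_le[OF eb e] .
    have "l e powr s = l e powr (s - 1) * l e powr 1"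
      using powr_add[of "l e" "s - 1" 1] by (simp only: diff_add_cancel)
    also have "\<dots> \<le> L powr (s - 1) * l e powr 1" using le s by (intro mult_right_mono powr_mono2) auto
    finally show "ennreal (l e powr s) \<le> ennreal (L powr (s - 1)) * ennreal (l e powr 1)"
      by (simp add: ennreal_leI flip: ennreal_mult)
  qed
  also have "\<dots> = ennreal (L powr (s - 1)) * trace_powr (gram I u) 1"
    unfolding infsum_cmult_ennreal by (simp only: pos_trace_eigenbasis[OF eb pos_op_gram zero_le_one])
  finally show ?thesis
    using s by (simp add: pos_trace_eigenbasis[OF eb pos_op_gram] pos_trace_gram ennreal_mult sum_nonneg)
qed

lemma pos_trace_gram_ge:
  assumes s: "0 < s" "s \<le> 1" and L0: "0 < L"
  shows "ennreal (L powr (s - 1) * (\<Sum>k\<in>I. (norm (u k))\<^sup>2)) \<le> trace_powr (gram I u) s"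
proof -
  obtain E l where eb: "eigenbasis (gram I u) E l"
    using spectral_theorem[OF pos_op_gram compact_gram] by blast
  have "(\<Sum>\<^sub>\<infinity>e\<in>E. ennreal (L powr (s - 1)) * ennreal (l e powr 1)) \<le> (\<Sum>\<^sub>\<infinity>e\<in>E. ennreal (l e powr s))"
  proof (intro infsum_mono ennreal_summable)
    fix e assume e: "e \<in> E"
    have le: "0 \<le> l e" "l e \<le> L" using eigenbasis_ge_0[OF eb e] gram_eigenvalue_le[OF eb e] .
    have "L powr (s - 1) * l e powr 1 \<le> l e powr s"
    \<comment> \<open>A negative power is decreasing on positive arguments only; at 0 both sides
      vanish.\<close>
    proof (cases "l e = 0")
      case False
      then have "L powr (s - 1) * l e powr 1 \<le> l e powr (s - 1) * l e powr 1"
        using le s by (intro mult_right_mono powr_mono2') auto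
      then show ?thesis using powr_add[of "l e" "s - 1" 1] by (simp only: diff_add_cancel)
    qed simp
    then show "ennreal (L powr (s - 1)) * ennreal (l e powr 1) \<le> ennreal (l e powr s)"
      by (simp add: ennreal_leI flip: ennreal_mult)
  qed
  moreover have "(\<Sum>\<^sub>\<infinity>e\<in>E. ennreal (L powr (s - 1)) * ennreal (l e powr 1)) = ennreal (L powr (s - 1)) * trace_powr (gram I u) 1"
    unfolding infsum_cmult_ennreal by (simp only: pos_trace_eigenbasis[OF eb pos_op_gram zero_le_one])
  ultimately show ?thesis
    using s by (simp add: pos_trace_eigenbasis[OF eb pos_op_gram] pos_trace_gram ennreal_mult sum_nonneg)
qed

text \<open>Concavity bounds the trace by the powers of the diagonal entries, each at most
  \<open>L\<close>. For \<open>p < 2\<close> this serves to keep the partial norms bounded, so that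
  their limit exists.\<close>

lemma pos_trace_gram_le_card:
  assumes s: "0 < s" "s \<le> 1"
  shows "trace_powr (gram I u) s \<le> ennreal (card F * L powr s)"
proof -
  have "qform (op_powr (gram I u) s) (ket i) \<le> L powr s" for i
  proof -
    have "qform (op_powr (gram I u) s) (ket i) \<le> qform (gram I u) (ket i) powr s"
      by (rule jensen_form_le[OF pos_op_gram compact_gram s]) simp
    also have "\<dots> \<le> L powr s"
      using L[of "ket i"] s by (intro powr_mono2 pos_op_ge_0[OF pos_op_gram]) (auto simp: gram_form simp del: cinner_ket_left)
    finally show ?thesis .
  qed
  then have "(\<Sum>i\<in>F. qform (op_powr (gram I u) s) (ket i)) \<le> card F * L powr s"
    by (rule sum_bounded_above)
  then show ?thesis
    using s by (subst pos_trace_finite_columns[OF pos_op_gram compact_gram _ F gram_ket]) (auto intro: ennreal_leI)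
qed

end

end

section \<open>The test operators\<close>

text \<open>The \<open>k\<close>-th entry of the square function at the vector of ones, up to the
  rank-one partner. At \<open>k = 0\<close>, where \<open>k - 1\<close> is truncated, the factor
  \<open>sqrt k\<close> annihilates the term.\<close>

definition orbit :: "nat \<Rightarrow> nat \<Rightarrow> nat ell2" where
  "orbit n k = (\<Sum>i<n. cscale (of_real (sqrt k * weight i ^ (k - 1) * (1 - weight i))) (ket i))"

lemma orbit_nth: "ell2_nth (orbit n k) i = (if i < n then of_real (sqrt k * weight i ^ (k - 1) * (1 - weight i)) else 0)"
  by (simp add: orbit_def ell2_nth_sum ell2_nth_ket if_distrib cong: if_cong)

interpretation orbit: finite_gram "{..<n}" "orbit n"
  by unfold_locales (auto simp: orbit_nth)

lemma norm_orbit_sq: "(norm (orbit n k))\<^sup>2 = (\<Sum>i<n. k * (weight i ^ (k - 1) * (1 - weight i))\<^sup>2)"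
proof -
  have "(norm (orbit n k))\<^sup>2 = (\<Sum>i<n. (cmod (of_real (sqrt k * weight i ^ (k - 1) * (1 - weight i))))\<^sup>2)"
    unfolding orbit_def by (rule norm_sum_orthonormal[OF onb_orthonormal[OF onb_ket]]) auto
  also have "\<dots> = (\<Sum>i<n. k * (weight i ^ (k - 1) * (1 - weight i))\<^sup>2)"
    by (intro sum.cong refl) (simp add: power_mult_distrib mult.assoc del: of_real_mult of_real_power)
  finally show ?thesis .
qed

text \<open>The full square sum of the orbit: for a single weight \<open>a\<close>, summing
  \<open>k * a ^ (2 * (k - 1))\<close> gives \<open>1 / (1 - a\<^sup>2)\<^sup>2\<close>, and the
  factor \<open>(1 - a)\<^sup>2\<close> reduces this to \<open>1 / (1 + a)\<^sup>2\<close>, a number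
  between 1/4 and 1.\<close>

definition orbit_const :: "nat \<Rightarrow> real" where
  "orbit_const n = (\<Sum>i<n. 1 / (1 + weight i)\<^sup>2)"

lemma sums_linear_geometric:
  fixes q :: real assumes "0 \<le> q" "q < 1"
  shows "(\<lambda>k. real k * q ^ (k - 1)) sums (1 / (1 - q)\<^sup>2)"
proof -
  have "(\<lambda>k. real (Suc k) * q ^ (Suc k - 1)) sums (1 / (1 - q)\<^sup>2)"
    using geometric_deriv_sums[of q] assms by simp
  then show ?thesis using sums_Suc_iff[of "\<lambda>k. real k * q ^ (k - 1)"] by simp
qed

lemma sum_linear_geometric_le:
  fixes q :: real assumes "0 \<le> q" "q < 1" "finite I"
  shows "(\<Sum>k\<in>I. real k * q ^ (k - 1)) \<le> 1 / (1 - q)\<^sup>2"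
  using sum_le_suminf[OF sums_summable[OF sums_linear_geometric[OF assms(1,2)]] assms(3)] assms
    sums_unique[OF sums_linear_geometric[OF assms(1,2)]] by simp

lemma orbit_tendsto: "(\<lambda>N. \<Sum>k\<in>{1..N}. (norm (orbit n k))\<^sup>2) \<longlonglongrightarrow> orbit_const n"
proof -
  have one: "(\<lambda>N. \<Sum>k\<in>{1..N}. k * (weight i ^ (k - 1) * (1 - weight i))\<^sup>2) \<longlonglongrightarrow> 1 / (1 + weight i)\<^sup>2" for i
  proof -
    let ?q = "(weight i)\<^sup>2"
    have q: "0 \<le> ?q" "?q < 1" using weight_bounds[of i] by (simp_all add: power_less_one_iff)
    have "(\<lambda>N. \<Sum>k<Suc N. real k * ?q ^ (k - 1)) \<longlonglongrightarrow> 1 / (1 - ?q)\<^sup>2"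
      using sums_linear_geometric[OF q] unfolding sums_def by (rule LIMSEQ_Suc)
    then have "(\<lambda>N. (1 - weight i)\<^sup>2 * (\<Sum>k<Suc N. real k * ?q ^ (k - 1))) \<longlonglongrightarrow> (1 - weight i)\<^sup>2 * (1 / (1 - ?q)\<^sup>2)"
      by (intro tendsto_intros)
    moreover have "(1 - weight i)\<^sup>2 * (\<Sum>k<Suc N. real k * ?q ^ (k - 1)) = (\<Sum>k\<in>{1..N}. k * (weight i ^ (k - 1) * (1 - weight i))\<^sup>2)" for N
    proof -
      have "(\<Sum>k<Suc N. real k * ?q ^ (k - 1)) = (\<Sum>k\<in>{1..N}. real k * ?q ^ (k - 1))"
        by (rule sum.mono_neutral_right) (auto simp: not_le)
      then show ?thesis
        by (simp add: sum_distrib_left power_mult_distrib mult_ac flip: power_mult)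
    qed
    moreover have "(1 - weight i)\<^sup>2 * (1 / (1 - ?q)\<^sup>2) = 1 / (1 + weight i)\<^sup>2"
    proof -
      have "1 - ?q = (1 - weight i) * (1 + weight i)" by (simp add: power2_eq_square algebra_simps)
      then show ?thesis using weight_bounds[of i] by (simp add: power_mult_distrib)
    qed
    ultimately show ?thesis by simp
  qed
  have "(\<lambda>N. \<Sum>i<n. \<Sum>k\<in>{1..N}. k * (weight i ^ (k - 1) * (1 - weight i))\<^sup>2) \<longlonglongrightarrow> orbit_const n"
    unfolding orbit_const_def by (intro tendsto_sum one)
  moreover have "(\<Sum>k\<in>{1..N}. (norm (orbit n k))\<^sup>2) = (\<Sum>i<n. \<Sum>k\<in>{1..N}. k * (weight i ^ (k - 1) * (1 - weight i))\<^sup>2)" for N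
    unfolding norm_orbit_sq by (rule sum.swap)
  ultimately show ?thesis by (simp only:)
qed

lemma orbit_const_ge: "real n / 4 \<le> orbit_const n"
proof -
  have "1 / 4 \<le> 1 / (1 + weight i)\<^sup>2" for i
  proof -
    have "(1 + weight i)\<^sup>2 \<le> 2\<^sup>2" using weight_bounds[of i] by (intro power_mono) auto
    moreover have "0 < (1 + weight i)\<^sup>2" using weight_bounds[of i] by simp
    ultimately show ?thesis by (simp add: divide_simps)
  qed
  then have "(\<Sum>i<n. 1 / 4) \<le> orbit_const n" unfolding orbit_const_def by (intro sum_mono)
  then show ?thesis by simp
qed

lemma orbit_sum_le: "finite I \<Longrightarrow> (\<Sum>k\<in>I. (norm (orbit n k))\<^sup>2) \<le> orbit_const n"
proof -
  assume I: "finite I"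
  have "incseq (\<lambda>N. \<Sum>k\<in>{1..N}. (norm (orbit n k))\<^sup>2)"
    by (rule incseq_SucI) simp
  from incseq_le[OF this orbit_tendsto]
  have le: "(\<Sum>k\<in>{1..N}. (norm (orbit n k))\<^sup>2) \<le> orbit_const n" for N .
  \<comment> \<open>The set \<open>I\<close> may contain 0, where the orbit vanishes.\<close>
  have "(\<Sum>k\<in>I. (norm (orbit n k))\<^sup>2) = (\<Sum>k\<in>I - {0}. (norm (orbit n k))\<^sup>2)"
    by (rule sum.mono_neutral_right) (use I in \<open>auto simp: norm_orbit_sq simp flip: power2_eq_square\<close>)
  also have "\<dots> \<le> (\<Sum>k\<in>{1..Max (insert 0 I)}. (norm (orbit n k))\<^sup>2)"
    by (rule sum_mono2) (use I in auto)
  finally show ?thesis using le order.trans by blast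
qed

section \<open>A bound for the Gram matrices that is uniform in their size\<close>

lemma sum_half_power_inj_le:
  assumes "finite A" "inj_on f A"
  shows "(\<Sum>j\<in>A. (1/2::real) ^ f j) \<le> 2"
proof -
  have g: "(\<lambda>m. (1/2::real) ^ m) sums 2" using geometric_sums[of "1/2::real"] by simp
  have "(\<Sum>j\<in>A. (1/2::real) ^ f j) = (\<Sum>m\<in>f ` A. (1/2) ^ m)" by (simp add: sum.reindex[OF assms(2)])
  also have "\<dots> \<le> (\<Sum>m. (1/2) ^ m)" by (rule sum_le_suminf) (use assms g sums_summable in auto)
  also have "\<dots> = 2" using sums_unique[OF g] by simp
  finally show ?thesis .
qed

definition nat_gap :: "nat \<Rightarrow> nat \<Rightarrow> nat" where
  "nat_gap i j = (if i \<le> j then j - i else i - j)"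

lemma nat_gap_commute: "nat_gap i j = nat_gap j i"
  by (auto simp: nat_gap_def)

text \<open>On each side of \<open>i\<close> every distance occurs at most once, so each side
  contributes at most the geometric sum 2.\<close>

lemma sum_half_power_gap_le: "(\<Sum>j<n. (1/2::real) ^ nat_gap i j) \<le> 4"
proof -
  have "(\<Sum>j<n. (1/2::real) ^ nat_gap i j) = (\<Sum>j\<in>{..<n} \<inter> {j. i \<le> j}. (1/2::real) ^ nat_gap i j) + (\<Sum>j\<in>{..<n} \<inter> {j. \<not> i \<le> j}. (1/2::real) ^ nat_gap i j)"
    by (subst sum.union_disjoint[symmetric]) (auto intro!: sum.cong)
  also have "\<dots> \<le> 2 + 2"
    by (intro add_mono sum_half_power_inj_le) (auto simp: inj_on_def nat_gap_def)
  finally show ?thesis by simp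
qed

text \<open>The choice \<^term>\<open>1 - weight i = 1 / 2 ^ (i + 1)\<close> makes this kernel decay geometrically off the
  diagonal, so that its matrices are bounded uniformly in their size.\<close>

lemma weight_kernel_le: "(1 - weight i) * (1 - weight j) / (1 - weight i * weight j)\<^sup>2 \<le> (1/2) ^ nat_gap i j"
proof -
  have main: "(1 - weight i) * (1 - weight j) / (1 - weight i * weight j)\<^sup>2 \<le> (1/2) ^ (j - i)" if "i \<le> j" for i j
  proof -
    have e: "1 - weight i > 0" "1 - weight j > 0" using weight_bounds[of i] weight_bounds[of j] by auto
    \<comment> \<open>For \<open>i \<le> j\<close> the denominator is bounded below by
      \<open>(1 - weight i)\<^sup>2\<close>, which leaves the quotient of the two gaps, a power of
      1/2.\<close>
    have "weight i * weight j \<le> weight i * 1" using weight_bounds[of i] weight_bounds[of j] by (intro mult_left_mono) auto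
    then have d: "1 - weight i \<le> 1 - weight i * weight j" by simp
    have "(1 - weight i) * (1 - weight j) / (1 - weight i * weight j)\<^sup>2 \<le> (1 - weight i) * (1 - weight j) / (1 - weight i)\<^sup>2"
      using e d by (intro divide_left_mono power_mono mult_pos_pos zero_less_power) auto
    also have "\<dots> = (1 - weight j) / (1 - weight i)" using e by (simp add: power2_eq_square)
    also have "\<dots> = (1/2) ^ (j - i)"
      using that by (simp add: weight_def power_divide power_diff)
    finally show ?thesis .
  qed
  show ?thesis
    using main[of i j] main[of j i] by (cases "i \<le> j") (auto simp: nat_gap_def mult.commute)
qed

text \<open>Schur's test: summation over \<open>k\<close> produces the kernel bounded by
  \<open>(1/2) ^ nat_gap i j\<close>, a product \<open>x i * x j\<close> is at most the mean of the
  squares, and the row sums of this symmetric kernel are at most 4.\<close>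

lemma orbit_form_le:
  assumes I: "finite I"
  shows "(\<Sum>k\<in>I. (cmod (cinner (orbit n k) v))\<^sup>2) \<le> 4 * (norm v)\<^sup>2"
proof -
  define x where "x i = cmod (ell2_nth v i)" for i
  define c where "c k i = sqrt (real k) * weight i ^ (k - 1) * (1 - weight i)" for k i
  have c0: "0 \<le> c k i" for k i using weight_bounds[of i] by (simp add: c_def)
  have 1: "cmod (cinner (orbit n k) v) \<le> (\<Sum>i<n. c k i * x i)" for k
  proof -
    have "cinner (orbit n k) v = (\<Sum>i<n. of_real (c k i) * ell2_nth v i)"
      by (simp add: orbit_def cinner_sum_left c_def)
    also have "cmod \<dots> \<le> (\<Sum>i<n. cmod (of_real (c k i) * ell2_nth v i))" by (rule norm_sum)
    also have "\<dots> = (\<Sum>i<n. c k i * x i)" using c0 by (simp add: norm_mult x_def)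
    finally show ?thesis .
  qed
  have ker: "(\<Sum>k\<in>I. c k i * c k j) \<le> (1/2) ^ nat_gap i j" for i j
  proof -
    let ?q = "weight i * weight j"
    have q: "0 \<le> ?q" "?q < 1"
      using weight_bounds[of i] weight_bounds[of j] mult_strict_mono[of "weight i" 1 "weight j" 1] by auto
    have "c k i * c k j = (1 - weight i) * (1 - weight j) * (real k * ?q ^ (k - 1))" for k
    proof -
      have "c k i * c k j = (sqrt (real k) * sqrt (real k)) * (weight i ^ (k - 1) * weight j ^ (k - 1)) * ((1 - weight i) * (1 - weight j))"
        by (simp only: c_def mult_ac)
      also have "\<dots> = (1 - weight i) * (1 - weight j) * (real k * ?q ^ (k - 1))"
        by (simp add: power_mult_distrib mult_ac)
      finally show ?thesis .
    qed
    then have "(\<Sum>k\<in>I. c k i * c k j) = (1 - weight i) * (1 - weight j) * (\<Sum>k\<in>I. real k * ?q ^ (k - 1))"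
      by (simp add: sum_distrib_left)
    also have "\<dots> \<le> (1 - weight i) * (1 - weight j) * (1 / (1 - ?q)\<^sup>2)"
      using weight_bounds[of i] weight_bounds[of j] by (intro mult_left_mono sum_linear_geometric_le q I) auto
    also have "\<dots> \<le> (1/2) ^ nat_gap i j" using weight_kernel_le[of i j] by simp
    finally show ?thesis .
  qed
  have "(\<Sum>k\<in>I. (cmod (cinner (orbit n k) v))\<^sup>2) \<le> (\<Sum>k\<in>I. (\<Sum>i<n. c k i * x i)\<^sup>2)"
    by (intro sum_mono power_mono 1) simp
  also have "\<dots> = (\<Sum>k\<in>I. \<Sum>i<n. \<Sum>j<n. (c k i * c k j) * (x i * x j))"
    unfolding power2_eq_square sum_product by (simp add: mult_ac)
  also have "\<dots> = (\<Sum>i<n. \<Sum>j<n. (\<Sum>k\<in>I. c k i * c k j) * (x i * x j))"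
    unfolding sum_distrib_right by (subst sum.swap, rule sum.cong[OF refl], subst sum.swap, rule refl)
  also have "\<dots> \<le> (\<Sum>i<n. \<Sum>j<n. (1/2) ^ nat_gap i j * (((x i)\<^sup>2 + (x j)\<^sup>2) / 2))"
  proof (intro sum_mono)
    fix i j
    have "x i * x j \<le> ((x i)\<^sup>2 + (x j)\<^sup>2) / 2" using sum_squares_bound[of "x i" "x j"] by simp
    moreover have "0 \<le> x i * x j" by (simp add: x_def)
    ultimately show "(\<Sum>k\<in>I. c k i * c k j) * (x i * x j) \<le> (1/2) ^ nat_gap i j * (((x i)\<^sup>2 + (x j)\<^sup>2) / 2)"
      using ker[of i j] by (intro mult_mono) auto
  qed
  also have "\<dots> = (\<Sum>i<n. \<Sum>j<n. (1/2) ^ nat_gap i j * ((x i)\<^sup>2 / 2)) + (\<Sum>i<n. \<Sum>j<n. (1/2) ^ nat_gap i j * ((x j)\<^sup>2 / 2))"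
    by (simp add: add_divide_distrib distrib_left sum.distrib)
  also have "(\<Sum>i<n. \<Sum>j<n. (1/2) ^ nat_gap i j * ((x j)\<^sup>2 / 2)) = (\<Sum>i<n. \<Sum>j<n. (1/2) ^ nat_gap i j * ((x i)\<^sup>2 / 2))"
    by (subst sum.swap) (simp only: nat_gap_commute)
  also have "(\<Sum>i<n. \<Sum>j<n. (1/2) ^ nat_gap i j * ((x i)\<^sup>2 / 2)) + (\<Sum>i<n. \<Sum>j<n. (1/2) ^ nat_gap i j * ((x i)\<^sup>2 / 2))
      = (\<Sum>i<n. (\<Sum>j<n. (1/2) ^ nat_gap i j) * (x i)\<^sup>2)"
    by (simp add: sum_distrib_left mult.commute flip: sum.distrib)
  also have "\<dots> \<le> (\<Sum>i<n. 4 * (x i)\<^sup>2)"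
    by (intro sum_mono mult_right_mono sum_half_power_gap_le) simp
  also have "\<dots> \<le> 4 * (norm v)\<^sup>2"
    unfolding sum_distrib_left[symmetric] x_def
    using finite_sum_le_has_sum[OF has_sum_norm_ell2[of v], of "{..<n}"] by simp
  finally show ?thesis .
qed

section \<open>Square functions of the test operators\<close>

definition ones :: "nat \<Rightarrow> nat ell2" where
  "ones n = (\<Sum>i<n. ket i)"

definition test_op :: "bool \<Rightarrow> nat \<Rightarrow> nat op" where
  "test_op d n = (if d then rank_one (ones n) (ket 0) else rank_one (ket 0) (ones n))"

definition orbit_op :: "bool \<Rightarrow> nat \<Rightarrow> nat \<Rightarrow> nat op" where
  "orbit_op d n k = (if d then rank_one (orbit n k) (ket 0) else rank_one (ket 0) (orbit n k))"

lemma square_seq_test_op: "square_seq (ritt_mult d) (test_op d n) = orbit_op d n"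
proof
  fix k
  define g where "g i = complex_of_real (weight i ^ (k - 1) * (1 - weight i))" for i
  let ?wk = "\<lambda>i. complex_of_real (weight i) ^ (k - 1)" and ?w1 = "\<lambda>i. 1 - complex_of_real (weight i)"
  have w1: "cmod (?w1 i) \<le> 2" for i
    using norm_triangle_ineq4[of 1 "complex_of_real (weight i)"] cmod_weight_le[of i] by simp
  have gb: "cmod (g i) \<le> 1 * 2" for i
  proof -
    have "cmod (g i) = cmod (?wk i) * cmod (?w1 i)" by (simp add: g_def flip: norm_mult)
    also have "\<dots> \<le> 1 * 2" by (intro mult_mono cmod_weight_powr_le w1) auto
    finally show ?thesis .
  qed
  have "test_op d n - ritt_mult d (test_op d n) = mult_by d (multiplier (\<lambda>i. 1) - multiplier (\<lambda>i. of_real (weight i))) (test_op d n)"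
    by (simp add: mult_by_diff_left multiplier_1 ritt_mult_def)
  also have "\<dots> = mult_by d (multiplier ?w1) (test_op d n)"
    by (subst multiplier_diff[where K = 1 and L = 1]) (simp_all add: weight_bounds)
  finally have "(ritt_mult d ^^ (k - 1)) (test_op d n - ritt_mult d (test_op d n)) = mult_by d (multiplier (\<lambda>i. ?wk i * ?w1 i)) (test_op d n)"
    unfolding ritt_mult_funpow
    by (simp only: mult_by_mult_by_multiplier[where g = ?wk and h = ?w1, OF cmod_weight_powr_le w1])
  also have "(\<lambda>i. ?wk i * ?w1 i) = g" by (simp add: g_def fun_eq_iff)
  finally have sq: "square_seq (ritt_mult d) (test_op d n) k = sqrt k *\<^sub>R mult_by d (multiplier g) (test_op d n)"
    by (simp add: square_seq_def powr_half_sqrt)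
  note mn = multiplier_nth[where g = g, OF gb]
  show "square_seq (ritt_mult d) (test_op d n) k = orbit_op d n k"
  proof (cases d)
    case True
    have "sqrt k *\<^sub>R (multiplier g) (ones n) = orbit n k"
      by (rule ell2_eqI) (simp add: mn orbit_nth ones_def ell2_nth_sum ell2_nth_ket g_def)
    then have "(sqrt k *\<^sub>R mult_by d (multiplier g) (test_op d n)) v = (orbit_op d n k) v" for v
      using True complex_linear_opD[OF multiplier_complex_linear[where g = g, OF gb]]
      by (simp add: orbit_op_def mult_by_def test_op_def blinfun.scaleR_left flip: cscale_scaleR)
    then show ?thesis unfolding sq by (rule blinfun_eqI)
  next
    case False
    \<comment> \<open>Moving the multiplier to the first, conjugate-linear argument leaves it
      unchanged because its entries are real.\<close>
    have "of_real (sqrt k) * cinner (ones n) ((multiplier g) v) = cinner (orbit n k) v" for v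
      by (simp add: ones_def orbit_def cinner_sum_left mn g_def sum_distrib_left mult_ac)
    then have "(sqrt k *\<^sub>R mult_by d (multiplier g) (test_op d n)) v = (orbit_op d n k) v" for v
      using False by (simp add: orbit_op_def mult_by_def test_op_def blinfun.scaleR_left flip: cscale_of_real)
    then show ?thesis unfolding sq by (rule blinfun_eqI)
  qed
qed

lemma finite_support_schatten:
  fixes v :: "nat ell2"
  assumes "0 < p" "\<And>i. i \<ge> n \<Longrightarrow> ell2_nth v i = 0"
  shows "rank_one u v \<in> schatten p"
proof (rule schatten_finite_columns[OF assms(1) complex_linear_rank_one finite_lessThan])
  fix i assume "i \<notin> {..<n}"
  then have "cinner v (ket i) = 0" using assms(2)[of i] cinner_commute[of v "ket i"] by simp
  then show "(rank_one u v) (ket i) = 0" by simp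
qed

lemma test_op_schatten: "0 < p \<Longrightarrow> test_op d n \<in> schatten p"
  unfolding test_op_def
  by (auto intro!: schatten_rank_one_ket finite_support_schatten[where n = n] simp: ones_def ell2_nth_sum ell2_nth_ket)

lemma orbit_op_schatten: "0 < p \<Longrightarrow> orbit_op d n k \<in> schatten p"
  unfolding orbit_op_def
  by (auto intro!: schatten_rank_one_ket finite_support_schatten[where n = n] simp: orbit_nth)

text \<open>On \<open>orbit_op d n\<close> the norm selected by \<open>d\<close> is Hilbertian, while the other one is given by
  the Gram matrix of the vectors \<open>orbit n k\<close>.\<close>

definition flat_norm :: "bool \<Rightarrow> real \<Rightarrow> nat set \<Rightarrow> (nat \<Rightarrow> nat op) \<Rightarrow> real" where
  "flat_norm d = (if d then column_norm else row_norm)"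

lemma flat_norm_orbit_op:
  assumes "0 < p" "finite I"
  shows "flat_norm d p I (orbit_op d n) = sqrt (\<Sum>k\<in>I. (norm (orbit n k))\<^sup>2)"
  using column_norm_rank_one[OF assms, of "orbit n" 0]
  by (simp add: flat_norm_def orbit_op_def[abs_def] row_norm_eq_column_norm_adj)

lemma gram_norm_orbit_op:
  "flat_norm (\<not> d) p I (orbit_op d n) = enn2real (trace_powr (gram I (orbit n)) (p/2)) powr (1/p)"
  using orbit.row_norm_rank_one[of p I n 0]
  by (simp add: flat_norm_def orbit_op_def[abs_def] row_norm_eq_column_norm_adj)

lemma orbit_tail_small:
  assumes "0 < r"
  shows "\<exists>M. \<forall>m\<ge>M. \<forall>N\<ge>m. sqrt (\<Sum>k\<in>{m<..N}. (norm (orbit n k))\<^sup>2) < r"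
proof -
  let ?S = "\<lambda>N. \<Sum>k\<in>{1..N}. (norm (orbit n k))\<^sup>2"
  have "\<forall>\<^sub>F N in sequentially. orbit_const n - r\<^sup>2 < ?S N"
    using assms by (intro order_tendstoD(1)[OF orbit_tendsto]) simp
  then obtain M where M: "\<And>N. N \<ge> M \<Longrightarrow> orbit_const n - r\<^sup>2 < ?S N"
    unfolding eventually_sequentially by blast
  have "sqrt (\<Sum>k\<in>{m<..N}. (norm (orbit n k))\<^sup>2) < r" if "m \<ge> M" "N \<ge> m" for m N
  proof -
    have "?S N = ?S m + (\<Sum>k\<in>{m<..N}. (norm (orbit n k))\<^sup>2)"
      using that by (subst sum.union_disjoint[symmetric]) (auto intro!: sum.cong)
    moreover have "?S N \<le> orbit_const n" by (rule orbit_sum_le) simp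
    ultimately have "(\<Sum>k\<in>{m<..N}. (norm (orbit n k))\<^sup>2) < r\<^sup>2" using M[OF that(1)] by linarith
    then have "sqrt (\<Sum>k\<in>{m<..N}. (norm (orbit n k))\<^sup>2) < sqrt (r\<^sup>2)" by (rule real_sqrt_less_mono)
    then show ?thesis using assms by simp
  qed
  then show ?thesis by blast
qed

lemma flat_seq_norm:
  assumes p: "0 < p"
  shows "orbit_op d n \<in> seq_space p (flat_norm d p)" "seq_norm (flat_norm d p) (orbit_op d n) = sqrt (orbit_const n)"
proof -
  show "orbit_op d n \<in> seq_space p (flat_norm d p)"
    using orbit_op_schatten[OF p] orbit_tail_small by (simp add: seq_space_def flat_norm_orbit_op[OF p])
  have "(\<lambda>N. sqrt (\<Sum>k\<in>{1..N}. (norm (orbit n k))\<^sup>2)) \<longlonglongrightarrow> sqrt (orbit_const n)"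
    by (intro tendsto_real_sqrt orbit_tendsto)
  then show "seq_norm (flat_norm d p) (orbit_op d n) = sqrt (orbit_const n)"
    unfolding seq_norm_def by (simp add: flat_norm_orbit_op[OF p] limI)
qed

text \<open>The trace estimate with \<open>L = 4\<close>, converted to a norm. The same number is an
  upper bound for \<open>p > 2\<close> and a lower bound for \<open>p < 2\<close>.\<close>

definition gram_bound :: "real \<Rightarrow> nat \<Rightarrow> real" where
  "gram_bound p n = (4 powr (p/2 - 1) * orbit_const n) powr (1/p)"

lemma pos_trace_gram_orbit:
  assumes "0 < p"
  shows "ennreal (enn2real (trace_powr (gram I (orbit n)) (p/2))) = trace_powr (gram I (orbit n)) (p/2)"
  using orbit.pos_trace_gram_finite[of "p/2" I n] assms by simp

text \<open>\<open>seq_norm\<close> is defined by \<open>lim\<close>, which says something only once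
  a limit is known to exist. Here it does because the traces increase with the index set and are
  bounded.\<close>

lemma gram_norm_convergent:
  assumes p: "0 < p" and bdd: "\<And>N. trace_powr (gram {1..N} (orbit n)) (p/2) \<le> ennreal B"
  shows "(\<lambda>N. flat_norm (\<not> d) p {1..N} (orbit_op d n)) \<longlonglongrightarrow> seq_norm (flat_norm (\<not> d) p) (orbit_op d n)"
proof -
  define t where "t N = enn2real (trace_powr (gram {1..N} (orbit n)) (p/2))" for N
  have t: "ennreal (t N) = trace_powr (gram {1..N} (orbit n)) (p/2)" for N
    unfolding t_def by (rule pos_trace_gram_orbit[OF p])
  have t0: "0 \<le> t N" for N by (simp add: t_def)
  have "incseq t"
  proof (rule incseq_SucI)
    fix N
    have "ennreal (t N) \<le> ennreal (t (Suc N))"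
      unfolding t using p by (intro orbit.gram_mono) auto
    then show "t N \<le> t (Suc N)" by (simp add: t_def)
  qed
  moreover have "t N \<le> max B 0" for N
  proof -
    have "ennreal (t N) \<le> ennreal (max B 0)" using order.trans[OF bdd[of N] ennreal_leI[of B "max B 0"]] by (simp only: t)
    then show ?thesis by simp
  qed
  ultimately obtain L where "t \<longlonglongrightarrow> L" using incseq_convergent by blast
  then have "(\<lambda>N. t N powr (1/p)) \<longlonglongrightarrow> L powr (1/p)"
    using p t0 by (intro tendsto_powr') auto
  then have "(\<lambda>N. flat_norm (\<not> d) p {1..N} (orbit_op d n)) \<longlonglongrightarrow> L powr (1/p)"
    by (simp add: gram_norm_orbit_op t_def)
  then show ?thesis unfolding seq_norm_def by (simp add: limI)
qed

lemma gram_seq_norm_le: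
  assumes p: "2 < p"
  shows "orbit_op d n \<in> seq_space p (flat_norm (\<not> d) p)" "seq_norm (flat_norm (\<not> d) p) (orbit_op d n) \<le> gram_bound p n"
proof -
  have s: "1 \<le> p/2" "0 < p" using p by auto
  have le: "enn2real (trace_powr (gram I (orbit n)) (p/2)) \<le> L powr (p/2 - 1) * (\<Sum>k\<in>I. (norm (orbit n k))\<^sup>2)"
    if "\<And>v. (\<Sum>k\<in>I. (cmod (cinner (orbit n k) v))\<^sup>2) \<le> L * (norm v)\<^sup>2" for I L
    using orbit.pos_trace_gram_le[OF that s(1)]
    by (metis enn2real_mono enn2real_ennreal ennreal_less_top mult_nonneg_nonneg powr_ge_zero sum_nonneg zero_le_power2)
  \<comment> \<open>By Cauchy-Schwarz the sum of the squared norms is itself an admissible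
    \<open>L\<close>. With this choice the Gram norm is dominated by the Hilbertian one, and
    membership in the sequence space follows from its small tails.\<close>
  have small: "flat_norm (\<not> d) p I (orbit_op d n) \<le> sqrt (\<Sum>k\<in>I. (norm (orbit n k))\<^sup>2)" if "finite I" for I
  proof -
    define c where "c = (\<Sum>k\<in>I. (norm (orbit n k))\<^sup>2)"
    have c: "0 \<le> c" by (simp add: c_def sum_nonneg)
    have "(\<Sum>k\<in>I. (cmod (cinner (orbit n k) v))\<^sup>2) \<le> c * (norm v)\<^sup>2" for v
      unfolding c_def sum_distrib_right power_mult_distrib[symmetric]
      by (intro sum_mono power_mono cmod_cinner_le) simp
    from le[OF this] have "enn2real (trace_powr (gram I (orbit n)) (p/2)) \<le> c powr (p/2 - 1) * c"
      by (simp add: c_def)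
    also have "\<dots> = c powr (p/2)" using c powr_mult_base[of c "p/2 - 1"] by (simp add: mult.commute)
    finally have "flat_norm (\<not> d) p I (orbit_op d n) \<le> (c powr (p/2)) powr (1/p)"
      unfolding gram_norm_orbit_op using s by (intro powr_mono2) auto
    also have "\<dots> = sqrt c" using c s by (simp add: powr_powr powr_half_sqrt)
    finally show ?thesis by (simp add: c_def)
  qed
  show "orbit_op d n \<in> seq_space p (flat_norm (\<not> d) p)"
    unfolding seq_space_def
  proof (intro CollectI conjI allI impI)
    fix r :: real assume "0 < r"
    then show "\<exists>M. \<forall>m\<ge>M. \<forall>N\<ge>m. flat_norm (\<not> d) p {m<..N} (orbit_op d n) < r"
      using orbit_tail_small[of r n] small by (meson finite_greaterThanAtMost le_less_trans)
  qed (rule orbit_op_schatten[OF s(2)])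
  \<comment> \<open>For the size of the norm the bound 4, uniform in \<open>n\<close>, is used
    instead.\<close>
  have le4: "enn2real (trace_powr (gram {1..N} (orbit n)) (p/2)) \<le> 4 powr (p/2 - 1) * orbit_const n" for N
  proof -
    have "enn2real (trace_powr (gram {1..N} (orbit n)) (p/2)) \<le> 4 powr (p/2 - 1) * (\<Sum>k\<in>{1..N}. (norm (orbit n k))\<^sup>2)"
      by (rule le[OF orbit_form_le]) simp
    also have "\<dots> \<le> 4 powr (p/2 - 1) * orbit_const n" by (intro mult_left_mono orbit_sum_le) auto
    finally show ?thesis .
  qed
  have "(\<lambda>N. flat_norm (\<not> d) p {1..N} (orbit_op d n)) \<longlonglongrightarrow> seq_norm (flat_norm (\<not> d) p) (orbit_op d n)"
    by (rule gram_norm_convergent[OF s(2)]) (subst pos_trace_gram_orbit[OF s(2), symmetric], rule ennreal_leI[OF le4])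
  then show "seq_norm (flat_norm (\<not> d) p) (orbit_op d n) \<le> gram_bound p n"
  proof (rule LIMSEQ_le_const2)
    show "\<exists>M. \<forall>N\<ge>M. flat_norm (\<not> d) p {1..N} (orbit_op d n) \<le> gram_bound p n"
      unfolding gram_norm_orbit_op gram_bound_def using s le4 by (auto intro!: powr_mono2)
  qed
qed

lemma gram_seq_norm_ge:
  assumes p: "0 < p" "p < 2"
  shows "gram_bound p n \<le> seq_norm (flat_norm (\<not> d) p) (orbit_op d n)"
proof -
  have s: "0 < p/2" "p/2 \<le> 1" using p by auto
  have form: "(\<Sum>k\<in>{1..N}. (cmod (cinner (orbit n k) v))\<^sup>2) \<le> 4 * (norm v)\<^sup>2" for v N
    by (rule orbit_form_le) simp
  have lim: "(\<lambda>N. flat_norm (\<not> d) p {1..N} (orbit_op d n)) \<longlonglongrightarrow> seq_norm (flat_norm (\<not> d) p) (orbit_op d n)"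
    by (rule gram_norm_convergent[OF p(1)]) (rule orbit.pos_trace_gram_le_card[OF form s])
  have ge: "(4 powr (p/2 - 1) * (\<Sum>k\<in>{1..N}. (norm (orbit n k))\<^sup>2)) powr (1/p) \<le> flat_norm (\<not> d) p {1..N} (orbit_op d n)" for N
  proof -
    have "ennreal (4 powr (p/2 - 1) * (\<Sum>k\<in>{1..N}. (norm (orbit n k))\<^sup>2))
      \<le> ennreal (enn2real (trace_powr (gram {1..N} (orbit n)) (p/2)))"
      unfolding pos_trace_gram_orbit[OF p(1)] by (rule orbit.pos_trace_gram_ge[OF form s]) simp
    then show ?thesis
      unfolding gram_norm_orbit_op using p by (intro powr_mono2) (auto simp: sum_nonneg)
  qed
  have "(\<lambda>N. (4 powr (p/2 - 1) * (\<Sum>k\<in>{1..N}. (norm (orbit n k))\<^sup>2)) powr (1/p)) \<longlonglongrightarrow> gram_bound p n"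
    unfolding gram_bound_def
    by (intro tendsto_powr' tendsto_mult tendsto_const orbit_tendsto) (use p in \<open>auto simp: sum_nonneg\<close>)
  from LIMSEQ_le[OF this lim] ge show ?thesis by blast
qed

section \<open>Comparison of the two square functions\<close>

lemma orbit_const_powr_unbounded:
  assumes "0 < \<delta>" shows "\<exists>n. 0 < orbit_const n \<and> K < orbit_const n powr \<delta>"
proof -
  define t where "t = max K 0 powr (1/\<delta>)"
  obtain n :: nat where n: "4 * (t + 1) < real n" using reals_Archimedean2 by blast
  then have C: "t < orbit_const n" using orbit_const_ge[of n] by argo
  have "0 \<le> t" by (simp add: t_def)
  then have pos: "0 < orbit_const n" using C by linarith
  have "(max K 0 powr (1/\<delta>)) powr \<delta> < orbit_const n powr \<delta>"
    using C assms unfolding t_def by (intro powr_less_mono2) auto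
  then show ?thesis using pos assms by (auto simp: powr_powr)
qed

text \<open>Factoring out the Hilbertian norm leaves a constant and a power with exponent
  \<open>1/p - 1/2\<close>, whose sign decides which norm wins.\<close>

lemma gram_bound_eq:
  assumes "0 < p" "0 < orbit_const n"
  shows "gram_bound p n = 4 powr ((p/2 - 1) / p) * orbit_const n powr (1/p - 1/2) * sqrt (orbit_const n)"
  using assms by (simp add: gram_bound_def powr_mult powr_powr powr_half_sqrt[symmetric] flip: powr_add)

lemma gram_bound_small:
  assumes "2 < p" "0 < K" shows "\<exists>n. K * gram_bound p n < sqrt (orbit_const n)"
proof -
  let ?c = "4 powr ((p/2 - 1) / p) :: real"
  have d: "0 < 1/2 - 1/p" using assms by (simp add: field_simps)
  obtain n where n: "0 < orbit_const n" "K * ?c < orbit_const n powr (1/2 - 1/p)"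
    using orbit_const_powr_unbounded[OF d] by blast
  have "orbit_const n powr (1/2 - 1/p) * orbit_const n powr (1/p - 1/2) = 1"
    using n by (simp flip: powr_add)
  moreover have "K * ?c * orbit_const n powr (1/p - 1/2) < orbit_const n powr (1/2 - 1/p) * orbit_const n powr (1/p - 1/2)"
    using n by (intro mult_strict_right_mono) auto
  ultimately have "K * ?c * orbit_const n powr (1/p - 1/2) * sqrt (orbit_const n) < 1 * sqrt (orbit_const n)"
    using n by (intro mult_strict_right_mono) auto
  then show ?thesis using assms n by (intro exI[of _ n]) (simp add: gram_bound_eq mult.assoc)
qed

lemma gram_bound_large:
  assumes "0 < p" "p < 2" shows "\<exists>n. K * sqrt (orbit_const n) < gram_bound p n"
proof -
  let ?c = "4 powr ((p/2 - 1) / p) :: real"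
  have d: "0 < 1/p - 1/2" using assms by (simp add: field_simps)
  obtain n where n: "0 < orbit_const n" "K / ?c < orbit_const n powr (1/p - 1/2)"
    using orbit_const_powr_unbounded[OF d] by blast
  have "K < ?c * orbit_const n powr (1/p - 1/2)" using n(2) by (simp add: field_simps)
  then have "K * sqrt (orbit_const n) < ?c * orbit_const n powr (1/p - 1/2) * sqrt (orbit_const n)"
    using n by (intro mult_strict_right_mono) auto
  then show ?thesis using assms n by (intro exI[of _ n]) (simp add: gram_bound_eq)
qed

definition square_norm :: "bool \<Rightarrow> real \<Rightarrow> (nat op \<Rightarrow> nat op) \<Rightarrow> nat op \<Rightarrow> ennreal" where
  "square_norm d = (if d then column_square_norm else row_square_norm)"

lemma square_norm_eq:
  "square_norm d p T x = (if square_seq T x \<in> seq_space p (flat_norm d p)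
     then ennreal (seq_norm (flat_norm d p) (square_seq T x)) else \<infinity>)"
  by (simp add: square_norm_def flat_norm_def column_square_norm_def row_square_norm_def)

lemma square_norm_flat:
  "0 < p \<Longrightarrow> square_norm d p (ritt_mult d) (test_op d n) = ennreal (sqrt (orbit_const n))"
  by (simp add: square_norm_eq square_seq_test_op flat_seq_norm)

text \<open>The Gram norm stands in the denominator, so its finiteness, that is membership in the
  sequence space, matters as much as its upper bound.\<close>

lemma sup_quotient_infinite_gt_2:
  assumes p: "2 < p"
  shows "sup_quotient_infinite p (square_norm d p (ritt_mult d)) (square_norm (\<not> d) p (ritt_mult d))"
  unfolding sup_quotient_infinite_def
proof (intro notI, elim exE conjE)
  fix K :: real assume K: "0 < K"
    and le: "\<forall>x\<in>schatten p. square_norm d p (ritt_mult d) x \<le> ennreal K * square_norm (\<not> d) p (ritt_mult d) x"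
  obtain n where n: "K * gram_bound p n < sqrt (orbit_const n)" using gram_bound_small[OF p K] by blast
  have "square_norm (\<not> d) p (ritt_mult d) (test_op d n) \<le> ennreal (gram_bound p n)"
    using gram_seq_norm_le[OF p, of d n] by (simp add: square_norm_eq square_seq_test_op ennreal_leI)
  then have "ennreal K * square_norm (\<not> d) p (ritt_mult d) (test_op d n) \<le> ennreal (K * gram_bound p n)"
    using K by (simp add: ennreal_mult gram_bound_def mult_left_mono)
  moreover have "test_op d n \<in> schatten p" using p by (intro test_op_schatten) simp
  ultimately have "ennreal (sqrt (orbit_const n)) \<le> ennreal (K * gram_bound p n)"
    using le square_norm_flat[of p d n] p order.trans by fastforce
  then show False using n K by (simp add: gram_bound_def ennreal_le_iff)
qed

lemma sup_quotient_infinite_lt_2: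
  assumes p: "0 < p" "p < 2"
  shows "sup_quotient_infinite p (square_norm (\<not> d) p (ritt_mult d)) (square_norm d p (ritt_mult d))"
  unfolding sup_quotient_infinite_def
proof (intro notI, elim exE conjE)
  fix K :: real assume K: "0 < K"
    and le: "\<forall>x\<in>schatten p. square_norm (\<not> d) p (ritt_mult d) x \<le> ennreal K * square_norm d p (ritt_mult d) x"
  obtain n where n: "K * sqrt (orbit_const n) < gram_bound p n" using gram_bound_large[OF p] by blast
  have C: "0 \<le> orbit_const n" using orbit_const_ge[of n] by (meson divide_nonneg_pos of_nat_0_le_iff order.trans zero_less_numeral)
  \<comment> \<open>In the numerator a lower bound is enough: outside the sequence space the square
    function is infinite.\<close>
  have "ennreal (gram_bound p n) \<le> square_norm (\<not> d) p (ritt_mult d) (test_op d n)"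
    using gram_seq_norm_ge[OF p, of n d] by (simp add: square_norm_eq square_seq_test_op ennreal_leI)
  also have "\<dots> \<le> ennreal K * ennreal (sqrt (orbit_const n))"
    using le test_op_schatten[OF p(1)] square_norm_flat[OF p(1)] by metis
  also have "\<dots> = ennreal (K * sqrt (orbit_const n))" using K C by (simp add: ennreal_mult)
  finally show False using n K C by (simp add: ennreal_le_iff)
qed

theorem theorem1p2:
  fixes p :: real
  assumes "1 < p" and "p \<noteq> 2"
  shows "(\<exists>T :: nat op \<Rightarrow> nat op.
            ritt p T \<and> dense_range_I_minus p T \<and>
            (\<exists>\<gamma>. 0 < \<gamma> \<and> \<gamma> < pi / 2 \<and> cb_functional_calculus p \<gamma> T) \<and>
            (2 < p \<longrightarrow> sup_quotient_infinite p (column_square_norm p T) (row_square_norm p T)) \<and>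
            (p < 2 \<longrightarrow> sup_quotient_infinite p (row_square_norm p T) (column_square_norm p T))) \<and>
         (\<exists>T :: nat op \<Rightarrow> nat op.
            ritt p T \<and> dense_range_I_minus p T \<and>
            (\<exists>\<gamma>. 0 < \<gamma> \<and> \<gamma> < pi / 2 \<and> cb_functional_calculus p \<gamma> T) \<and>
            (2 < p \<longrightarrow> sup_quotient_infinite p (row_square_norm p T) (column_square_norm p T)) \<and>
            (p < 2 \<longrightarrow> sup_quotient_infinite p (column_square_norm p T) (row_square_norm p T)))"
proof -
  have p: "0 < p" using assms by simp
  have cb: "\<exists>\<gamma>. 0 < \<gamma> \<and> \<gamma> < pi / 2 \<and> cb_functional_calculus p \<gamma> (ritt_mult d)" for d
    using cb_functional_calculus_ritt_mult[OF p, of "pi / 4"] pi_gt_zero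
    by (intro exI[of _ "pi / 4"]) (auto simp: sin_45)
  note basic = ritt_ritt_mult[OF p] dense_range_ritt_mult[OF p] cb
  show ?thesis
    using sup_quotient_infinite_gt_2[of p True] sup_quotient_infinite_gt_2[of p False]
      sup_quotient_infinite_lt_2[OF p, of True] sup_quotient_infinite_lt_2[OF p, of False]
    by (intro conjI exI[of _ "ritt_mult True"] exI[of _ "ritt_mult False"] impI basic)
       (simp_all add: square_norm_def)
qed

end
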